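(* Let $Y$ be a homotopy polyhedron, let $A$ be a countable abelian group, and let $\alpha<\omega_1$. For every $d\geq 1$, $\mathrm{Ph}^{\alpha}\mathrm{H}^{d}(Y;A)$ is isomorphic to the group $\mathrm{Ph}^{\alpha}\mathrm{Ext}(\mathrm{H}_{d-1}(Y),A)$ parametrizing phantom extensions of $\mathrm{H}_{d-1}(Y)$ by $A$ of order at least $\alpha$.
   Context: A homotopy polyhedron is a space homotopy equivalent to the geometric realization $|K|$ of a countable locally finite simplicial complex $K$. Countable abelian groups are given the discrete topology. An abelian group with a Polish cover is a quotient $\hat G/N$ of an abelian Polish group $\hat G$ by a Polishable subgroup $N$ (a subgroup that is Polish in a topology making the inclusion continuous); morphisms are homomorphisms induced by Borel functions between the covers. These form an abelian category, in which isomorphism is meant. $\mathrm{H}_\bullet(Y)$ is integral homology; $\mathrm{H}^\bullet(Y;A)$ is the cohomology, as a group with a Polish cover, of the complex of Polish groups $\mathrm{Hom}(C_\bullet(K),A)$ (product topology), where $C_\bullet(K)$ is the ordered simplicial chain complex and $Y\simeq|K|$. For countable abelian groups $C,A$ with $0\to R\to F\to C\to 0$ exact and $F,R$ countable free, $\mathrm{Ext}(C,A)$ is the group with a Polish cover $\mathrm{Hom}(R,A)/\mathrm{Ran}(\mathrm{Hom}(F,A)\to\mathrm{Hom}(R,A))$; its elements correspond to isomorphism classes of extensions of $C$ by $A$. Phantom subgroups: for $G=\hat G/N$ and $\alpha<\omega_1$, $\mathrm{Ph}^\alpha(G)=L/N$ where $L$ is the smallest Polishable subgroup of $\hat G$ that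 contains $N$ and is $\boldsymbol\Pi^0_{1+\alpha+1}$ in $\hat G$. The extensions of $C$ by $A$ that are phantom (pure) of order at least $\alpha$ are those whose class lies in $\mathrm{Ph}^\alpha\mathrm{Ext}(C,A)$. *)

theory Defs
  imports "HOL-Analysis.Analysis" "HOL-Homology.Homology"
begin

section \<open>Countable ordinals\<close>

text \<open>Up to isomorphism, \<open>cardSuc natLeq\<close> is the well-order \<open>\<omega>\<^sub>1\<close>, so the elements of its
  field are the ordinals below \<open>\<omega>\<^sub>1\<close>.\<close>

lemma infinite_Field_cardSuc_natLeq: "infinite (Field (cardSuc natLeq))"
  by (metis Field_natLeq cardSuc_finite infinite_UNIV_nat natLeq_Card_order)

lemma well_order_cardSuc_natLeq: "Well_order (cardSuc natLeq)"
  using cardSuc_Card_order[OF natLeq_Card_order] card_order_on_well_order_on by blast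

typedef omega1 = "Field (cardSuc natLeq)"
  using infinite_Field_cardSuc_natLeq by (metis ex_in_conv finite.emptyI)

instantiation omega1 :: wellorder
begin

definition less_eq_omega1 :: "omega1 \<Rightarrow> omega1 \<Rightarrow> bool" where
  "\<alpha> \<le> \<beta> \<longleftrightarrow> (Rep_omega1 \<alpha>, Rep_omega1 \<beta>) \<in> cardSuc natLeq"

definition less_omega1 :: "omega1 \<Rightarrow> omega1 \<Rightarrow> bool" where
  "\<alpha> < \<beta> \<longleftrightarrow> \<alpha> \<le> \<beta> \<and> \<not> \<beta> \<le> (\<alpha> :: omega1)"

instance
proof
  have wo: "well_order_on (Field (cardSuc natLeq)) (cardSuc natLeq)"
    by (rule well_order_cardSuc_natLeq)
  then have lin: "linear_order_on (Field (cardSuc natLeq)) (cardSuc natLeq)"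
    and wf: "wf (cardSuc natLeq - Id)"
    by (auto simp: well_order_on_def)
  then have tr: "trans (cardSuc natLeq)" and rf: "refl_on (Field (cardSuc natLeq)) (cardSuc natLeq)"
    and an: "antisym (cardSuc natLeq)" and tot: "total_on (Field (cardSuc natLeq)) (cardSuc natLeq)"
    by (auto simp: linear_order_on_def partial_order_on_def preorder_on_def)
  fix x y z :: omega1
  show "x < y \<longleftrightarrow> x \<le> y \<and> \<not> y \<le> x" by (simp add: less_omega1_def)
  show "x \<le> x" using rf Rep_omega1 by (auto simp: less_eq_omega1_def refl_on_def)
  show "x \<le> z" if "x \<le> y" "y \<le> z"
    using that tr by (auto simp: less_eq_omega1_def dest: transD)
  show anti: "x = y" if "x \<le> y" "y \<le> x" for x y :: omega1
    using that an by (auto simp: less_eq_omega1_def Rep_omega1_inject dest: antisymD)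
  show "x \<le> y \<or> y \<le> x"
    using tot rf Rep_omega1[of x] Rep_omega1[of y]
    unfolding less_eq_omega1_def total_on_def refl_on_def by metis
  fix P :: "omega1 \<Rightarrow> bool" and a :: omega1
  assume step: "\<And>x. (\<And>y. y < x \<Longrightarrow> P y) \<Longrightarrow> P x"
  have "wf (inv_image (cardSuc natLeq - Id) Rep_omega1)" using wf by (rule wf_inv_image)
  moreover have "{(x, y). x < (y :: omega1)} \<subseteq> inv_image (cardSuc natLeq - Id) Rep_omega1"
    by (auto simp: inv_image_def less_omega1_def less_eq_omega1_def)
  ultimately have "wf {(x, y). x < (y :: omega1)}" by (rule wf_subset)
  then show "P a" by (induction a rule: wf_induct_rule) (use step in auto)
qed

end

lemma omega1_no_greatest: "\<exists>\<beta>. (\<alpha> :: omega1) < \<beta>"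
proof -
  obtain b where b: "b \<in> Field (cardSuc natLeq)" "Rep_omega1 \<alpha> \<noteq> b"
      "(Rep_omega1 \<alpha>, b) \<in> cardSuc natLeq"
    using infinite_Card_order_limit[OF cardSuc_Card_order[OF natLeq_Card_order]
        infinite_Field_cardSuc_natLeq Rep_omega1] by blast
  then have "\<alpha> \<le> Abs_omega1 b" "\<alpha> \<noteq> Abs_omega1 b"
    by (auto simp: less_eq_omega1_def Abs_omega1_inverse)
  then show ?thesis by (metis order_less_le)
qed

definition omega1_succ :: "omega1 \<Rightarrow> omega1" where
  "omega1_succ \<alpha> = (LEAST \<beta>. \<alpha> < \<beta>)"

lemma less_omega1_succ_iff: "\<beta> < omega1_succ \<alpha> \<longleftrightarrow> \<beta> \<le> \<alpha>"
  unfolding omega1_succ_def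
  by (metis LeastI_ex Least_le leD leI omega1_no_greatest order_le_less_trans)

section \<open>The Borel hierarchy\<close>

text \<open>The index is shifted: \<open>Sigma0 T \<alpha>\<close> and \<open>Pi0 T \<alpha>\<close> are the classes
  \<open>\<Sigma>\<^sup>0\<close> and \<open>\<Pi>\<^sup>0\<close> of index \<open>1 + \<alpha>\<close> in the space \<open>T\<close>. At the least index,
  \<open>Sigma0\<close> consists of the open sets.\<close>

inductive Sigma0 Pi0 :: "'a topology \<Rightarrow> omega1 \<Rightarrow> 'a set \<Rightarrow> bool" for T :: "'a topology" where
  Sigma0_open: "\<lbrakk>\<nexists>\<beta>. \<beta> < \<alpha>; openin T U\<rbrakk> \<Longrightarrow> Sigma0 T \<alpha> U"
| Sigma0_Union: "(\<And>n :: nat. \<beta> n < \<alpha> \<and> Pi0 T (\<beta> n) (X n)) \<Longrightarrow> Sigma0 T \<alpha> (\<Union>n. X n)"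
| Pi0_compl: "Sigma0 T \<alpha> U \<Longrightarrow> Pi0 T \<alpha> (topspace T - U)"

definition borel_of :: "'a topology \<Rightarrow> 'a measure" where
  "borel_of T = sigma (topspace T) {U. openin T U}"

section \<open>Groups with a Polish cover\<close>

definition abelian_polish_group :: "('a, 'm) monoid_scheme \<Rightarrow> 'a topology \<Rightarrow> bool" where
  "abelian_polish_group G T \<longleftrightarrow>
     comm_group G \<and> topspace T = carrier G \<and>
     completely_metrizable_space T \<and> second_countable T \<and>
     continuous_map (prod_topology T T) T (\<lambda>(x, y). x \<otimes>\<^bsub>G\<^esub> y) \<and>
     continuous_map T T (\<lambda>x. inv\<^bsub>G\<^esub> x)"

definition polish_subgroup_topology ::
  "('a, 'm) monoid_scheme \<Rightarrow> 'a topology \<Rightarrow> 'a set \<Rightarrow> 'a topology \<Rightarrow> bool" where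
  "polish_subgroup_topology G T L S \<longleftrightarrow>
     abelian_polish_group (G\<lparr>carrier := L\<rparr>) S \<and> continuous_map S T (\<lambda>x. x)"

definition polishable_subgroup :: "('a, 'm) monoid_scheme \<Rightarrow> 'a topology \<Rightarrow> 'a set \<Rightarrow> bool" where
  "polishable_subgroup G T L \<longleftrightarrow> subgroup L G \<and> (\<exists>S. polish_subgroup_topology G T L S)"

text \<open>The Polish topology of a Polishable subgroup is unique. The subspace topology is a dummy
  value for subgroups that are not Polishable.\<close>

definition polishable_topology ::
  "('a, 'm) monoid_scheme \<Rightarrow> 'a topology \<Rightarrow> 'a set \<Rightarrow> 'a topology" where
  "polishable_topology G T L =
     (if polishable_subgroup G T L then SOME S. polish_subgroup_topology G T L S
      else subtopology T L)"

text \<open>A record \<open>G\<close> of the following type presents the group \<open>G Mod cover_kernel G\<close> with cover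
  \<open>G\<close>, topologized by \<open>cover_topology G\<close>.\<close>

record 'a polish_cover = "'a monoid" +
  cover_topology :: "'a topology"
  cover_kernel :: "'a set"

abbreviation covered_group :: "'a polish_cover \<Rightarrow> 'a set monoid" where
  "covered_group G \<equiv> G Mod cover_kernel G"

definition polish_cover_hom :: "'a polish_cover \<Rightarrow> 'b polish_cover \<Rightarrow> ('a set \<Rightarrow> 'b set) set" where
  "polish_cover_hom G H =
     {\<phi> \<in> hom (covered_group G) (covered_group H).
        \<exists>f \<in> borel_of (cover_topology G) \<rightarrow>\<^sub>M borel_of (cover_topology H).
          \<forall>x \<in> carrier G. \<phi> (cover_kernel G #>\<^bsub>G\<^esub> x) = cover_kernel H #>\<^bsub>H\<^esub> f x}"

definition polish_cover_isomorphic :: "'a polish_cover \<Rightarrow> 'b polish_cover \<Rightarrow> bool"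
  (infix \<open>\<cong>\<^sub>P\<close> 50) where
  "G \<cong>\<^sub>P H \<longleftrightarrow>
     (\<exists>\<phi> \<in> polish_cover_hom G H. \<exists>\<psi> \<in> polish_cover_hom H G.
        (\<forall>X \<in> carrier (covered_group G). \<psi> (\<phi> X) = X) \<and>
        (\<forall>X \<in> carrier (covered_group H). \<phi> (\<psi> X) = X))"

section \<open>Phantom subgroups\<close>

text \<open>\<open>P hull N\<close> is the intersection of all sets with property \<open>P\<close> that contain \<open>N\<close>, hence
  the smallest such set whenever there is one; see \<open>phantom_carrier_eq\<close> below.\<close>

definition phantom_carrier :: "omega1 \<Rightarrow> 'a polish_cover \<Rightarrow> 'a set" where
  "phantom_carrier \<alpha> G =
     (\<lambda>L. polishable_subgroup G (cover_topology G) L \<and>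
          Pi0 (cover_topology G) (omega1_succ \<alpha>) L) hull cover_kernel G"

definition Ph :: "omega1 \<Rightarrow> 'a polish_cover \<Rightarrow> 'a polish_cover" where
  "Ph \<alpha> G = G\<lparr>carrier := phantom_carrier \<alpha> G,
     cover_topology := polishable_topology G (cover_topology G) (phantom_carrier \<alpha> G)\<rparr>"

lemma phantom_carrier_eq:
  assumes "polishable_subgroup G (cover_topology G) L"
    and "Pi0 (cover_topology G) (omega1_succ \<alpha>) L" and "cover_kernel G \<subseteq> L"
    and "\<And>M. \<lbrakk>polishable_subgroup G (cover_topology G) M;
               Pi0 (cover_topology G) (omega1_succ \<alpha>) M; cover_kernel G \<subseteq> M\<rbrakk> \<Longrightarrow> L \<subseteq> M"
  shows "phantom_carrier \<alpha> G = L"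
  unfolding phantom_carrier_def by (rule hull_unique) (use assms in auto)

section \<open>Groups of homomorphisms and Ext\<close>

definition hom_group :: "('c, 'm) monoid_scheme \<Rightarrow> ('a, 'n) monoid_scheme \<Rightarrow> ('c \<Rightarrow> 'a) monoid" where
  "hom_group C A =
     \<lparr>carrier = hom C A \<inter> extensional (carrier C),
      monoid.mult = (\<lambda>f g. \<lambda>x\<in>carrier C. f x \<otimes>\<^bsub>A\<^esub> g x),
      one = (\<lambda>x\<in>carrier C. \<one>\<^bsub>A\<^esub>)\<rparr>"

definition hom_topology ::
  "('c, 'm) monoid_scheme \<Rightarrow> ('a, 'n) monoid_scheme \<Rightarrow> ('c \<Rightarrow> 'a) topology" where
  "hom_topology C A =
     subtopology (product_topology (\<lambda>_. discrete_topology (carrier A)) (carrier C))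
       (carrier (hom_group C A))"

definition free_abelian :: "'f monoid \<Rightarrow> bool" where
  "free_abelian F \<longleftrightarrow> comm_group F \<and> (\<exists>S :: 'f set. F \<cong> free_Abelian_group S)"

definition free_resolution ::
  "'r monoid \<Rightarrow> ('r \<Rightarrow> 'f) \<Rightarrow> 'f monoid \<Rightarrow> ('f \<Rightarrow> 'c) \<Rightarrow> 'c monoid \<Rightarrow> bool" where
  "free_resolution R i F p C \<longleftrightarrow>
     free_abelian R \<and> countable (carrier R) \<and> free_abelian F \<and> countable (carrier F) \<and>
     i \<in> mon R F \<and> p \<in> epi F C \<and> i ` carrier R = kernel F C p"

text \<open>\<open>Ext_cover R i F A\<close> is Ext(C,A), computed from a free resolution
  \<open>free_resolution R i F p C\<close>.\<close>

definition Ext_cover ::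
  "'r monoid \<Rightarrow> ('r \<Rightarrow> 'f) \<Rightarrow> 'f monoid \<Rightarrow> 'a monoid \<Rightarrow> ('r \<Rightarrow> 'a) polish_cover" where
  "Ext_cover R i F A =
     \<lparr>carrier = carrier (hom_group R A),
      monoid.mult = monoid.mult (hom_group R A),
      one = one (hom_group R A),
      cover_topology = hom_topology R A,
      cover_kernel = (\<lambda>h. \<lambda>x\<in>carrier R. h (i x)) ` carrier (hom_group F A)\<rparr>"

section \<open>Simplicial complexes and their cohomology\<close>

definition abstract_simplicial_complex :: "'v set set \<Rightarrow> bool" where
  "abstract_simplicial_complex K \<longleftrightarrow>
     (\<forall>\<sigma>\<in>K. finite \<sigma> \<and> \<sigma> \<noteq> {} \<and> (\<forall>\<tau>. \<tau> \<subseteq> \<sigma> \<and> \<tau> \<noteq> {} \<longrightarrow> \<tau> \<in> K))"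

definition locally_finite_complex :: "'v set set \<Rightarrow> bool" where
  "locally_finite_complex K \<longleftrightarrow> (\<forall>v. finite {\<sigma>\<in>K. v \<in> \<sigma>})"

text \<open>Points are given by their barycentric coordinates; the topology is the weak topology
  determined by the closed simplices.\<close>

definition realization_simplex :: "'v set \<Rightarrow> ('v \<Rightarrow> real) set" where
  "realization_simplex \<sigma> =
     {t. (\<forall>v. 0 \<le> t v) \<and> (\<forall>v. v \<notin> \<sigma> \<longrightarrow> t v = 0) \<and> (\<Sum>v\<in>\<sigma>. t v) = 1}"

definition realization_open :: "'v set set \<Rightarrow> ('v \<Rightarrow> real) set \<Rightarrow> bool" where
  "realization_open K U \<longleftrightarrow>
     U \<subseteq> (\<Union>\<sigma>\<in>K. realization_simplex \<sigma>) \<and>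
     (\<forall>\<sigma>\<in>K. openin (subtopology (powertop_real UNIV) (realization_simplex \<sigma>))
                   (U \<inter> realization_simplex \<sigma>))"

definition geometric_realization :: "'v set set \<Rightarrow> ('v \<Rightarrow> real) topology" where
  "geometric_realization K = topology (realization_open K)"

lemma openin_geometric_realization:
  "openin (geometric_realization K) = realization_open K"
proof -
  have "istopology (realization_open K)"
    unfolding istopology_def
  proof (intro conjI allI impI)
    fix S T assume "realization_open K S" "realization_open K T"
    note ST = this
    show "realization_open K (S \<inter> T)"
      unfolding realization_open_def
    proof (intro conjI ballI)
      show "S \<inter> T \<subseteq> (\<Union>\<sigma>\<in>K. realization_simplex \<sigma>)"
        using ST unfolding realization_open_def by blast
    next
      fix \<sigma> assume \<sigma>: "\<sigma> \<in> K"
      have "openin (subtopology (powertop_real UNIV) (realization_simplex \<sigma>))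
          ((S \<inter> realization_simplex \<sigma>) \<inter> (T \<inter> realization_simplex \<sigma>))"
        by (rule openin_Int) (use ST \<sigma> in \<open>auto simp: realization_open_def\<close>)
      moreover have "(S \<inter> realization_simplex \<sigma>) \<inter> (T \<inter> realization_simplex \<sigma>) =
          S \<inter> T \<inter> realization_simplex \<sigma>"
        by blast
      ultimately show "openin (subtopology (powertop_real UNIV) (realization_simplex \<sigma>))
          (S \<inter> T \<inter> realization_simplex \<sigma>)"
        by metis
    qed
  next
    fix \<U> assume *: "\<forall>S\<in>\<U>. realization_open K S"
    show "realization_open K (\<Union>\<U>)"
      unfolding realization_open_def
    proof (intro conjI ballI)
      show "\<Union>\<U> \<subseteq> (\<Union>\<sigma>\<in>K. realization_simplex \<sigma>)"
        using * unfolding realization_open_def by blast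
    next
      fix \<sigma> assume \<sigma>: "\<sigma> \<in> K"
      have "openin (subtopology (powertop_real UNIV) (realization_simplex \<sigma>))
          (\<Union>((\<lambda>S. S \<inter> realization_simplex \<sigma>) ` \<U>))"
        by (rule openin_Union) (use * \<sigma> in \<open>auto simp: realization_open_def\<close>)
      moreover have "\<Union>((\<lambda>S. S \<inter> realization_simplex \<sigma>) ` \<U>) = \<Union>\<U> \<inter> realization_simplex \<sigma>"
        by blast
      ultimately show "openin (subtopology (powertop_real UNIV) (realization_simplex \<sigma>))
          (\<Union>\<U> \<inter> realization_simplex \<sigma>)"
        by metis
    qed
  qed
  then show ?thesis by (simp add: geometric_realization_def topology_inverse')
qed

lemma topspace_geometric_realization:
  "topspace (geometric_realization K) = (\<Union>\<sigma>\<in>K. realization_simplex \<sigma>)"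
proof
  show "topspace (geometric_realization K) \<subseteq> (\<Union>\<sigma>\<in>K. realization_simplex \<sigma>)"
    by (auto simp: topspace_def openin_geometric_realization realization_open_def)
  have "(\<Union>\<sigma>\<in>K. realization_simplex \<sigma>) \<inter> realization_simplex \<sigma> = realization_simplex \<sigma>"
    if "\<sigma> \<in> K" for \<sigma>
    using that by blast
  then have "realization_open K (\<Union>\<sigma>\<in>K. realization_simplex \<sigma>)"
    by (auto simp: realization_open_def openin_subtopology_refl)
  then show "(\<Union>\<sigma>\<in>K. realization_simplex \<sigma>) \<subseteq> topspace (geometric_realization K)"
    by (metis openin_geometric_realization openin_subset)
qed

text \<open>Ordered simplices are tuples of vertices spanning a simplex, repetitions being allowed.\<close>

definition ordered_simplices :: "'v set set \<Rightarrow> nat \<Rightarrow> 'v list set" where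
  "ordered_simplices K n = {s. length s = Suc n \<and> set s \<in> K}"

definition ordered_chains :: "'v set set \<Rightarrow> nat \<Rightarrow> ('v list \<Rightarrow>\<^sub>0 int) monoid" where
  "ordered_chains K n = free_Abelian_group (ordered_simplices K n)"

text \<open>The boundary \<open>C\<^sub>n\<^sub>+\<^sub>1(K) \<rightarrow> C\<^sub>n(K)\<close>.\<close>

definition ordered_boundary :: "nat \<Rightarrow> ('v list \<Rightarrow>\<^sub>0 int) \<Rightarrow> ('v list \<Rightarrow>\<^sub>0 int)" where
  "ordered_boundary n =
     frag_extend (\<lambda>s. \<Sum>j\<le>Suc n. frag_cmul ((-1) ^ j) (frag_of (take j s @ drop (Suc j) s)))"

definition coboundary ::
  "'v set set \<Rightarrow> nat \<Rightarrow> (('v list \<Rightarrow>\<^sub>0 int) \<Rightarrow> 'a) \<Rightarrow> (('v list \<Rightarrow>\<^sub>0 int) \<Rightarrow> 'a)" where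
  "coboundary K n f = (\<lambda>c\<in>carrier (ordered_chains K (Suc n)). f (ordered_boundary n c))"

definition cocycles :: "'v set set \<Rightarrow> 'a monoid \<Rightarrow> nat \<Rightarrow> (('v list \<Rightarrow>\<^sub>0 int) \<Rightarrow> 'a) set" where
  "cocycles K A n =
     {f \<in> carrier (hom_group (ordered_chains K n) A).
        coboundary K n f = \<one>\<^bsub>hom_group (ordered_chains K (Suc n)) A\<^esub>}"

definition coboundaries :: "'v set set \<Rightarrow> 'a monoid \<Rightarrow> nat \<Rightarrow> (('v list \<Rightarrow>\<^sub>0 int) \<Rightarrow> 'a) set" where
  "coboundaries K A n =
     (case n of
        0 \<Rightarrow> {\<one>\<^bsub>hom_group (ordered_chains K 0) A\<^esub>}
      | Suc m \<Rightarrow> coboundary K m ` carrier (hom_group (ordered_chains K m) A))"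

definition cohomology_cover ::
  "'v set set \<Rightarrow> 'a monoid \<Rightarrow> nat \<Rightarrow> (('v list \<Rightarrow>\<^sub>0 int) \<Rightarrow> 'a) polish_cover" where
  "cohomology_cover K A n =
     \<lparr>carrier = cocycles K A n,
      monoid.mult = monoid.mult (hom_group (ordered_chains K n) A),
      one = one (hom_group (ordered_chains K n) A),
      cover_topology = subtopology (hom_topology (ordered_chains K n) A) (cocycles K A n),
      cover_kernel = coboundaries K A n\<rparr>"

end

(* Write C, Z, B for the ordered simplicial chains, cycles and boundaries of |K| in degree d - 1. A cocycle
   of degree d vanishes on boundaries, and those that vanish on all cycles form a closed subgroup W containing
   the coboundaries; W modulo coboundaries is Ext(H, A) computed from the resolution B -> Z -> H of the homology
   H in degree d - 1. Comparing this resolution with the given R -> F -> H yields continuous homomorphisms in both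
   directions that are inverse to each other modulo the kernels of the covers. Closed subgroups satisfy every
   complexity bound in the definition of Ph, so Ph of the cohomology lies in W. Preimages under continuous
   homomorphisms preserve Polishability and complexity, so the two phantom subgroups correspond; a Polishable
   subgroup carries a unique Polish group topology, by a Baire category argument, so the correspondence is
   continuous for their topologies.

   That H is the singular homology of |K|: sending a small singular simplex to the list of the dominant vertices
   (largest barycentric coordinate) of its corners is a chain map from sufficiently subdivided singular chains to
   ordered chains. Its composites with the affine realization are homotopic to the identity, by acyclic carriers
   on one side and by straight-line homotopies within the barycentric stars on the other. *)

theory Submission
  imports Defs
begin

no_notation eq_closure_of (\<open>closure'_of\<index>\<close>)

text \<open>The maps between the covers are given on cochains, so the algebra needs honest
  splittings: lifts between the two resolutions, a section of the boundary onto \<open>B\<close>,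
  and a retraction of the chains onto \<open>Z\<close>. They exist because \<open>Z\<close> and
  \<open>B\<close> are subgroups of a free abelian group of countable rank, hence free. The maps of
  cochains are then precompositions, continuous for pointwise convergence.

  The phantom subgroups carry topologies obtained by choice. A preimage of a Polishable subgroup
  receives the topology of a graph, Polish because the graph is closed, and uniqueness identifies it
  with the chosen one.

  The dominant vertex jumps from point to point, so passing to vertex lists is not induced by a
  continuous self-map of |K|. The straight-line homotopies are therefore given simplex by simplex,
  compatibly with faces, and applied to one universal triangulated prism in each dimension;
  contractibility of the cylinders provides these prisms. Their continuity is checked
  coordinatewise, which is where local finiteness enters: it makes the weak topology of |K| the
  topology of pointwise convergence.\<close>

section \<open>Uniqueness of Polish group topologies\<close>

text \<open>Otherwise, interlacing points of two \<open>S\<close>-open sets that are both \<open>T\<close>-dense in a \<open>T\<close>-open set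
  yields two sequences with distinct limits in \<open>S\<close> but equal limits in \<open>T\<close>.\<close>

lemma nearly_open_imp_topology_eq:
  assumes S: "completely_metrizable_space S" and T: "Hausdorff_space T"
    and top: "topspace S = topspace T"
    and cont: "continuous_map S T (\<lambda>x. x)"
    and near: "\<And>U. openin S U \<Longrightarrow> U \<subseteq> T interior_of (T closure_of U)"
  shows "S = T"
proof -
  obtain M d where M: "Metric_space M d" and mc: "Metric_space.mcomplete M d"
    and Seq: "S = Metric_space.mtopology M d"
    using S unfolding completely_metrizable_space_def by blast
  interpret Metric_space M d by (rule M)
  have topS: "topspace S = M" by (simp add: Seq)
  have T_S: "openin S U" if "openin T U" for U
  proof -
    have "openin S {x \<in> topspace S. x \<in> U}"
      by (rule openin_continuous_map_preimage[OF cont that])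
    moreover have "{x \<in> topspace S. x \<in> U} = U"
      using openin_subset[OF that] top by auto
    ultimately show ?thesis by simp
  qed
  have small: "\<exists>W. openin S W \<and> x \<in> W \<and> S closure_of W \<subseteq> A \<and> (\<exists>a. S closure_of W \<subseteq> mcball a e)"
    if A: "openin S A" "x \<in> A" and e: "0 < e" for A x e
  proof -
    obtain r where r: "r > 0" "mcball x r \<subseteq> A"
      using A openin_mtopology_mcball unfolding Seq by blast
    let ?r = "min r e"
    have "mball x ?r \<subseteq> mcball x ?r" by auto
    then have "S closure_of (mball x ?r) \<subseteq> mcball x ?r"
      unfolding Seq by (intro closure_of_minimal) auto
    moreover have "mcball x ?r \<subseteq> A" "mcball x ?r \<subseteq> mcball x e"
      using r(2) mcball_subset_concentric[of ?r r x] mcball_subset_concentric[of ?r e x] by auto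
    moreover have "x \<in> M" using A openin_subset topS by blast
    ultimately show ?thesis
      using r(1) e by (intro exI[of _ "mball x ?r"]) (auto simp: Seq)
  qed
  have sub_cl: "W \<subseteq> S closure_of W" if "openin S W" for W
    using closure_of_subset[OF openin_subset[OF that]] .
  have key: False
    if B: "openin S B" and D: "openin S D"
      and disj: "S closure_of B \<inter> S closure_of D = {}"
      and y: "y \<in> T interior_of (T closure_of B)" "y \<in> T interior_of (T closure_of D)" for B D y
  proof -
    \<comment> \<open>A stage consists of two \<open>S\<close>-open sets and a \<open>T\<close>-open
      \<open>V\<close> in which both are \<open>T\<close>-dense. The radius bound starts at stage 1,
      since the given \<open>B\<close> and \<open>D\<close> may be large.\<close>
    define P where "P = (\<lambda>n (B, D, V). openin S B \<and> openin S D \<and> openin T V \<and> V \<noteq> {} \<and>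
        V \<subseteq> T closure_of B \<and> V \<subseteq> T closure_of D \<and>
        (n > 0 \<longrightarrow> (\<exists>a. S closure_of B \<subseteq> mcball a (inverse (real n))) \<and>
                   (\<exists>a. S closure_of D \<subseteq> mcball a (inverse (real n)))))"
    define Q where "Q = (\<lambda>n::nat. \<lambda>(B, D, V :: 'a set) (B', D', V' :: 'a set).
        S closure_of B' \<subseteq> S closure_of B \<and> S closure_of D' \<subseteq> S closure_of D)"
    define z0 where "z0 = (B, D, T interior_of (T closure_of B) \<inter> T interior_of (T closure_of D))"
    have P0: "P 0 z0"
      unfolding P_def z0_def using B D y interior_of_subset[of T "T closure_of B"]
        interior_of_subset[of T "T closure_of D"] by auto
    have "\<exists>z. P (Suc n) z \<and> Q n x z" if "P n x" for x n
    proof -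
      obtain B D V where x: "x = (B, D, V)" by (cases x)
      have P: "openin S B" "openin S D" "openin T V" "V \<noteq> {}" "V \<subseteq> T closure_of B" "V \<subseteq> T closure_of D"
        using that by (auto simp: P_def x)
      have pos: "0 < inverse (real (Suc n))" by simp
      have "V \<inter> B \<noteq> {}"
        using openin_Int_closure_of_eq_empty[OF P(3), of B] P(4,5) by blast
      then obtain b where b: "b \<in> V \<inter> B" by blast
      have "openin S (V \<inter> B)" using T_S P by blast
      then obtain B' a where B': "openin S B'" "b \<in> B'" "S closure_of B' \<subseteq> V \<inter> B"
        "S closure_of B' \<subseteq> mcball a (inverse (real (Suc n)))"
        using small[OF _ b pos] by blast
      \<comment> \<open>\<open>D\<close> is shrunk inside \<open>V1\<close> rather than
        \<open>V\<close>, so that the final \<open>V2\<close> lies in the \<open>T\<close>-closures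
        of both new sets.\<close>
      define V1 where "V1 = T interior_of (T closure_of B') \<inter> V"
      have V1: "openin T V1" "b \<in> V1" "V1 \<subseteq> V" "V1 \<subseteq> T closure_of B'"
        using near[OF B'(1)] B'(2) b P(3) interior_of_subset[of T "T closure_of B'"]
        by (auto simp: V1_def)
      have "V1 \<inter> D \<noteq> {}"
        using openin_Int_closure_of_eq_empty[OF V1(1), of D] P(6) V1 by blast
      then obtain e where e: "e \<in> V1 \<inter> D" by blast
      have "openin S (V1 \<inter> D)" using T_S P V1 by blast
      then obtain D' a' where D': "openin S D'" "e \<in> D'" "S closure_of D' \<subseteq> V1 \<inter> D"
        "S closure_of D' \<subseteq> mcball a' (inverse (real (Suc n)))"
        using small[OF _ e pos] by blast
      define V2 where "V2 = T interior_of (T closure_of D') \<inter> V1"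
      have V2: "openin T V2" "e \<in> V2" "V2 \<subseteq> V1" "V2 \<subseteq> T closure_of D'"
        using near[OF D'(1)] D'(2) e V1(1) interior_of_subset[of T "T closure_of D'"]
        by (auto simp: V2_def)
      have "P (Suc n) (B', D', V2)"
        using B' D' V1 V2 unfolding P_def by auto
      moreover have "Q n x (B', D', V2)"
        using B'(3) D'(3) sub_cl[OF P(1)] sub_cl[OF P(2)] by (auto simp: Q_def x)
      ultimately show ?thesis by blast
    qed
    note step = this
    have "\<exists>f. \<forall>n. (P n (f n) \<and> (n = 0 \<longrightarrow> f n = z0)) \<and> Q n (f n) (f (Suc n))"
    proof (intro dependent_nat_choice)
      show "\<exists>x. P 0 x \<and> (0 = (0::nat) \<longrightarrow> x = z0)" using P0 by blast
    next
      fix x n assume "P n x \<and> (n = 0 \<longrightarrow> x = z0)"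
      then obtain z where "P (Suc n) z" "Q n x z" using step by blast
      then show "\<exists>y. (P (Suc n) y \<and> (Suc n = 0 \<longrightarrow> y = z0)) \<and> Q n x y" by blast
    qed
    then obtain f where f': "\<And>n. P n (f n)" "\<And>n. Q n (f n) (f (Suc n))" "f 0 = z0"
      by blast
    define b e V where "b = (\<lambda>n. fst (f n))" and "e = (\<lambda>n. fst (snd (f n)))" and "V = (\<lambda>n. snd (snd (f n)))"
    then have "f n = (b n, e n, V n)" for n by simp
    with f' have f: "\<And>n. P n (b n, e n, V n)"
      "\<And>n. Q n (b n, e n, V n) (b (Suc n), e (Suc n), V (Suc n))" "b 0 = B" "e 0 = D"
      by (simp_all add: z0_def)
    \<comment> \<open>Cantor's intersection theorem in the complete metric of \<open>S\<close>, with
      the addition that every \<open>S\<close>-neighbourhood of the common point contains the sets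
      from some stage on.\<close>
    have lim: "\<exists>l. l \<in> M \<and> (\<forall>n. l \<in> S closure_of (c n)) \<and>
        (\<forall>U. openin S U \<and> l \<in> U \<longrightarrow> (\<exists>n. \<forall>m\<ge>n. c m \<subseteq> U))"
      if c: "\<And>n. openin S (c n)" "\<And>n. c n \<noteq> {}" "\<And>n. S closure_of (c (Suc n)) \<subseteq> S closure_of (c n)"
        "\<And>n. n > 0 \<Longrightarrow> \<exists>a. S closure_of (c n) \<subseteq> mcball a (inverse (real n))" for c
    proof -
      have "decseq (\<lambda>n. S closure_of (c n))" using c(3) by (simp add: decseq_SucI)
      moreover have "\<exists>n a. S closure_of (c n) \<subseteq> mcball a \<epsilon>" if eps: "\<epsilon> > 0" for \<epsilon>
      proof -
        obtain n where n: "n > 0" "inverse (real n) < \<epsilon>"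
          using ex_inverse_of_nat_less[OF eps] by blast
        then show ?thesis
          using c(4)[OF n(1)] mcball_subset_concentric[of "inverse (real n)" \<epsilon>] by (meson less_imp_le subset_trans)
      qed
      moreover have "S closure_of (c n) \<noteq> {}" for n using c(2)[of n] sub_cl[OF c(1)] by blast
      moreover have "closedin mtopology (S closure_of (c n))" for n by (simp add: Seq)
      ultimately have "\<Inter>(range (\<lambda>n. S closure_of (c n))) \<noteq> {}"
        using mc[unfolded mcomplete_nest, rule_format, of "\<lambda>n. S closure_of (c n)"] by blast
      then obtain l where l: "\<And>n. l \<in> S closure_of (c n)" by blast
      then have "l \<in> M" using topS in_closure_of by metis
      moreover have "\<exists>n. \<forall>m\<ge>n. c m \<subseteq> U" if U: "openin S U" "l \<in> U" for U
      proof -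
        obtain r where r: "r > 0" "mball l r \<subseteq> U"
          using U openin_mtopology unfolding Seq by blast
        obtain n where n: "n > 0" "inverse (real n) < r / 2"
          using ex_inverse_of_nat_less[of "r/2"] r by auto
        have "c m \<subseteq> U" if "m \<ge> n" for m
        proof
          fix z assume z: "z \<in> c m"
          have "m > 0" using n that by simp
          then obtain a where a: "S closure_of (c m) \<subseteq> mcball a (inverse (real m))" using c(4) by blast
          have "inverse (real m) \<le> inverse (real n)" using n that by simp
          moreover have "z \<in> mcball a (inverse (real m))" "l \<in> mcball a (inverse (real m))"
            using a z l sub_cl[OF c(1)] by blast+
          ultimately have "d l z < r"
            using n(2) triangle[of l a z] commute[of l a] by (auto)
          then have "z \<in> mball l r" using \<open>l \<in> M\<close> \<open>z \<in> mcball a _\<close> by auto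
          then show "z \<in> U" using r by blast
        qed
        then show ?thesis by blast
      qed
      ultimately show ?thesis using l by blast
    qed
    have op: "openin S (b n)" "openin S (e n)" and ne: "b n \<noteq> {}" "e n \<noteq> {}" for n
      using f(1)[of n] by (auto simp: P_def)
    have diam: "\<exists>a. S closure_of (b n) \<subseteq> mcball a (inverse (real n))"
      "\<exists>a. S closure_of (e n) \<subseteq> mcball a (inverse (real n))" if "n > 0" for n
      using f(1)[of n] that by (simp_all add: P_def)
    have dec: "S closure_of (b (Suc n)) \<subseteq> S closure_of (b n)"
      "S closure_of (e (Suc n)) \<subseteq> S closure_of (e n)" for n
      using f(2)[of n] by (simp_all add: Q_def)
    obtain l where "l \<in> M \<and> (\<forall>n. l \<in> S closure_of (b n)) \<and>
        (\<forall>U. openin S U \<and> l \<in> U \<longrightarrow> (\<exists>n. \<forall>m\<ge>n. b m \<subseteq> U))"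
      using lim[of b, OF op(1) ne(1) dec(1) diam(1)] by (rule exE)
    then have l: "l \<in> M" "\<And>n. l \<in> S closure_of (b n)"
        "\<And>U. openin S U \<Longrightarrow> l \<in> U \<Longrightarrow> (\<exists>n. \<forall>m\<ge>n. b m \<subseteq> U)"
      by simp_all
    obtain k where "k \<in> M \<and> (\<forall>n. k \<in> S closure_of (e n)) \<and>
        (\<forall>U. openin S U \<and> k \<in> U \<longrightarrow> (\<exists>n. \<forall>m\<ge>n. e m \<subseteq> U))"
      using lim[of e, OF op(2) ne(2) dec(2) diam(2)] by (rule exE)
    then have k: "k \<in> M" "\<And>n. k \<in> S closure_of (e n)"
        "\<And>U. openin S U \<Longrightarrow> k \<in> U \<Longrightarrow> (\<exists>n. \<forall>m\<ge>n. e m \<subseteq> U)"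
      by simp_all
    have "l \<noteq> k" using l(2)[of 0] k(2)[of 0] disj f(3,4) by auto
    then obtain U W where UW: "openin T U" "openin T W" "l \<in> U" "k \<in> W" "disjnt U W"
      using T l(1) k(1) top topS unfolding Hausdorff_space_def by metis
    obtain n where n: "\<And>m. m \<ge> n \<Longrightarrow> b m \<subseteq> U" using l(3)[OF T_S[OF UW(1)] UW(3)] by blast
    obtain n' where n': "\<And>m. m \<ge> n' \<Longrightarrow> e m \<subseteq> W" using k(3)[OF T_S[OF UW(2)] UW(4)] by blast
    \<comment> \<open>\<open>V m\<close> lies in the \<open>T\<close>-closures of both
      \<open>U\<close> and \<open>W\<close>, so it meets \<open>U\<close>, and the open set
      \<open>V m \<inter> U\<close> then meets \<open>W\<close>, against disjointness.\<close>
    define m where "m = max n n'"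
    have V: "openin T (V m)" "V m \<noteq> {}" "V m \<subseteq> T closure_of U" "V m \<subseteq> T closure_of W"
      using f(1)[of m] closure_of_mono[OF n[of m], of T] closure_of_mono[OF n'[of m], of T]
      by (auto simp: P_def m_def)
    have "V m \<inter> U \<noteq> {}"
      using openin_Int_closure_of_eq_empty[OF V(1), of U] V by blast
    moreover have "openin T (V m \<inter> U)" using V UW by blast
    ultimately have "V m \<inter> U \<inter> W \<noteq> {}"
      using openin_Int_closure_of_eq_empty[of T "V m \<inter> U" W] V by blast
    then show False using UW(5) by (auto simp: disjnt_def)
  qed
  have "openin T U" if U: "openin S U" for U
  proof (subst openin_subopen, intro ballI)
    fix x assume x: "x \<in> U"
    obtain W where W: "openin S W" "x \<in> W" "S closure_of W \<subseteq> U"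
      using small[OF U x, of 1] by auto
    \<comment> \<open>This \<open>T\<close>-open set stays inside \<open>U\<close>: a point of it
      outside \<open>U\<close> would have an \<open>S\<close>-neighbourhood \<open>D\<close> whose
      closure misses that of \<open>W\<close>, and \<open>key\<close> excludes this.\<close>
    let ?N = "T interior_of (T closure_of W)"
    have "y \<in> U" if y: "y \<in> ?N" for y
    proof (rule ccontr)
      assume "y \<notin> U"
      then have "y \<in> topspace S - S closure_of W"
        using W(3) y interior_of_subset_topspace[of T] top by auto
      moreover have "openin S (topspace S - S closure_of W)"
        by (intro openin_diff) auto
      ultimately obtain D where D: "openin S D" "y \<in> D" "S closure_of D \<subseteq> topspace S - S closure_of W"
        using small[of "topspace S - S closure_of W" y 1] by auto
      show False
        by (rule key[OF W(1) D(1) _ y]) (use D near[OF D(1)] in auto)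
    qed
    then show "\<exists>V. openin T V \<and> x \<in> V \<and> V \<subseteq> U"
      using near[OF W(1)] W(2) by (intro exI[of _ ?N]) auto
  qed
  with T_S show ?thesis by (meson topology_eq)
qed

lemma second_countable_prod_topology:
  assumes "second_countable X" "second_countable Y"
  shows "second_countable (prod_topology X Y)"
proof -
  obtain \<B> where \<B>: "countable \<B>" "\<And>V. V \<in> \<B> \<Longrightarrow> openin X V"
    "\<And>U x. openin X U \<Longrightarrow> x \<in> U \<Longrightarrow> \<exists>V \<in> \<B>. x \<in> V \<and> V \<subseteq> U"
    using assms(1) by (auto simp: second_countable_def)
  obtain \<C> where \<C>: "countable \<C>" "\<And>V. V \<in> \<C> \<Longrightarrow> openin Y V"
    "\<And>U x. openin Y U \<Longrightarrow> x \<in> U \<Longrightarrow> \<exists>V \<in> \<C>. x \<in> V \<and> V \<subseteq> U"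
    using assms(2) by (auto simp: second_countable_def)
  show ?thesis
    unfolding second_countable_def
  proof (intro exI[of _ "(\<lambda>(B, C). B \<times> C) ` (\<B> \<times> \<C>)"] conjI allI impI ballI)
    show "countable ((\<lambda>(B, C). B \<times> C) ` (\<B> \<times> \<C>))" using \<B>(1) \<C>(1) by blast
    show "openin (prod_topology X Y) V" if "V \<in> (\<lambda>(B, C). B \<times> C) ` (\<B> \<times> \<C>)" for V
      using that \<B>(2) \<C>(2) by (auto simp: openin_prod_Times_iff)
    fix U z assume "openin (prod_topology X Y) U \<and> z \<in> U"
    then have "openin (prod_topology X Y) U" "(fst z, snd z) \<in> U" by simp_all
    then obtain A B where AB: "openin X A" "openin Y B" "fst z \<in> A" "snd z \<in> B" "A \<times> B \<subseteq> U"
      unfolding openin_prod_topology_alt by meson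
    obtain A' where A': "A' \<in> \<B>" "fst z \<in> A'" "A' \<subseteq> A" using \<B>(3)[OF AB(1,3)] by (elim bexE conjE)
    obtain B' where B': "B' \<in> \<C>" "snd z \<in> B'" "B' \<subseteq> B" using \<C>(3)[OF AB(2,4)] by (elim bexE conjE)
    show "\<exists>V\<in>(\<lambda>(B, C). B \<times> C) ` (\<B> \<times> \<C>). z \<in> V \<and> V \<subseteq> U"
    proof (rule bexI[of _ "A' \<times> B'"])
      show "z \<in> A' \<times> B' \<and> A' \<times> B' \<subseteq> U" using A' B' AB(5) by (auto simp: mem_Times_iff)
      show "A' \<times> B' \<in> (\<lambda>(B, C). B \<times> C) ` (\<B> \<times> \<C>)" using A'(1) B'(1) by auto
    qed
  qed
qed

lemma abelian_polish_groupD: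
  assumes "abelian_polish_group G T"
  shows "comm_group G" "topspace T = carrier G" "completely_metrizable_space T" "second_countable T"
    "continuous_map (prod_topology T T) T (\<lambda>(x, y). x \<otimes>\<^bsub>G\<^esub> y)"
    "continuous_map T T (\<lambda>x. inv\<^bsub>G\<^esub> x)" "Hausdorff_space T" "metrizable_space T"
  using assms completely_metrizable_imp_metrizable_space metrizable_imp_Hausdorff_space
  unfolding abelian_polish_group_def by blast+

lemma continuous_map_abelian_polish_mult:
  assumes "abelian_polish_group G T" "continuous_map X T f" "continuous_map X T g"
  shows "continuous_map X T (\<lambda>x. f x \<otimes>\<^bsub>G\<^esub> g x)"
  using continuous_map_compose[OF _ abelian_polish_groupD(5)[OF assms(1)], of X "\<lambda>x. (f x, g x)"] assms(2,3)
  by (simp add: o_def continuous_map_pairwise)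

lemma continuous_map_abelian_polish_inv:
  assumes "abelian_polish_group G T" "continuous_map X T f"
  shows "continuous_map X T (\<lambda>x. inv\<^bsub>G\<^esub> (f x))"
  using continuous_map_compose[OF assms(2) abelian_polish_groupD(6)[OF assms(1)]] by (simp add: o_def)

text \<open>The open mapping argument for the identity. Countably many translates of an
  \<open>S\<close>-neighbourhood cover the group, so by Baire the \<open>T\<close>-closure of one of
  them has interior points, and translating it back to \<open>x\<close> shows that
  \<open>S\<close>-open sets are nearly open in \<open>T\<close>.\<close>

lemma finer_abelian_polish_topology_eq:
  fixes G (structure)
  assumes S: "abelian_polish_group G S" and T: "abelian_polish_group G T"
    and cont: "continuous_map S T (\<lambda>x. x)"
  shows "S = T"
proof (rule nearly_open_imp_topology_eq)
  interpret comm_group G by (rule abelian_polish_groupD(1)[OF S])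
  note top = abelian_polish_groupD(2)[OF S] abelian_polish_groupD(2)[OF T]
  show "completely_metrizable_space S" "Hausdorff_space T" "topspace S = topspace T"
    using abelian_polish_groupD[OF S] abelian_polish_groupD[OF T] by auto
  show "continuous_map S T (\<lambda>x. x)" by (rule cont)
  fix U assume U: "openin S U"
  show "U \<subseteq> T interior_of (T closure_of U)"
  proof
    fix x assume x: "x \<in> U"
    then have xG: "x \<in> carrier G" using openin_subset[OF U] top by auto
    \<comment> \<open>Quotients of two elements of the neighbourhood are allowed for because the
      closure supplied by Baire has its interior around an uncontrolled point \<open>q\<close>;
      moving \<open>q\<close> to \<open>x\<close> introduces such a quotient.\<close>
    let ?f = "\<lambda>p. x \<otimes> fst p \<otimes> inv (snd p)"
    have "continuous_map (prod_topology S S) S ?f"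
      by (intro continuous_map_abelian_polish_mult[OF S] continuous_map_abelian_polish_inv[OF S])
        (use xG top in \<open>auto simp: continuous_map_fst continuous_map_snd\<close>)
    then have "openin (prod_topology S S) {p \<in> topspace (prod_topology S S). ?f p \<in> U}"
      using U by (rule openin_continuous_map_preimage)
    moreover have "(\<one>, \<one>) \<in> {p \<in> topspace (prod_topology S S). ?f p \<in> U}"
      using x xG top by simp
    ultimately obtain A B where AB: "openin S A" "openin S B" "\<one> \<in> A" "\<one> \<in> B"
        "A \<times> B \<subseteq> {p \<in> topspace (prod_topology S S). ?f p \<in> U}"
      unfolding openin_prod_topology_alt by meson
    define V where "V = A \<inter> B"
    have V: "openin S V" "\<one> \<in> V" using AB by (auto simp: V_def)
    have VU: "x \<otimes> v \<otimes> inv w \<in> U" if "v \<in> V" "w \<in> V" for v w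
    proof -
      have "(v, w) \<in> A \<times> B" using that by (auto simp: V_def)
      then show ?thesis using AB(5) by auto
    qed
    define Va where "Va = (\<lambda>a. {y \<in> carrier G. y \<otimes> inv a \<in> V})"
    have "openin S (Va a)" if "a \<in> carrier G" for a
    proof -
      have "continuous_map S S (\<lambda>y. y \<otimes> inv a)"
        by (intro continuous_map_abelian_polish_mult[OF S]) (use that top in auto)
      from openin_continuous_map_preimage[OF this V(1)] show ?thesis by (simp add: Va_def top)
    qed
    moreover have "\<Union>(Va ` carrier G) = topspace S"
      using V(2) top by (fastforce simp: Va_def)
    ultimately obtain C where C: "countable C" "C \<subseteq> Va ` carrier G" "\<Union>C = topspace S"
      using Lindelof_spaceD[OF second_countable_imp_Lindelof_space[OF abelian_polish_groupD(4)[OF S]],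
          of "Va ` carrier G"] by (metis (no_types, lifting) imageE)
    have "\<exists>W\<in>C. T interior_of (T closure_of W) \<noteq> {}"
    proof (rule ccontr)
      assume "\<not> ?thesis"
      then have "T interior_of \<Union>((closure_of) T ` C) = {}"
        using C(1) abelian_polish_groupD(3)[OF T] by (intro Baire_category_alt) auto
      moreover have "\<Union>((closure_of) T ` C) = topspace T"
      proof
        show "\<Union> ((closure_of) T ` C) \<subseteq> topspace T" by (auto simp: in_closure_of)
        have "W \<subseteq> T closure_of W" if "W \<in> C" for W
        proof (rule closure_of_subset)
          show "W \<subseteq> topspace T" using that C(3) unfolding top by blast
        qed
        then have "\<Union>C \<subseteq> \<Union> ((closure_of) T ` C)" by blast
        then show "topspace T \<subseteq> \<Union> ((closure_of) T ` C)" unfolding C(3) top .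
      qed
      ultimately show False using xG interior_of_topspace[of T] top(2) by auto
    qed
    then obtain W where W: "W \<in> C" "T interior_of (T closure_of W) \<noteq> {}" by (elim bexE)
    obtain a where a: "a \<in> carrier G" and Wa: "W = Va a" using C(2) W(1) by (meson imageE subsetD)
    define Q where "Q = T interior_of (T closure_of (Va a))"
    have Q: "openin T Q" "Q \<subseteq> T closure_of (Va a)" "Q \<noteq> {}"
      using W(2) interior_of_subset[of T "T closure_of W"] by (simp_all add: Q_def Wa)
    then have "Q \<inter> Va a \<noteq> {}"
      using openin_Int_closure_of_eq_empty[OF Q(1), of "Va a"] by blast
    then obtain q where q: "q \<in> Q" "q \<in> carrier G" "q \<otimes> inv a \<in> V" by (auto simp: Va_def)
    \<comment> \<open>\<open>N\<close> is the translate of \<open>Q\<close> that moves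
      \<open>q\<close> to \<open>x\<close>. The inverse translation \<open>?g\<close> sends
      \<open>Va a\<close> into \<open>U\<close>, as z q^-1 x = x (z a^-1) (q a^-1)^-1 with both z
      a^-1 and q a^-1 in \<open>V\<close>.\<close>
    define N where "N = {y \<in> carrier G. y \<otimes> inv x \<otimes> q \<in> Q}"
    have "continuous_map T T (\<lambda>y. y \<otimes> inv x \<otimes> q)"
      by (intro continuous_map_abelian_polish_mult[OF T]) (use xG q top in auto)
    from openin_continuous_map_preimage[OF this Q(1)] have "openin T N"
      by (simp add: N_def top)
    moreover have "x \<in> N" using q xG by (simp add: N_def)
    moreover have "N \<subseteq> T closure_of U"
    proof
      fix y assume y: "y \<in> N"
      let ?g = "\<lambda>z. z \<otimes> inv q \<otimes> x"
      have cg: "continuous_map T T ?g"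
        by (intro continuous_map_abelian_polish_mult[OF T]) (use xG q top in auto)
      have "?g ` Va a \<subseteq> U"
      proof clarify
        fix z assume z: "z \<in> Va a"
        then have zG: "z \<in> carrier G" "z \<otimes> inv a \<in> V" by (auto simp: Va_def)
        have "x \<otimes> (z \<otimes> inv a) \<otimes> inv (q \<otimes> inv a) = ?g z"
        proof -
          have "inv a \<otimes> inv (q \<otimes> inv a) = inv q"
            using q(2) a m_assoc[of "inv a" a "inv q"] by (simp add: inv_mult_group)
          then have "x \<otimes> (z \<otimes> inv a) \<otimes> inv (q \<otimes> inv a) = x \<otimes> (z \<otimes> inv q)"
            using zG(1) q(2) a xG by (simp add: m_assoc)
          then show ?thesis using zG(1) q(2) xG m_comm[of x "z \<otimes> inv q"] by simp
        qed
        then show "?g z \<in> U" using VU[OF zG(2) q(3)] by simp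
      qed
      then have im: "?g ` (T closure_of (Va a)) \<subseteq> T closure_of U"
        using continuous_map_image_closure_subset[OF cg, of "Va a"] closure_of_mono[of "?g ` Va a" U T] by blast
      have eq: "?g (y \<otimes> inv x \<otimes> q) = y"
        using y xG q(2) by (simp add: N_def m_assoc)
      have "?g (y \<otimes> inv x \<otimes> q) \<in> ?g ` (T closure_of (Va a))"
        using y Q(2) by (intro imageI) (auto simp: N_def)
      then have "?g (y \<otimes> inv x \<otimes> q) \<in> T closure_of U" using im by (rule subsetD[rotated])
      then show "y \<in> T closure_of U" unfolding eq .
    qed
    ultimately show "x \<in> T interior_of (T closure_of U)"
      unfolding interior_of_def by blast
  qed
qed

section \<open>Graph topologies on subgroups and preimages\<close>

lemma comm_group_subgroup:
  assumes "comm_group G" "subgroup U G"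
  shows "comm_group (G\<lparr>carrier := U\<rparr>)"
proof -
  interpret G: comm_group G by (rule assms(1))
  show ?thesis
    by (rule group.group_comm_groupI[OF subgroup.subgroup_is_group[OF assms(2) G.is_group]])
      (use subgroup.mem_carrier[OF assms(2)] in \<open>simp add: G.m_comm\<close>)
qed

text \<open>The pullback topology makes \<open>M\<close> homeomorphic to the graph of
  \<open>f\<close>, a closed subset of a Polish space. It is the coarsest topology for which both
  the inclusion and \<open>f\<close> are continuous; \<open>into\<close> expresses this and settles
  the group operations.\<close>

lemma abelian_polish_graph_topology:
  fixes G :: "('a, 'm) monoid_scheme" and H :: "('b, 'n) monoid_scheme"
  assumes T: "abelian_polish_group G T" and S: "abelian_polish_group H S" and M: "subgroup M G"
    and f: "f \<in> M \<rightarrow> carrier H" "\<And>x y. x \<in> M \<Longrightarrow> y \<in> M \<Longrightarrow> f (x \<otimes>\<^bsub>G\<^esub> y) = f x \<otimes>\<^bsub>H\<^esub> f y"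
    and closed: "closedin (prod_topology T S) ((\<lambda>x. (x, f x)) ` M)"
  defines "P \<equiv> pullback_topology M (\<lambda>x. (x, f x)) (prod_topology T S)"
  shows "abelian_polish_group (G\<lparr>carrier := M\<rparr>) P" and "continuous_map P T (\<lambda>x. x)"
    and "continuous_map P S f"
proof -
  interpret G: comm_group G by (rule abelian_polish_groupD(1)[OF T])
  interpret H: comm_group H by (rule abelian_polish_groupD(1)[OF S])
  interpret M: subgroup M G by (rule M)
  have MG: "M \<subseteq> carrier G" by (rule M.subset)
  have topP: "topspace P = M"
    using MG f(1) abelian_polish_groupD(2)[OF T] abelian_polish_groupD(2)[OF S]
    by (auto simp: P_def topspace_pullback_topology)
  show cT: "continuous_map P T (\<lambda>x. x)"
    using continuous_map_pullback[OF continuous_map_fst[of T S], of M "\<lambda>x. (x, f x)"] by (simp add: P_def o_def)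
  show cS: "continuous_map P S f"
    using continuous_map_pullback[OF continuous_map_snd[of T S], of M "\<lambda>x. (x, f x)"] by (simp add: P_def o_def)
  have into: "continuous_map X P h"
    if "continuous_map X T h" "continuous_map X S k" "\<And>x. x \<in> topspace X \<Longrightarrow> h x \<in> M"
      "\<And>x. x \<in> topspace X \<Longrightarrow> f (h x) = k x" for X :: "'z topology" and h k
    unfolding P_def
  proof (rule continuous_map_pullback')
    have "continuous_map X (prod_topology T S) (\<lambda>x. (h x, k x))"
      using that by (simp add: continuous_map_pairwise o_def)
    then show "continuous_map X (prod_topology T S) ((\<lambda>x. (x, f x)) \<circ> h)"
      by (rule continuous_map_eq) (use that in auto)
  qed (use that in auto)
  have hom: "group_hom (G\<lparr>carrier := M\<rparr>) H f"
    using f M.subgroup_is_group[OF G.is_group] H.is_group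
    by (auto simp: group_hom_def group_hom_axioms_def hom_def)
  have homeo: "P homeomorphic_space subtopology (prod_topology T S) ((\<lambda>x. (x, f x)) ` M)"
    unfolding homeomorphic_space_def homeomorphic_maps_def
  proof (intro exI[of _ "\<lambda>x. (x, f x)"] exI[of _ fst] conjI)
    show "continuous_map P (subtopology (prod_topology T S) ((\<lambda>x. (x, f x)) ` M)) (\<lambda>x. (x, f x))"
      using cT cS topP by (auto simp: continuous_map_in_subtopology continuous_map_pairwise o_def)
    show "continuous_map (subtopology (prod_topology T S) ((\<lambda>x. (x, f x)) ` M)) P fst"
      by (rule into[of _ _ snd])
        (auto intro: continuous_map_from_subtopology continuous_map_fst continuous_map_snd)
  qed auto
  show "abelian_polish_group (G\<lparr>carrier := M\<rparr>) P"
    unfolding abelian_polish_group_def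
  proof (intro conjI)
    show "comm_group (G\<lparr>carrier := M\<rparr>)"
      by (rule comm_group_subgroup[OF G.comm_group_axioms M])
    show "topspace P = carrier (G\<lparr>carrier := M\<rparr>)" by (simp add: topP)
    have "completely_metrizable_space (prod_topology T S)"
      using abelian_polish_groupD(3)[OF T] abelian_polish_groupD(3)[OF S]
      by (simp add: completely_metrizable_space_prod_topology)
    then show "completely_metrizable_space P"
      using homeomorphic_completely_metrizable_space[OF homeo] completely_metrizable_space_closedin[OF _ closed]
      by blast
    show "second_countable P"
      using homeomorphic_space_second_countability[OF homeo]
        second_countable_subtopology[OF second_countable_prod_topology[OF abelian_polish_groupD(4)[OF T]
            abelian_polish_groupD(4)[OF S]]] by blast
    have "continuous_map (prod_topology P P) P (\<lambda>p. fst p \<otimes>\<^bsub>G\<^esub> snd p)"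
    proof (rule into)
      show "continuous_map (prod_topology P P) T (\<lambda>p. fst p \<otimes>\<^bsub>G\<^esub> snd p)"
        using continuous_map_compose[OF continuous_map_fst cT] continuous_map_compose[OF continuous_map_snd cT]
        by (intro continuous_map_abelian_polish_mult[OF T]) (auto simp: o_def)
      show "continuous_map (prod_topology P P) S (\<lambda>p. f (fst p) \<otimes>\<^bsub>H\<^esub> f (snd p))"
        using continuous_map_compose[OF continuous_map_fst cS] continuous_map_compose[OF continuous_map_snd cS]
        by (intro continuous_map_abelian_polish_mult[OF S]) (auto simp: o_def)
    qed (simp_all add: topP f(2) mem_Times_iff)
    then show "continuous_map (prod_topology P P) P (\<lambda>(x, y). x \<otimes>\<^bsub>G\<lparr>carrier := M\<rparr>\<^esub> y)"
      by (simp add: case_prod_unfold)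
    show "continuous_map P P (\<lambda>x. inv\<^bsub>G\<lparr>carrier := M\<rparr>\<^esub> x)"
    proof (rule into)
      have "continuous_map P T (\<lambda>x. inv\<^bsub>G\<^esub> x)"
        by (rule continuous_map_abelian_polish_inv[OF T cT])
      then show "continuous_map P T (\<lambda>x. inv\<^bsub>G\<lparr>carrier := M\<rparr>\<^esub> x)"
        by (rule continuous_map_eq) (simp add: topP G.m_inv_consistent[OF M])
      show "continuous_map P S (\<lambda>x. inv\<^bsub>H\<^esub> (f x))"
        by (rule continuous_map_abelian_polish_inv[OF S cS])
    qed (use topP group_hom.hom_inv[OF hom] in \<open>auto simp: G.m_inv_consistent[OF M]\<close>)
  qed
qed

text \<open>\<open>f\<close> is continuous only into the coarser space \<open>Z\<close>, while the
  graph is taken in the product with \<open>Y\<close>. There it is the set where \<open>f\<close>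
  after the first projection agrees with the inclusion of \<open>Y\<close> after the second, cut
  down to \<open>W\<close>; this is closed because \<open>Z\<close> is Hausdorff.\<close>

lemma continuous_map_imp_closedin_graph:
  assumes "continuous_map X Z f" "continuous_map Y Z (\<lambda>y. y)" "Hausdorff_space Z"
    "closedin X W" "M = {x \<in> W. f x \<in> topspace Y}"
  shows "closedin (prod_topology X Y) ((\<lambda>x. (x, f x)) ` M)"
proof -
  have "continuous_map (prod_topology X Y) Z (f \<circ> fst)" "continuous_map (prod_topology X Y) Z ((\<lambda>y. y) \<circ> snd)"
    using assms(1,2) continuous_map_fst continuous_map_snd continuous_map_compose by blast+
  then have "closedin (prod_topology X Y) {p \<in> topspace (prod_topology X Y). (f \<circ> fst) p = ((\<lambda>y. y) \<circ> snd) p}"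
    using assms(3) by (intro closedin_continuous_maps_eq)
  moreover have "closedin (prod_topology X Y) (W \<times> topspace Y)"
    using assms(4) by (simp add: closedin_prod_Times_iff)
  ultimately have "closedin (prod_topology X Y)
      ({p \<in> topspace (prod_topology X Y). (f \<circ> fst) p = ((\<lambda>y. y) \<circ> snd) p} \<inter> W \<times> topspace Y)"
    by (rule closedin_Int)
  moreover have "{p \<in> topspace (prod_topology X Y). (f \<circ> fst) p = ((\<lambda>y. y) \<circ> snd) p} \<inter> W \<times> topspace Y
      = (\<lambda>x. (x, f x)) ` M"
    using closedin_subset[OF assms(4)] by (auto simp: assms(5))
  ultimately show ?thesis by simp
qed

text \<open>\<open>S\<close> and \<open>S'\<close> need not be comparable a priori. The diagonal is
  closed in their product because both refine the Hausdorff \<open>T\<close>, so its graph topology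
  is a Polish group topology finer than each, and the comparable case applies twice.\<close>

lemma polish_subgroup_topology_unique:
  assumes T: "Hausdorff_space T" and S: "polish_subgroup_topology G T L S"
    and S': "polish_subgroup_topology G T L S'"
  shows "S = S'"
proof -
  let ?L = "G\<lparr>carrier := L\<rparr>"
  let ?P = "pullback_topology L (\<lambda>x. (x, x)) (prod_topology S S')"
  have pol: "abelian_polish_group ?L S" "abelian_polish_group ?L S'"
    and cont: "continuous_map S T (\<lambda>x. x)" "continuous_map S' T (\<lambda>x. x)"
    using S S' by (auto simp: polish_subgroup_topology_def)
  interpret L: comm_group ?L by (rule abelian_polish_groupD(1)[OF pol(1)])
  have "closedin (prod_topology S S') ((\<lambda>x. (x, x)) ` L)"
    using abelian_polish_groupD(2)[OF pol(1)] abelian_polish_groupD(2)[OF pol(2)]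
    by (intro continuous_map_imp_closedin_graph[OF cont T closedin_topspace]) auto
  moreover have "subgroup L ?L" using L.subgroup_self by simp
  ultimately have "abelian_polish_group (?L\<lparr>carrier := L\<rparr>) ?P"
      "continuous_map ?P S (\<lambda>x. x)" "continuous_map ?P S' (\<lambda>x. x)"
    using abelian_polish_graph_topology[OF pol, of L "\<lambda>x. x"] by auto
  then have "?P = S" "?P = S'"
    using finer_abelian_polish_topology_eq[of ?L] pol by auto
  then show ?thesis by simp
qed

lemma polishable_topology_eq:
  assumes "Hausdorff_space T" "subgroup L G" "polish_subgroup_topology G T L S"
  shows "polishable_topology G T L = S"
proof -
  have "polishable_subgroup G T L" using assms by (auto simp: polishable_subgroup_def)
  moreover have "polish_subgroup_topology G T L (SOME S. polish_subgroup_topology G T L S)"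
    using assms(3) by (rule someI)
  ultimately show ?thesis
    using polish_subgroup_topology_unique[OF assms(1) _ assms(3)] by (simp add: polishable_topology_def)
qed

text \<open>The witness is the graph topology. Continuity of \<open>f\<close> into the finer
  topology \<open>S\<close> is recorded with it, since uniqueness later transfers it to the topology
  chosen by \<open>Ph\<close>. The closed subgroup \<open>W\<close> is built in because the two
  comparison maps are inverse modulo the kernels only inside it.\<close>

lemma polish_subgroup_topology_preimage:
  fixes G :: "('a, 'm) monoid_scheme" and H :: "('b, 'n) monoid_scheme"
  assumes G: "abelian_polish_group G T" and H: "abelian_polish_group H U"
    and f: "f \<in> hom G H" "continuous_map T U f"
    and W: "subgroup W G" "closedin T W"
    and L: "subgroup L H" "polish_subgroup_topology H U L S"
  shows "\<exists>S'. polish_subgroup_topology G T {x \<in> W. f x \<in> L} S' \<and> continuous_map S' S f"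
    and "subgroup {x \<in> W. f x \<in> L} G"
proof -
  interpret G: comm_group G by (rule abelian_polish_groupD(1)[OF G])
  interpret H: comm_group H by (rule abelian_polish_groupD(1)[OF H])
  interpret f: group_hom G H f by unfold_locales (rule f)
  interpret W: subgroup W G by (rule W)
  interpret L: subgroup L H by (rule L)
  let ?M = "{x \<in> W. f x \<in> L}"
  have S: "abelian_polish_group (H\<lparr>carrier := L\<rparr>) S" "continuous_map S U (\<lambda>x. x)"
    using L by (auto simp: polish_subgroup_topology_def)
  show M: "subgroup ?M G"
    by unfold_locales auto
  have "closedin (prod_topology T S) ((\<lambda>x. (x, f x)) ` ?M)"
    using abelian_polish_groupD(2)[OF S(1)] abelian_polish_groupD(7)[OF H]
    by (intro continuous_map_imp_closedin_graph[OF f(2) S(2) _ W(2)]) auto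
  note * = abelian_polish_graph_topology[OF G S(1) M _ _ this]
  let ?P = "pullback_topology ?M (\<lambda>x. (x, f x)) (prod_topology T S)"
  have "abelian_polish_group (G\<lparr>carrier := ?M\<rparr>) ?P" by (rule *(1)) auto
  moreover have "continuous_map ?P T (\<lambda>x. x)" by (rule *(2)) auto
  moreover have "continuous_map ?P S f" by (rule *(3)) auto
  ultimately show "\<exists>S'. polish_subgroup_topology G T ?M S' \<and> continuous_map S' S f"
    by (auto simp: polish_subgroup_topology_def)
qed

lemma polish_subgroup_topology_closed:
  assumes G: "abelian_polish_group G T" and W: "subgroup W G" "closedin T W"
  shows "polish_subgroup_topology G T W (subtopology T W)"
proof -
  interpret G: comm_group G by (rule abelian_polish_groupD(1)[OF G])
  have WT: "W \<subseteq> topspace T" using closedin_subset[OF W(2)] .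
  have tW: "topspace (subtopology T W) = W" using WT by auto
  have "continuous_map (subtopology T W) T (\<lambda>x. inv\<^bsub>G\<^esub> x)"
    by (intro continuous_map_from_subtopology abelian_polish_groupD(6)[OF G])
  then have "continuous_map (subtopology T W) (subtopology T W) (\<lambda>x. inv\<^bsub>G\<^esub> x)"
    unfolding continuous_map_in_subtopology tW using subgroup.m_inv_closed[OF W(1)] by blast
  then have inv: "continuous_map (subtopology T W) (subtopology T W) (\<lambda>x. inv\<^bsub>G\<lparr>carrier := W\<rparr>\<^esub> x)"
    by (rule continuous_map_eq) (simp add: tW G.m_inv_consistent[OF W(1)])
  have "continuous_map (prod_topology (subtopology T W) (subtopology T W)) T (\<lambda>(x, y). x \<otimes>\<^bsub>G\<^esub> y)"
    using continuous_map_from_subtopology[OF abelian_polish_groupD(5)[OF G], of "W \<times> W"]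
    by (simp add: subtopology_Times)
  then have mult: "continuous_map (prod_topology (subtopology T W) (subtopology T W)) (subtopology T W)
      (\<lambda>(x, y). x \<otimes>\<^bsub>G\<^esub> y)"
    using subgroup.m_closed[OF W(1)] by (auto simp: continuous_map_in_subtopology)
  show ?thesis
    unfolding polish_subgroup_topology_def abelian_polish_group_def
    using comm_group_subgroup[OF G.comm_group_axioms W(1)] inv mult WT completely_metrizable_space_closedin[OF abelian_polish_groupD(3)[OF G] W(2)]
      second_countable_subtopology[OF abelian_polish_groupD(4)[OF G]]
    by (auto simp: topspace_subtopology_subset continuous_map_from_subtopology)
qed

section \<open>Phantom subgroups and homomorphisms\<close>

lemma
  assumes f: "continuous_map X Y f"
  shows Sigma0_preimage: "Sigma0 Y \<alpha> U \<Longrightarrow> Sigma0 X \<alpha> {x \<in> topspace X. f x \<in> U}"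
    and Pi0_preimage: "Pi0 Y \<alpha> U \<Longrightarrow> Pi0 X \<alpha> {x \<in> topspace X. f x \<in> U}"
proof (induction rule: Sigma0_Pi0.inducts)
  case (Sigma0_open \<alpha> U)
  then show ?case using openin_continuous_map_preimage[OF f] by (intro Sigma0_Pi0.Sigma0_open)
next
  case (Sigma0_Union \<beta> \<alpha> V)
  then have "Sigma0 X \<alpha> (\<Union>n. {x \<in> topspace X. f x \<in> V n})"
    by (intro Sigma0_Pi0.Sigma0_Union) auto
  moreover have "(\<Union>n. {x \<in> topspace X. f x \<in> V n}) = {x \<in> topspace X. f x \<in> (\<Union>n. V n)}" by auto
  ultimately show ?case by simp
next
  case (Pi0_compl \<alpha> U)
  then have "Pi0 X \<alpha> (topspace X - {x \<in> topspace X. f x \<in> U})"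
    by (intro Sigma0_Pi0.Pi0_compl)
  moreover have "topspace X - {x \<in> topspace X. f x \<in> U} = {x \<in> topspace X. f x \<in> topspace Y - U}"
    using continuous_map_image_subset_topspace[OF f] by auto
  ultimately show ?case by simp
qed

text \<open>\<open>Sigma0\<close> admits open sets outright only at the least index; higher up, sets
  arise as unions of earlier \<open>Pi0\<close> sets. So the open complement is written as a
  countable union of closed sets, which metrizability permits, and the index
  \<open>omega1_succ \<alpha>\<close> always lies above the least one.\<close>

lemma closedin_imp_Pi0:
  assumes "metrizable_space X" "closedin X C"
  shows "Pi0 X (omega1_succ \<alpha>) C"
proof -
  define \<zeta> :: omega1 where "\<zeta> = (LEAST \<beta>. True)"
  have least: "\<nexists>\<beta>. \<beta> < \<zeta>" using not_less_Least[of _ "\<lambda>_. True"] by (auto simp: \<zeta>_def)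
  have cl: "Pi0 X \<zeta> D" if "closedin X D" for D
  proof -
    have "Pi0 X \<zeta> (topspace X - (topspace X - D))"
      using that by (intro Pi0_compl Sigma0_open[OF least]) auto
    moreover have "topspace X - (topspace X - D) = D" using closedin_subset[OF that] by auto
    ultimately show ?thesis by simp
  qed
  have "fsigma_in X (topspace X - C)"
    using assms by (intro open_imp_fsigma_in) auto
  then obtain D where "(\<forall>n. closedin X (D n)) \<and> (\<forall>n. D n \<subseteq> D (Suc n)) \<and> (\<Union>n. D n) = topspace X - C"
    unfolding fsigma_in_ascending by (rule exE)
  then have D: "closedin X (D n)" "(\<Union>n. D n) = topspace X - C" for n by auto
  have "\<zeta> < omega1_succ \<alpha>"
    using least by (simp add: less_omega1_succ_iff) (meson not_less)
  then have "Sigma0 X (omega1_succ \<alpha>) (\<Union>n. D n)"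
    using cl[OF D(1)] by (intro Sigma0_Union[where \<beta> = "\<lambda>_. \<zeta>"]) simp
  then have "Pi0 X (omega1_succ \<alpha>) (topspace X - (topspace X - C))"
    using D(2) by (intro Pi0_compl) simp
  moreover have "topspace X - (topspace X - C) = C" using closedin_subset[OF assms(2)] by auto
  ultimately show ?thesis by simp
qed

lemma continuous_map_imp_measurable_borel_of:
  assumes "continuous_map X Y f"
  shows "f \<in> borel_of X \<rightarrow>\<^sub>M borel_of Y"
  unfolding borel_of_def
proof (rule measurable_measure_of)
  show "{U. openin Y U} \<subseteq> Pow (topspace Y)" using openin_subset by auto
  show "f \<in> space (sigma (topspace X) {U. openin X U}) \<rightarrow> topspace Y"
    using continuous_map_image_subset_topspace[OF assms] by (auto simp: space_measure_of_conv)
  fix U assume "U \<in> {U. openin Y U}"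
  then have "openin X {x \<in> topspace X. f x \<in> U}" using openin_continuous_map_preimage[OF assms] by auto
  then have "{x \<in> topspace X. f x \<in> U} \<in> sigma_sets (topspace X) {U. openin X U}"
    by (intro sigma_sets.Basic) auto
  moreover have "f -` U \<inter> topspace X = {x \<in> topspace X. f x \<in> U}" by auto
  moreover have "{U. openin X U} \<subseteq> Pow (topspace X)" using openin_subset by auto
  ultimately show "f -` U \<inter> space (sigma (topspace X) {U. openin X U}) \<in> sets (sigma (topspace X) {U. openin X U})"
    by (simp add: space_measure_of_conv)
qed

lemma polish_cover_hom_induced:
  fixes G :: "'a polish_cover" and H :: "'b polish_cover"
  assumes G: "comm_group G" "subgroup (cover_kernel G) G" and H: "comm_group H" "subgroup (cover_kernel H) H"
    and f: "f \<in> hom G H" "f ` cover_kernel G \<subseteq> cover_kernel H"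
    and cont: "continuous_map (cover_topology G) (cover_topology H) f"
  obtains \<phi> where "\<phi> \<in> polish_cover_hom G H"
    "\<And>x. x \<in> carrier G \<Longrightarrow> \<phi> (cover_kernel G #>\<^bsub>G\<^esub> x) = cover_kernel H #>\<^bsub>H\<^esub> f x"
proof -
  interpret G: comm_group G by (rule G)
  interpret H: comm_group H by (rule H)
  interpret f: group_hom G H f by unfold_locales (rule f)
  have N: "cover_kernel G \<lhd> G" "cover_kernel H \<lhd> H"
    using G.normal_iff_subgroup H.normal_iff_subgroup G H by auto
  have "(\<lambda>y. cover_kernel H #>\<^bsub>H\<^esub> y) \<circ> f \<in> hom G (covered_group H)"
    using f(1) normal.r_coset_hom_Mod[OF N(2)] by (rule hom_compose)
  moreover have "((\<lambda>y. cover_kernel H #>\<^bsub>H\<^esub> y) \<circ> f) x = ((\<lambda>y. cover_kernel H #>\<^bsub>H\<^esub> y) \<circ> f) y"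
    if xy: "x \<in> carrier G" "y \<in> carrier G" and eq: "cover_kernel G #>\<^bsub>G\<^esub> x = cover_kernel G #>\<^bsub>G\<^esub> y" for x y
  proof -
    have "x \<in> cover_kernel G #>\<^bsub>G\<^esub> y"
      using G.rcos_self[OF xy(1) G(2)] eq by simp
    then obtain n where n: "n \<in> cover_kernel G" "x = n \<otimes>\<^bsub>G\<^esub> y" by (auto simp: r_coset_def)
    have nG: "n \<in> carrier G" using n(1) subgroup.subset[OF G(2)] by auto
    have "f x \<in> cover_kernel H #>\<^bsub>H\<^esub> f y"
      using n f(2) nG xy by (auto simp: r_coset_def)
    then have "cover_kernel H #>\<^bsub>H\<^esub> f x = cover_kernel H #>\<^bsub>H\<^esub> f y"
      using H.repr_independence[OF _ _ H(2)] xy(2) f.hom_closed by metis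
    then show ?thesis by simp
  qed
  ultimately obtain \<phi> where \<phi>: "\<phi> \<in> hom (covered_group G) (covered_group H)"
      "\<And>x. x \<in> carrier G \<Longrightarrow> \<phi> (cover_kernel G #>\<^bsub>G\<^esub> x) = ((\<lambda>y. cover_kernel H #>\<^bsub>H\<^esub> y) \<circ> f) x"
    using FactGroup_universal[OF _ N(1)] by metis
  moreover have "\<phi> \<in> polish_cover_hom G H"
    unfolding polish_cover_hom_def using \<phi> continuous_map_imp_measurable_borel_of[OF cont] by auto
  ultimately show thesis using that[of \<phi>] by simp
qed

text \<open>The given \<open>W\<close> ensures that the intersection behind \<open>hull\<close> is
  over a nonempty family; over the empty family it would be the whole type.\<close>

lemma phantom_carrier_subgroup:
  assumes G: "group G" and W: "polishable_subgroup G (cover_topology G) W"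
    "Pi0 (cover_topology G) (omega1_succ \<alpha>) W" "cover_kernel G \<subseteq> W"
  shows "subgroup (phantom_carrier \<alpha> G) G" "phantom_carrier \<alpha> G \<subseteq> W"
    "cover_kernel G \<subseteq> phantom_carrier \<alpha> G"
proof -
  show "subgroup (phantom_carrier \<alpha> G) G"
    unfolding phantom_carrier_def hull_def
    by (rule group.subgroups_Inter[OF G]) (use W in \<open>auto simp: polishable_subgroup_def\<close>)
  show "phantom_carrier \<alpha> G \<subseteq> W" "cover_kernel G \<subseteq> phantom_carrier \<alpha> G"
    unfolding phantom_carrier_def by (auto simp: hull_subset hull_minimal W intro!: hull_minimal)
qed

text \<open>Functoriality: each \<open>L\<close> occurring in the intersection for \<open>H\<close>
  pulls back along \<open>f\<close> to a subgroup occurring in the intersection for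
  \<open>G\<close>.\<close>

lemma phantom_carrier_hom:
  assumes G: "abelian_polish_group G (cover_topology G)" and H: "abelian_polish_group H (cover_topology H)"
    and f: "f \<in> hom G H" "continuous_map (cover_topology G) (cover_topology H) f"
      "f ` cover_kernel G \<subseteq> cover_kernel H"
    and N: "subgroup (cover_kernel G) G"
    and x: "x \<in> phantom_carrier \<alpha> G"
  shows "f x \<in> phantom_carrier \<alpha> H"
  unfolding phantom_carrier_def hull_def
proof clarify
  fix L assume L: "polishable_subgroup H (cover_topology H) L" "Pi0 (cover_topology H) (omega1_succ \<alpha>) L"
    "cover_kernel H \<subseteq> L"
  interpret G: comm_group G by (rule abelian_polish_groupD(1)[OF G])
  let ?M = "{x \<in> carrier G. f x \<in> L}"
  obtain S where S: "subgroup L H" "polish_subgroup_topology H (cover_topology H) L S"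
    using L(1) by (auto simp: polishable_subgroup_def)
  have "closedin (cover_topology G) (carrier G)"
    using abelian_polish_groupD(2)[OF G] closedin_topspace by metis
  note * = polish_subgroup_topology_preimage[OF G H f(1,2) G.subgroup_self this S]
  have "polishable_subgroup G (cover_topology G) ?M"
    using * by (auto simp: polishable_subgroup_def)
  moreover have "Pi0 (cover_topology G) (omega1_succ \<alpha>) ?M"
    using Pi0_preimage[OF f(2) L(2)] by (simp add: abelian_polish_groupD(2)[OF G])
  moreover have "cover_kernel G \<subseteq> ?M"
    using subgroup.subset[OF N] f(3) L(3) by blast
  ultimately have "phantom_carrier \<alpha> G \<subseteq> ?M"
    unfolding phantom_carrier_def by (intro hull_minimal) auto
  then show "f x \<in> L" using x by blast
qed

lemma comm_group_cong:
  assumes "comm_group G" "carrier H = carrier G" "monoid.mult H = monoid.mult G" "one H = one G"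
  shows "comm_group H"
proof -
  interpret G: comm_group G by (rule assms(1))
  show ?thesis
    by (intro comm_groupI) (use assms(2-4) G.l_inv_ex in \<open>auto simp: G.m_ac\<close>)
qed

lemma comm_group_Ph:
  assumes "comm_group G" "subgroup (phantom_carrier \<alpha> G) G"
  shows "comm_group (Ph \<alpha> G)"
  by (rule comm_group_cong[OF comm_group_subgroup[OF assms]]) (simp_all add: Ph_def)

lemma subgroup_cong:
  assumes N: "subgroup N H" and "group H" "group G" "N \<subseteq> carrier G" "carrier G \<subseteq> carrier H"
    and mult: "monoid.mult G = monoid.mult H" "one G = one H"
  shows "subgroup N G"
proof -
  interpret H: group H by fact
  interpret G: group G by fact
  interpret N: subgroup N H by fact
  have "inv\<^bsub>G\<^esub> x = inv\<^bsub>H\<^esub> x" if "x \<in> N" for x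
    using that assms(4) by (intro G.inv_equality) (auto simp: mult)
  then show ?thesis using assms(4) by unfold_locales (auto simp: mult)
qed

lemma subgroup_Ph:
  assumes "subgroup (cover_kernel G) G" "comm_group G" "subgroup (phantom_carrier \<alpha> G) G"
    "cover_kernel G \<subseteq> phantom_carrier \<alpha> G"
  shows "subgroup (cover_kernel (Ph \<alpha> G)) (Ph \<alpha> G)"
proof -
  have "subgroup (cover_kernel G) (Ph \<alpha> G)"
    using assms(2,4) comm_group_Ph[OF assms(2,3)] subgroup.subset[OF assms(3)]
    by (intro subgroup_cong[OF assms(1)]) (simp_all add: Ph_def comm_group_def)
  then show ?thesis by (simp add: Ph_def)
qed

text \<open>The hypotheses on \<open>f\<close> and \<open>g\<close> give \<open>phantom_carrier \<alpha> G = {x \<in> W. f x \<in> phantom_carrier \<alpha> H}\<close>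
  and \<open>phantom_carrier \<alpha> H = g -` phantom_carrier \<alpha> G\<close>. So if one of the two is Polishable, then
  both are, and by uniqueness their Polish topologies are the graph topologies, which make \<open>f\<close> and
  \<open>g\<close> continuous.\<close>

theorem Ph_isomorphic:
  fixes G :: "'a polish_cover" and H :: "'b polish_cover"
  assumes G: "abelian_polish_group G (cover_topology G)" and H: "abelian_polish_group H (cover_topology H)"
    and N: "subgroup (cover_kernel G) G" "subgroup (cover_kernel H) H"
    and f: "f \<in> hom G H" "continuous_map (cover_topology G) (cover_topology H) f"
      "f ` cover_kernel G \<subseteq> cover_kernel H"
    and g: "g \<in> hom H G" "continuous_map (cover_topology H) (cover_topology G) g"
      "g ` cover_kernel H \<subseteq> cover_kernel G"
    and W: "subgroup W G" "closedin (cover_topology G) W" "cover_kernel G \<subseteq> W"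
    and gf: "\<And>x. x \<in> W \<Longrightarrow> \<exists>n \<in> cover_kernel G. g (f x) = n \<otimes>\<^bsub>G\<^esub> x"
    and fg: "\<And>y. y \<in> carrier H \<Longrightarrow> \<exists>n \<in> cover_kernel H. f (g y) = n \<otimes>\<^bsub>H\<^esub> y"
  shows "Ph \<alpha> G \<cong>\<^sub>P Ph \<alpha> H"
proof -
  interpret G: comm_group G by (rule abelian_polish_groupD(1)[OF G])
  interpret H: comm_group H by (rule abelian_polish_groupD(1)[OF H])
  interpret f: group_hom G H f by unfold_locales (rule f)
  interpret g: group_hom H G g by unfold_locales (rule g)
  define PG where "PG = phantom_carrier \<alpha> G"
  define PH where "PH = phantom_carrier \<alpha> H"
  have cH: "closedin (cover_topology H) (carrier H)"
    using abelian_polish_groupD(2)[OF H] closedin_topspace by metis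
  have "polishable_subgroup G (cover_topology G) W" "polishable_subgroup H (cover_topology H) (carrier H)"
    using polish_subgroup_topology_closed[OF G W(1,2)] polish_subgroup_topology_closed[OF H H.subgroup_self cH]
      W(1) H.subgroup_self by (auto simp: polishable_subgroup_def)
  moreover have "Pi0 (cover_topology G) (omega1_succ \<alpha>) W" "Pi0 (cover_topology H) (omega1_succ \<alpha>) (carrier H)"
    using closedin_imp_Pi0 abelian_polish_groupD(8) G H W(2) cH by blast+
  ultimately have sub: "polishable_subgroup G (cover_topology G) W" "Pi0 (cover_topology G) (omega1_succ \<alpha>) W"
    "polishable_subgroup H (cover_topology H) (carrier H)" "Pi0 (cover_topology H) (omega1_succ \<alpha>) (carrier H)"
    by simp_all
  have PG: "subgroup PG G" "PG \<subseteq> W" "cover_kernel G \<subseteq> PG"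
    unfolding PG_def by (rule phantom_carrier_subgroup[OF G.is_group sub(1,2) W(3)])+
  have PH: "subgroup PH H" "PH \<subseteq> carrier H" "cover_kernel H \<subseteq> PH"
    unfolding PH_def by (rule phantom_carrier_subgroup[OF H.is_group sub(3,4) subgroup.subset[OF N(2)]])+
  have fP: "f x \<in> PH" if "x \<in> PG" for x
    using phantom_carrier_hom[OF G H f N(1)] that by (simp add: PG_def PH_def)
  have gP: "g y \<in> PG" if "y \<in> PH" for y
    using phantom_carrier_hom[OF H G g N(2)] that by (simp add: PG_def PH_def)
  \<comment> \<open>On \<open>W\<close>, \<open>x\<close> and \<open>g (f x)\<close> differ by a
    kernel element, and the kernel lies in \<open>PG\<close>; so \<open>x\<close> is in
    \<open>PG\<close> as soon as \<open>g (f x)\<close> is.\<close>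
  have PG_eq: "PG = {x \<in> W. f x \<in> PH}"
  proof
    show "{x \<in> W. f x \<in> PH} \<subseteq> PG"
    proof clarify
      fix x assume x: "x \<in> W" "f x \<in> PH"
      obtain n where n: "n \<in> cover_kernel G" "g (f x) = n \<otimes>\<^bsub>G\<^esub> x" using gf[OF x(1)] by blast
      have "n \<in> PG" "g (f x) \<in> PG" using n(1) PG(3) gP[OF x(2)] by auto
      moreover have "n \<in> carrier G" "x \<in> carrier G"
        using calculation(1) subgroup.subset[OF PG(1)] subgroup.subset[OF W(1)] x(1) by auto
      then have "x = inv\<^bsub>G\<^esub> n \<otimes>\<^bsub>G\<^esub> g (f x)" unfolding n(2) by (simp flip: G.m_assoc)
      ultimately show "x \<in> PG" using subgroup.m_closed[OF PG(1)] subgroup.m_inv_closed[OF PG(1)] by metis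
    qed
  qed (use fP PG in auto)
  have PH_eq: "PH = {y \<in> carrier H. g y \<in> PG}"
  proof
    show "{y \<in> carrier H. g y \<in> PG} \<subseteq> PH"
    proof clarify
      fix y assume y: "y \<in> carrier H" "g y \<in> PG"
      obtain n where n: "n \<in> cover_kernel H" "f (g y) = n \<otimes>\<^bsub>H\<^esub> y" using fg[OF y(1)] by blast
      have "n \<in> PH" "f (g y) \<in> PH" using n(1) PH(3) fP[OF y(2)] by auto
      moreover have "n \<in> carrier H" using calculation(1) PH(2) by auto
      then have "y = inv\<^bsub>H\<^esub> n \<otimes>\<^bsub>H\<^esub> f (g y)" unfolding n(2) using y(1) by (simp flip: H.m_assoc)
      ultimately show "y \<in> PH" using subgroup.m_closed[OF PH(1)] subgroup.m_inv_closed[OF PH(1)] by metis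
    qed
  qed (use gP PH in auto)
  define TG where "TG = polishable_topology G (cover_topology G) PG"
  define TH where "TH = polishable_topology H (cover_topology H) PH"
  have contfg: "continuous_map TG TH f \<and> continuous_map TH TG g"
  proof (cases "polishable_subgroup G (cover_topology G) PG \<or> polishable_subgroup H (cover_topology H) PH")
    case True
    have "polishable_subgroup G (cover_topology G) PG \<and> polishable_subgroup H (cover_topology H) PH"
      using True
    proof
      assume *: "polishable_subgroup G (cover_topology G) PG"
      then obtain S where "polish_subgroup_topology G (cover_topology G) PG S" by (auto simp: polishable_subgroup_def)
      from polish_subgroup_topology_preimage(1)[OF H G g(1,2) H.subgroup_self cH PG(1) this]
      show ?thesis using * PH(1) by (auto simp: polishable_subgroup_def PH_eq[symmetric])
    next
      assume *: "polishable_subgroup H (cover_topology H) PH"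
      then obtain S where "polish_subgroup_topology H (cover_topology H) PH S" by (auto simp: polishable_subgroup_def)
      from polish_subgroup_topology_preimage(1)[OF G H f(1,2) W(1,2) PH(1) this]
      show ?thesis using * PG(1) by (auto simp: polishable_subgroup_def PG_eq[symmetric])
    qed
    then obtain S S' where S: "polish_subgroup_topology G (cover_topology G) PG S"
        "polish_subgroup_topology H (cover_topology H) PH S'" by (auto simp: polishable_subgroup_def)
    have T: "TG = S" "TH = S'"
      unfolding TG_def TH_def
      using polishable_topology_eq[OF abelian_polish_groupD(7)[OF G] PG(1) S(1)]
        polishable_topology_eq[OF abelian_polish_groupD(7)[OF H] PH(1) S(2)] by auto
    obtain S1 where S1: "polish_subgroup_topology G (cover_topology G) PG S1" "continuous_map S1 S' f"
      using polish_subgroup_topology_preimage(1)[OF G H f(1,2) W(1,2) PH(1) S(2)] unfolding PG_eq[symmetric]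
      by blast
    obtain S2 where S2: "polish_subgroup_topology H (cover_topology H) PH S2" "continuous_map S2 S g"
      using polish_subgroup_topology_preimage(1)[OF H G g(1,2) H.subgroup_self cH PG(1) S(1)]
      unfolding PH_eq[symmetric] by blast
    have "S1 = S" "S2 = S'"
      using polish_subgroup_topology_unique[OF abelian_polish_groupD(7)[OF G] S1(1) S(1)]
        polish_subgroup_topology_unique[OF abelian_polish_groupD(7)[OF H] S2(1) S(2)] by auto
    then show ?thesis using S1(2) S2(2) by (simp add: T)
  next
    \<comment> \<open>\<open>polishable_topology\<close> takes its default value on both sides, so
      the topologies are the subspace topologies and the restrictions of \<open>f\<close> and
      \<open>g\<close> stay continuous.\<close>
    case False
    then have T: "TG = subtopology (cover_topology G) PG" "TH = subtopology (cover_topology H) PH"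
      by (simp_all add: TG_def TH_def polishable_topology_def)
    show ?thesis
      unfolding T continuous_map_in_subtopology
      using f(2) g(2) fP gP by (auto intro: continuous_map_from_subtopology)
  qed
  have simps: "carrier (Ph \<alpha> G) = PG" "cover_topology (Ph \<alpha> G) = TG" "cover_kernel (Ph \<alpha> G) = cover_kernel G"
    "monoid.mult (Ph \<alpha> G) = monoid.mult G" "carrier (Ph \<alpha> H) = PH" "cover_topology (Ph \<alpha> H) = TH"
    "cover_kernel (Ph \<alpha> H) = cover_kernel H" "monoid.mult (Ph \<alpha> H) = monoid.mult H"
    by (simp_all add: Ph_def PG_def PH_def TG_def TH_def)
  have coset: "cover_kernel (Ph \<alpha> G) #>\<^bsub>Ph \<alpha> G\<^esub> x = cover_kernel G #>\<^bsub>G\<^esub> x"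
    "cover_kernel (Ph \<alpha> H) #>\<^bsub>Ph \<alpha> H\<^esub> y = cover_kernel H #>\<^bsub>H\<^esub> y" for x y
    by (simp_all add: r_coset_def simps)
  have cg: "comm_group (Ph \<alpha> G)" "comm_group (Ph \<alpha> H)"
    using comm_group_Ph G.comm_group_axioms H.comm_group_axioms PG(1) PH(1) unfolding PG_def PH_def by blast+
  have sg: "subgroup (cover_kernel (Ph \<alpha> G)) (Ph \<alpha> G)" "subgroup (cover_kernel (Ph \<alpha> H)) (Ph \<alpha> H)"
    using subgroup_Ph[OF N(1) G.comm_group_axioms] subgroup_Ph[OF N(2) H.comm_group_axioms] PG PH
    unfolding PG_def PH_def by blast+
  have hom: "f \<in> hom (Ph \<alpha> G) (Ph \<alpha> H)" "g \<in> hom (Ph \<alpha> H) (Ph \<alpha> G)"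
    using fP gP f.hom_mult g.hom_mult subsetD[OF subgroup.subset[OF PG(1)]] subsetD[OF PH(2)]
    by (simp_all add: hom_def simps Pi_def)
  obtain \<phi> where \<phi>: "\<phi> \<in> polish_cover_hom (Ph \<alpha> G) (Ph \<alpha> H)"
      "\<And>x. x \<in> PG \<Longrightarrow> \<phi> (cover_kernel G #>\<^bsub>G\<^esub> x) = cover_kernel H #>\<^bsub>H\<^esub> f x"
    using polish_cover_hom_induced[OF cg(1) sg(1) cg(2) sg(2) hom(1)] f(3) contfg unfolding coset unfolding simps
    by metis
  obtain \<psi> where \<psi>: "\<psi> \<in> polish_cover_hom (Ph \<alpha> H) (Ph \<alpha> G)"
      "\<And>y. y \<in> PH \<Longrightarrow> \<psi> (cover_kernel H #>\<^bsub>H\<^esub> y) = cover_kernel G #>\<^bsub>G\<^esub> g y"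
    using polish_cover_hom_induced[OF cg(2) sg(2) cg(1) sg(1) hom(2)] g(3) contfg unfolding coset unfolding simps
    by metis
  have carr: "carrier (covered_group (Ph \<alpha> G)) = (\<lambda>x. cover_kernel G #>\<^bsub>G\<^esub> x) ` PG"
    "carrier (covered_group (Ph \<alpha> H)) = (\<lambda>x. cover_kernel H #>\<^bsub>H\<^esub> x) ` PH"
    by (auto simp: FactGroup_def RCOSETS_def simps coset[unfolded simps])
  have "\<psi> (\<phi> X) = X" if X: "X \<in> carrier (covered_group (Ph \<alpha> G))" for X
  proof -
    obtain x where x: "x \<in> PG" "X = cover_kernel G #>\<^bsub>G\<^esub> x" using X carr by auto
    then obtain n where n: "n \<in> cover_kernel G" "g (f x) = n \<otimes>\<^bsub>G\<^esub> x" using gf PG(2) by blast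
    have "g (f x) \<in> cover_kernel G #>\<^bsub>G\<^esub> x" using n by (auto simp: r_coset_def)
    then have "cover_kernel G #>\<^bsub>G\<^esub> x = cover_kernel G #>\<^bsub>G\<^esub> g (f x)"
      using G.repr_independence[OF _ _ N(1)] subgroup.subset[OF PG(1)] x(1) by blast
    moreover have "\<psi> (\<phi> X) = cover_kernel G #>\<^bsub>G\<^esub> g (f x)"
      unfolding x(2) using \<phi>(2)[OF x(1)] \<psi>(2)[OF fP[OF x(1)]] by simp
    ultimately show ?thesis using x(2) by simp
  qed
  moreover have "\<phi> (\<psi> Y) = Y" if Y: "Y \<in> carrier (covered_group (Ph \<alpha> H))" for Y
  proof -
    obtain y where y: "y \<in> PH" "Y = cover_kernel H #>\<^bsub>H\<^esub> y" using Y carr by auto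
    then obtain n where n: "n \<in> cover_kernel H" "f (g y) = n \<otimes>\<^bsub>H\<^esub> y" using fg PH(2) by blast
    have "f (g y) \<in> cover_kernel H #>\<^bsub>H\<^esub> y" using n by (auto simp: r_coset_def)
    then have "cover_kernel H #>\<^bsub>H\<^esub> y = cover_kernel H #>\<^bsub>H\<^esub> f (g y)"
      using H.repr_independence[OF _ _ N(2)] PH(2) y(1) by blast
    moreover have "\<phi> (\<psi> Y) = cover_kernel H #>\<^bsub>H\<^esub> f (g y)"
      unfolding y(2) using \<psi>(2)[OF y(1)] \<phi>(2)[OF gP[OF y(1)]] by simp
    ultimately show ?thesis using y(2) by simp
  qed
  ultimately show ?thesis
    unfolding polish_cover_isomorphic_def using \<phi>(1) \<psi>(1) by blast
qed

section \<open>Free abelian groups\<close>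

lemma ideal_of_int_principal:
  fixes I :: "int set"
  assumes "0 \<in> I" and diff: "\<And>a b. a \<in> I \<Longrightarrow> b \<in> I \<Longrightarrow> a - b \<in> I"
  obtains d where "d \<in> I" "\<And>a. a \<in> I \<Longrightarrow> d dvd a"
proof (cases "I = {0}")
  case True
  then show thesis using that[of 0] by auto
next
  case False
  have uminus: "- a \<in> I" if "a \<in> I" for a using diff[OF assms(1) that] by simp
  have "\<exists>n. 0 < n \<and> int n \<in> I"
  proof -
    obtain a where "a \<in> I" "a \<noteq> 0" using False assms(1) by blast
    then have "0 < nat \<bar>a\<bar> \<and> int (nat \<bar>a\<bar>) \<in> I" using uminus by (auto simp: abs_if)
    then show ?thesis by blast
  qed
  define d where "d = (LEAST n. 0 < n \<and> int n \<in> I)"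
  have d: "0 < d" "int d \<in> I" using LeastI_ex[OF \<open>\<exists>n. 0 < n \<and> int n \<in> I\<close>] by (auto simp: d_def)
  have mult: "int d * k \<in> I" for k
  proof -
    have nat: "int d * int n \<in> I" for n
    proof (induction n)
      case (Suc n)
      then show ?case using diff[OF Suc.IH uminus[OF d(2)]] by (simp add: algebra_simps)
    qed (use assms in simp)
    show ?thesis using nat[of "nat \<bar>k\<bar>"] uminus by (cases "k \<ge> 0") fastforce+
  qed
  show thesis
  proof (rule that[OF d(2)])
    fix a assume a: "a \<in> I"
    have "a mod int d \<in> I"
      using diff[OF a mult[of "a div int d"]] by (simp add: minus_mult_div_eq_mod)
    moreover have "0 \<le> a mod int d" "a mod int d < int d" using d(1) by simp_all
    ultimately have "\<not> 0 < nat (a mod int d)"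
      using not_less_Least[of "nat (a mod int d)" "\<lambda>n. 0 < n \<and> int n \<in> I"] by (auto simp: d_def[symmetric])
    then show "int d dvd a" using \<open>0 \<le> a mod int d\<close> by (simp add: dvd_eq_mod_eq_0)
  qed
qed

lemma lookup_frag_extend:
  "Poly_Mapping.lookup (frag_extend f c) s
     = (\<Sum>x\<in>Poly_Mapping.keys c. Poly_Mapping.lookup c x * Poly_Mapping.lookup (f x) s)"
  unfolding frag_extend_def by (simp add: lookup_sum)

text \<open>Along an enumeration of the basis, choose for each basis element \<open>s\<close> an element of \<open>U\<close> with leading
  term \<open>d s\<close> and \<open>d\<close> minimal.\<close>

lemma subgroup_free_Abelian_group_iso:
  fixes S :: "'a set"
  assumes S: "countable S" and U: "subgroup U (free_Abelian_group S)"
  obtains J :: "'a set" and b :: "'a \<Rightarrow> 'a \<Rightarrow>\<^sub>0 int" where "bij_betw (frag_extend b) (carrier (free_Abelian_group J)) U"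
proof -
  define \<iota> where "\<iota> = to_nat_on S"
  have inj: "inj_on \<iota> S" unfolding \<iota>_def by (rule inj_on_to_nat_on[OF S])
  have US: "Poly_Mapping.keys u \<subseteq> S" if "u \<in> U" for u
  proof -
    have "u \<in> carrier (free_Abelian_group S)" using subgroup.subset[OF U] that by blast
    then show ?thesis by simp
  qed
  have U0: "0 \<in> U" using subgroup.one_closed[OF U] by simp
  have Uadd: "u + v \<in> U" if "u \<in> U" "v \<in> U" for u v using subgroup.m_closed[OF U that] by simp
  have Uminus: "- u \<in> U" if "u \<in> U" for u
    using subgroup.m_inv_closed[OF U that] US[OF that] by simp
  have Udiff: "u - v \<in> U" if "u \<in> U" "v \<in> U" for u v
    using Uadd[OF that(1) Uminus[OF that(2)]] by simp
  have Ucmul: "frag_cmul k u \<in> U" if "u \<in> U" for k u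
    by (rule frag_closure_minus_cmul) (use U0 Udiff that in auto)
  define V where "V = (\<lambda>n. {u \<in> U. \<forall>s \<in> Poly_Mapping.keys u. \<iota> s \<le> n})"
  have Vdiff: "u - v \<in> V n" if "u \<in> V n" "v \<in> V n" for u v n
    using that Udiff keys_diff[of u v] by (auto simp: V_def)
  \<comment> \<open>The coefficients at \<open>s\<close> of elements of \<open>V (\<iota> s)\<close>
    form an ideal of the integers; \<open>b s\<close> realizes a generator, so that leading terms
    can be divided off exactly.\<close>
  have "\<exists>u \<in> V (\<iota> s). \<forall>v \<in> V (\<iota> s). Poly_Mapping.lookup u s dvd Poly_Mapping.lookup v s" for s
  proof -
    have "0 \<in> (\<lambda>u. Poly_Mapping.lookup u s) ` V (\<iota> s)"
      using U0 by (intro image_eqI[of _ _ 0]) (auto simp: V_def)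
    moreover have "x - y \<in> (\<lambda>u. Poly_Mapping.lookup u s) ` V (\<iota> s)"
      if "x \<in> (\<lambda>u. Poly_Mapping.lookup u s) ` V (\<iota> s)" "y \<in> (\<lambda>u. Poly_Mapping.lookup u s) ` V (\<iota> s)" for x y
      using that Vdiff by (auto simp: lookup_minus[symmetric] intro!: imageI)
    ultimately show ?thesis by (rule ideal_of_int_principal) auto
  qed
  then obtain b where b: "\<And>s. b s \<in> V (\<iota> s)"
      "\<And>s v. v \<in> V (\<iota> s) \<Longrightarrow> Poly_Mapping.lookup (b s) s dvd Poly_Mapping.lookup v s" by metis
  define J where "J = {s \<in> S. Poly_Mapping.lookup (b s) s \<noteq> 0}"
  have bU: "b s \<in> U" for s using b(1) by (auto simp: V_def)
  have into: "frag_extend b c \<in> U" for c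
    unfolding frag_extend_def
  proof -
    have "(\<Sum>i\<in>I. frag_cmul (Poly_Mapping.lookup c i) (b i)) \<in> U" if "finite I" for I
      using that by (induction I) (auto simp: U0 Uadd Ucmul bU)
    then show "(\<Sum>i\<in>Poly_Mapping.keys c. frag_cmul (Poly_Mapping.lookup c i) (b i)) \<in> U" by simp
  qed
  \<comment> \<open>Triangularity: at the basis element \<open>s\<close> of largest index in
    \<open>c\<close>, only \<open>b s\<close> can contribute, and its coefficient there is nonzero
    since \<open>s\<close> is in \<open>J\<close>.\<close>
  have zero: "c = 0" if c: "Poly_Mapping.keys c \<subseteq> J" "frag_extend b c = 0" for c
  proof (rule ccontr)
    assume "c \<noteq> 0"
    then have fin: "finite (\<iota> ` Poly_Mapping.keys c)" "\<iota> ` Poly_Mapping.keys c \<noteq> {}" by auto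
    obtain s where s: "s \<in> Poly_Mapping.keys c" "\<iota> s = Max (\<iota> ` Poly_Mapping.keys c)"
      using Max_in[OF fin] by auto
    have "Poly_Mapping.lookup c x * Poly_Mapping.lookup (b x) s = 0" if "x \<in> Poly_Mapping.keys c" "x \<noteq> s" for x
    proof -
      have "\<iota> x \<le> \<iota> s" using Max_ge[OF fin(1)] that(1) s(2) by auto
      moreover have "\<iota> x \<noteq> \<iota> s" using inj that s(1) c(1) by (auto simp: J_def inj_on_def)
      ultimately have "s \<notin> Poly_Mapping.keys (b x)" using b(1)[of x] by (auto simp: V_def)
      then show ?thesis by (simp add: in_keys_iff)
    qed
    then have "Poly_Mapping.lookup (frag_extend b c) s = (\<Sum>x\<in>{s}. Poly_Mapping.lookup c x * Poly_Mapping.lookup (b x) s)"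
      unfolding lookup_frag_extend by (intro sum.mono_neutral_right) (use s(1) in auto)
    moreover have "Poly_Mapping.lookup c s \<noteq> 0" "Poly_Mapping.lookup (b s) s \<noteq> 0"
      using s(1) c(1) by (auto simp: in_keys_iff J_def)
    ultimately show False using c(2) by simp
  qed
  \<comment> \<open>Elimination from the top: subtracting a multiple of \<open>b s\<close> removes
    the leading term of \<open>u\<close>. The strict bound \<open>n\<close> leaves only 0 to treat
    at the start.\<close>
  have surj: "\<exists>c. Poly_Mapping.keys c \<subseteq> J \<and> frag_extend b c = u" if "u \<in> U" "\<forall>s \<in> Poly_Mapping.keys u. \<iota> s < n" for u n
    using that
  proof (induction n arbitrary: u)
    case 0
    then have "u = 0" by (metis all_not_in_conv keys_eq_empty not_less_zero)
    then show ?case by (intro exI[of _ 0]) auto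
  next
    case (Suc n)
    show ?case
    proof (cases "\<exists>s \<in> Poly_Mapping.keys u. \<iota> s = n")
      case False
      then show ?thesis using Suc by (metis less_antisym)
    next
      case True
      then obtain s where s: "s \<in> Poly_Mapping.keys u" "\<iota> s = n" by blast
      have "u \<in> V (\<iota> s)" using Suc.prems s(2) by (auto simp: V_def)
      then obtain k where k: "Poly_Mapping.lookup u s = Poly_Mapping.lookup (b s) s * k"
        using b(2) by (blast elim: dvdE)
      have sJ: "s \<in> J" using s(1) k US[OF Suc.prems(1)] by (auto simp: J_def in_keys_iff)
      let ?w = "u - frag_cmul k (b s)"
      have "?w \<in> U" using Suc.prems(1) Udiff Ucmul bU by blast
      moreover have "\<iota> t < n" if "t \<in> Poly_Mapping.keys ?w" for t
      proof -
        have t: "t \<in> Poly_Mapping.keys u \<union> Poly_Mapping.keys (b s)"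
          using that keys_diff[of u "frag_cmul k (b s)"] keys_cmul[of k "b s"] by blast
        then have "\<iota> t \<le> n" using Suc.prems(2) b(1)[of s] s(2) by (auto simp: V_def)
        moreover have "t \<in> S" using t US Suc.prems(1) bU by blast
        moreover have "t \<noteq> s" using that k by (auto simp: in_keys_iff lookup_minus)
        ultimately show ?thesis using inj s US[OF Suc.prems(1)]
          by (metis inj_on_eq_iff le_neq_implies_less subsetD)
      qed
      ultimately obtain c where c: "Poly_Mapping.keys c \<subseteq> J" "frag_extend b c = ?w"
        using Suc.IH by blast
      have "frag_extend b (c + frag_cmul k (frag_of s)) = u"
        by (simp add: frag_extend_add frag_extend_cmul c(2))
      moreover have "Poly_Mapping.keys (c + frag_cmul k (frag_of s)) \<subseteq> J"
        using keys_add[of c "frag_cmul k (frag_of s)"] keys_cmul[of k "frag_of s"] c(1) sJ by auto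
      ultimately show ?thesis by blast
    qed
  qed
  have "bij_betw (frag_extend b) (carrier (free_Abelian_group J)) U"
    unfolding bij_betw_def
  proof
    show "inj_on (frag_extend b) (carrier (free_Abelian_group J))"
    proof (rule inj_onI)
      fix x y assume xy: "x \<in> carrier (free_Abelian_group J)" "y \<in> carrier (free_Abelian_group J)"
        "frag_extend b x = frag_extend b y"
      have "Poly_Mapping.keys (x - y) \<subseteq> J" using keys_diff[of x y] xy(1,2) by auto
      moreover have "frag_extend b (x - y) = 0" using xy(3) by (simp add: frag_extend_diff)
      ultimately have "x - y = 0" by (rule zero)
      then show "x = y" by simp
    qed
    show "frag_extend b ` carrier (free_Abelian_group J) = U"
    proof
      show "U \<subseteq> frag_extend b ` carrier (free_Abelian_group J)"
      proof
        fix u assume u: "u \<in> U"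
        have "\<forall>s \<in> Poly_Mapping.keys u. \<iota> s < Suc (Max (\<iota> ` Poly_Mapping.keys u))"
          by (simp add: less_Suc_eq_le)
        then show "u \<in> frag_extend b ` carrier (free_Abelian_group J)" using surj[OF u] by (metis carrier_free_Abelian_group_iff imageI)
      qed
    qed (use into in auto)
  qed
  then show thesis by (rule that)
qed

text \<open>Projectivity: the images under \<open>h\<close> of the basis elements are lifted through
  \<open>p\<close> by choice, and the universal property extends the choice to a
  homomorphism.\<close>

lemma free_Abelian_group_lift:
  assumes P: "P \<cong> free_Abelian_group S" "group P" and E: "comm_group E" and p: "p \<in> epi E Q" and h: "h \<in> hom P Q"
    and Q: "group Q"
  shows "\<exists>l \<in> hom P E. \<forall>x \<in> carrier P. p (l x) = h x"
proof -
  interpret E: comm_group E by (rule E)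
  interpret Q: group Q by (rule Q)
  let ?F = "free_Abelian_group S"
  obtain \<phi> \<psi> where iso: "group_isomorphisms P ?F \<phi> \<psi>"
    using P group.iso_iff_group_isomorphisms[OF P(2)] by (force simp: is_iso_def)
  then have \<phi>: "\<phi> \<in> hom P ?F" "\<psi> \<in> hom ?F P" "\<And>x. x \<in> carrier P \<Longrightarrow> \<psi> (\<phi> x) = x"
    by (auto simp: group_isomorphisms_def)
  have hp: "h \<circ> \<psi> \<in> hom ?F Q" using hom_compose[OF \<phi>(2) h] .
  have ph: "p \<in> hom E Q" "p ` carrier E = carrier Q" using p by (auto simp: epi_def)
  have "\<exists>e \<in> carrier E. p e = h (\<psi> (frag_of s))" if "s \<in> S" for s
  proof -
    have "(h \<circ> \<psi>) (frag_of s) \<in> p ` carrier E" using hp that unfolding ph(2) by (auto simp: hom_def)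
    then show ?thesis by (metis comp_apply imageE)
  qed
  then obtain e where e: "\<And>s. s \<in> S \<Longrightarrow> e s \<in> carrier E" "\<And>s. s \<in> S \<Longrightarrow> p (e s) = h (\<psi> (frag_of s))" by metis
  then have "e ` S \<subseteq> carrier E" by blast
  then obtain k where k: "k \<in> hom ?F E" "\<And>s. s \<in> S \<Longrightarrow> k (frag_of s) = e s"
    by (metis E.free_Abelian_group_universal)
  interpret a: group_hom ?F Q "h \<circ> \<psi>"
    by (intro group_hom.intro group_hom_axioms.intro group_free_Abelian_group Q hp)
  have "p \<circ> k \<in> hom ?F Q" using hom_compose[OF k(1) ph(1)] .
  then interpret b: group_hom ?F Q "p \<circ> k"
    by (intro group_hom.intro group_hom_axioms.intro group_free_Abelian_group Q)
  have eq: "(p \<circ> k) c = (h \<circ> \<psi>) c" if "Poly_Mapping.keys c \<subseteq> S" for c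
  proof (rule free_Abelian_group_induct[OF that])
    show "(p \<circ> k) 0 = (h \<circ> \<psi>) 0" using a.hom_one b.hom_one by simp
    show "(p \<circ> k) (x - y) = (h \<circ> \<psi>) (x - y)"
      if xy: "Poly_Mapping.keys x \<subseteq> S" "Poly_Mapping.keys y \<subseteq> S" "(p \<circ> k) x = (h \<circ> \<psi>) x" "(p \<circ> k) y = (h \<circ> \<psi>) y" for x y
    proof -
      have "(p \<circ> k) (x \<otimes>\<^bsub>?F\<^esub> inv\<^bsub>?F\<^esub> y) = (h \<circ> \<psi>) (x \<otimes>\<^bsub>?F\<^esub> inv\<^bsub>?F\<^esub> y)"
        using a.hom_mult[of x "inv\<^bsub>?F\<^esub> y"] b.hom_mult[of x "inv\<^bsub>?F\<^esub> y"] a.hom_inv[of y] b.hom_inv[of y] xy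
        by simp
      then show ?thesis using xy by simp
    qed
    show "(p \<circ> k) (frag_of s) = (h \<circ> \<psi>) (frag_of s)" if "s \<in> S" for s
      using that k(2) e(2) by simp
  qed
  have "p (k (\<phi> x)) = h x" if "x \<in> carrier P" for x
  proof -
    have "Poly_Mapping.keys (\<phi> x) \<subseteq> S" using \<phi>(1) that by (force simp: hom_def)
    from eq[OF this] show ?thesis using \<phi>(3)[OF that] by simp
  qed
  moreover have "k \<circ> \<phi> \<in> hom P E" using hom_compose[OF \<phi>(1) k(1)] .
  ultimately show ?thesis by (intro bexI[of _ "k \<circ> \<phi>"]) auto
qed

text \<open>Cycles and boundaries are given only as subgroups of a free group of chains; freeness of
  such subgroups makes them projective too.\<close>

lemma subgroup_free_Abelian_group_lift:
  fixes S :: "'a set"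
  assumes S: "countable S" and U: "subgroup U (free_Abelian_group S)"
    and E: "comm_group E" and p: "p \<in> epi E Q" and h: "h \<in> hom (free_Abelian_group S\<lparr>carrier := U\<rparr>) Q"
    and Q: "group Q"
  shows "\<exists>l \<in> hom (free_Abelian_group S\<lparr>carrier := U\<rparr>) E. \<forall>x \<in> U. p (l x) = h x"
proof -
  let ?U = "free_Abelian_group S\<lparr>carrier := U\<rparr>"
  obtain J :: "'a set" and b :: "'a \<Rightarrow> 'a \<Rightarrow>\<^sub>0 int" where b: "bij_betw (frag_extend b) (carrier (free_Abelian_group J)) U"
    by (rule subgroup_free_Abelian_group_iso[OF S U])
  have grp: "group ?U" by (rule subgroup.subgroup_is_group[OF U group_free_Abelian_group])
  have "frag_extend b \<in> iso (free_Abelian_group J) ?U"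
    using b bij_betwE[OF b] by (auto simp: iso_def hom_def frag_extend_add)
  then have "?U \<cong> free_Abelian_group J"
    using group.iso_sym[OF group_free_Abelian_group] by (auto simp: is_iso_def)
  from free_Abelian_group_lift[OF this grp E p h Q] show ?thesis by simp
qed

section \<open>Polish groups of homomorphisms\<close>

lemma second_countable_product_discrete:
  assumes I: "countable I" and A: "countable A"
  shows "second_countable (product_topology (\<lambda>_. discrete_topology A) I)"
  unfolding second_countable_def
proof (intro exI conjI allI impI ballI)
  let ?X = "product_topology (\<lambda>_. discrete_topology A) I"
  \<comment> \<open>Cylinder sets: a finite partial assignment \<open>P\<close> prescribes finitely
    many values. There are only countably many such \<open>P\<close>.\<close>
  define B where "B = (\<lambda>P. {f \<in> I \<rightarrow>\<^sub>E A. \<forall>(i, a) \<in> P. f i = a})"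
  let ?B = "B ` {P. finite P \<and> P \<subseteq> I \<times> A}"
  show "countable ?B"
    using I A by (intro countable_image countable_Collect_finite_subset countable_SIGMA)
  show "openin ?X V" if V: "V \<in> ?B" for V
    unfolding openin_product_topology_alt
  proof
    obtain P where P: "finite P" "P \<subseteq> I \<times> A" "V = B P" using V by auto
    fix f assume f: "f \<in> V"
    have "finite {i \<in> I. (if i \<in> fst ` P then {f i} else A) \<noteq> topspace (discrete_topology A)}"
      by (rule finite_subset[of _ "fst ` P"]) (use P in auto)
    moreover have "f \<in> PiE I (\<lambda>i. if i \<in> fst ` P then {f i} else A)"
      using f P by (auto simp: B_def)
    moreover have "PiE I (\<lambda>i. if i \<in> fst ` P then {f i} else A) \<subseteq> V"
    proof
      fix g assume g: "g \<in> PiE I (\<lambda>i. if i \<in> fst ` P then {f i} else A)"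
      have fA: "f \<in> I \<rightarrow>\<^sub>E A" "\<And>i a. (i, a) \<in> P \<Longrightarrow> f i = a" using f P(3) by (auto simp: B_def)
      have "g i = f i" if "i \<in> fst ` P" for i using PiE_mem[OF g, of i] that P(2) by auto
      moreover have "g i \<in> A" if "i \<in> I" for i
        using PiE_mem[OF g that] PiE_mem[OF fA(1) that] by (auto split: if_splits)
      ultimately show "g \<in> V" using g fA(2) unfolding P(3) B_def by (force simp: PiE_iff)
    qed
    ultimately show "\<exists>U. finite {i \<in> I. U i \<noteq> topspace (discrete_topology A)} \<and>
        (\<forall>i\<in>I. openin (discrete_topology A) (U i)) \<and> f \<in> Pi\<^sub>E I U \<and> Pi\<^sub>E I U \<subseteq> V"
      using f P(3) by (intro exI[of _ "\<lambda>i. if i \<in> fst ` P then {f i} else A"]) (auto simp: B_def)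
  qed
  fix W f assume W: "openin ?X W \<and> f \<in> W"
  then have "\<exists>U. finite {i \<in> I. U i \<noteq> topspace (discrete_topology A)} \<and>
      (\<forall>i\<in>I. openin (discrete_topology A) (U i)) \<and> f \<in> Pi\<^sub>E I U \<and> Pi\<^sub>E I U \<subseteq> W"
    unfolding openin_product_topology_alt by blast
  then obtain U where "finite {i \<in> I. U i \<noteq> topspace (discrete_topology A)} \<and>
      (\<forall>i\<in>I. openin (discrete_topology A) (U i)) \<and> f \<in> Pi\<^sub>E I U \<and> Pi\<^sub>E I U \<subseteq> W"
    by (rule exE)
  then have U: "finite {i \<in> I. U i \<noteq> A}" "\<And>i. i \<in> I \<Longrightarrow> U i \<subseteq> A" "f \<in> Pi\<^sub>E I U" "Pi\<^sub>E I U \<subseteq> W"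
    by simp_all
  define P where "P = (\<lambda>i. (i, f i)) ` {i \<in> I. U i \<noteq> A}"
  have "f i \<in> A" if "i \<in> I" for i using PiE_mem[OF U(3) that] U(2)[OF that] by blast
  then have "P \<in> {P. finite P \<and> P \<subseteq> I \<times> A}" using U(1) by (auto simp: P_def)
  then have "B P \<in> ?B" by (rule imageI)
  moreover have "f \<in> B P" using U(2,3) by (auto simp: B_def P_def PiE_iff)
  moreover have "B P \<subseteq> W"
  proof
    fix g assume g: "g \<in> B P"
    have "g i \<in> U i" if "i \<in> I" for i
    proof (cases "U i = A")
      case True then show ?thesis using g that by (auto simp: B_def)
    next
      case False
      then have "g i = f i" using g that by (auto simp: B_def P_def)
      then show ?thesis using PiE_mem[OF U(3) that] by simp
    qed
    then have "g \<in> Pi\<^sub>E I U" using g by (auto simp: B_def PiE_iff)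
    then show "g \<in> W" using U(4) by (rule subsetD[rotated])
  qed
  ultimately show "\<exists>V\<in>?B. f \<in> V \<and> V \<subseteq> W" by (intro bexI[of _ "B P"] conjI)
qed

lemma abelian_polish_group_discrete:
  assumes "comm_group A" "countable (carrier A)"
  shows "abelian_polish_group A (discrete_topology (carrier A))"
proof -
  interpret A: comm_group A by (rule assms(1))
  show ?thesis
    unfolding abelian_polish_group_def
    by (auto simp: assms completely_metrizable_space_discrete_topology second_countable_discrete_topology
        continuous_map_def simp flip: prod_topology_discrete_topology)
qed

lemma hom_groupD:
  assumes "f \<in> carrier (hom_group C A)"
  shows "f \<in> hom C A" "f \<in> extensional (carrier C)" "c \<in> carrier C \<Longrightarrow> f c \<in> carrier A"
  using assms by (auto simp: hom_group_def hom_def)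

lemma hom_group_simps:
  "monoid.mult (hom_group C A) f g = (\<lambda>x\<in>carrier C. f x \<otimes>\<^bsub>A\<^esub> g x)"
  "\<one>\<^bsub>hom_group C A\<^esub> = (\<lambda>x\<in>carrier C. \<one>\<^bsub>A\<^esub>)"
  by (simp_all add: hom_group_def)

lemma hom_group_memI:
  assumes "f \<in> hom C A" "group C"
  shows "restrict f (carrier C) \<in> carrier (hom_group C A)"
  using group.hom_restrict[OF assms(2), of f A "restrict f (carrier C)"] assms(1) by (simp add: hom_group_def)

lemma comm_group_hom_group:
  assumes C: "group C" and A: "comm_group A"
  shows "comm_group (hom_group C A)"
proof -
  interpret C: group C by (rule C)
  interpret A: comm_group A by (rule A)
  show ?thesis
  proof (rule comm_groupI)
    fix f g h assume f: "f \<in> carrier (hom_group C A)" and g: "g \<in> carrier (hom_group C A)" and h: "h \<in> carrier (hom_group C A)"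
    note fD = hom_groupD[OF f] and gD = hom_groupD[OF g] and hD = hom_groupD[OF h]
    have "(\<lambda>x. f x \<otimes>\<^bsub>A\<^esub> g x) \<in> hom C A"
      using fD(1,3) gD(1,3) by (auto intro!: homI simp: hom_mult[OF fD(1)] hom_mult[OF gD(1)] A.m_ac)
    from hom_group_memI[OF this C] show "f \<otimes>\<^bsub>hom_group C A\<^esub> g \<in> carrier (hom_group C A)"
      by (simp add: hom_group_simps)
    show "f \<otimes>\<^bsub>hom_group C A\<^esub> g \<otimes>\<^bsub>hom_group C A\<^esub> h = f \<otimes>\<^bsub>hom_group C A\<^esub> (g \<otimes>\<^bsub>hom_group C A\<^esub> h)"
      using fD gD hD by (auto simp: hom_group_simps A.m_assoc intro!: restrict_ext)
    show "f \<otimes>\<^bsub>hom_group C A\<^esub> g = g \<otimes>\<^bsub>hom_group C A\<^esub> f"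
      using fD gD by (auto simp: hom_group_simps A.m_comm intro!: restrict_ext)
    show "\<one>\<^bsub>hom_group C A\<^esub> \<otimes>\<^bsub>hom_group C A\<^esub> f = f"
      using fD by (auto simp: hom_group_simps extensional_def restrict_def)
    have "(\<lambda>x. inv\<^bsub>A\<^esub> f x) \<in> hom C A"
      using fD(1,3) by (auto intro!: homI simp: hom_mult[OF fD(1)] A.inv_mult)
    from hom_group_memI[OF this C] show "\<exists>y\<in>carrier (hom_group C A). y \<otimes>\<^bsub>hom_group C A\<^esub> f = \<one>\<^bsub>hom_group C A\<^esub>"
      by (rule rev_bexI) (use fD in \<open>auto simp: hom_group_simps intro!: restrict_ext\<close>)
  next
    have "(\<lambda>x. \<one>\<^bsub>A\<^esub>) \<in> hom C A" by (simp add: homI)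
    from hom_group_memI[OF this C] show "\<one>\<^bsub>hom_group C A\<^esub> \<in> carrier (hom_group C A)"
      by (simp add: hom_group_simps)
  qed
qed

lemma topspace_hom_topology: "topspace (hom_topology C A) = carrier (hom_group C A)"
  unfolding hom_topology_def hom_group_def by (auto simp: hom_def PiE_def)

lemma continuous_map_hom_topology_eval:
  "c \<in> carrier C \<Longrightarrow> continuous_map (hom_topology C A) (discrete_topology (carrier A)) (\<lambda>f. f c)"
  unfolding hom_topology_def
  by (intro continuous_map_from_subtopology continuous_map_product_projection)

lemma continuous_map_into_hom_topology:
  assumes "\<And>x. x \<in> topspace X \<Longrightarrow> F x \<in> carrier (hom_group C A)"
    and "\<And>c. c \<in> carrier C \<Longrightarrow> continuous_map X (discrete_topology (carrier A)) (\<lambda>x. F x c)"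
  shows "continuous_map X (hom_topology C A) F"
  unfolding hom_topology_def continuous_map_in_subtopology continuous_map_componentwise
  using assms(1)[THEN hom_groupD(2)] assms by auto

text \<open>Additivity is one equation between continuous functions for each pair of elements, so
  the homomorphisms form a closed subset of a countable product of discrete spaces.\<close>

lemma abelian_polish_group_hom:
  assumes C: "group C" "countable (carrier C)" and A: "comm_group A" "countable (carrier A)"
  shows "abelian_polish_group (hom_group C A) (hom_topology C A)"
proof -
  interpret C: group C by (rule C)
  interpret A: comm_group A by (rule A)
  interpret H: comm_group "hom_group C A" by (rule comm_group_hom_group[OF C(1) A(1)])
  note dA = abelian_polish_group_discrete[OF A]
  let ?X = "product_topology (\<lambda>_. discrete_topology (carrier A)) (carrier C)"
  have proj: "continuous_map ?X (discrete_topology (carrier A)) (\<lambda>f. f c)" if "c \<in> carrier C" for c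
    using that by (intro continuous_map_product_projection)
  have "closedin ?X {f \<in> topspace ?X. f (x \<otimes>\<^bsub>C\<^esub> y) = f x \<otimes>\<^bsub>A\<^esub> f y}"
    if "x \<in> carrier C" "y \<in> carrier C" for x y
    by (rule closedin_continuous_maps_eq[where Y = "discrete_topology (carrier A)"])
      (use that proj in \<open>auto intro!: continuous_map_abelian_polish_mult[OF dA]\<close>)
  then have "closedin ?X (topspace ?X \<inter> (\<Inter>(x, y) \<in> carrier C \<times> carrier C. {f \<in> topspace ?X. f (x \<otimes>\<^bsub>C\<^esub> y) = f x \<otimes>\<^bsub>A\<^esub> f y}))"
    by (intro closedin_Int closedin_topspace closedin_INT) auto
  moreover have "topspace ?X \<inter> (\<Inter>(x, y) \<in> carrier C \<times> carrier C. {f \<in> topspace ?X. f (x \<otimes>\<^bsub>C\<^esub> y) = f x \<otimes>\<^bsub>A\<^esub> f y}) = carrier (hom_group C A)"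
    by (auto simp: hom_group_def hom_def PiE_def)
  ultimately have closed: "closedin ?X (carrier (hom_group C A))" by simp
  have "completely_metrizable_space ?X"
    using C(2) unfolding completely_metrizable_space_product_topology
    by (auto simp: completely_metrizable_space_discrete_topology intro: countable_subset)
  then have "completely_metrizable_space (hom_topology C A)"
    unfolding hom_topology_def using closed by (rule completely_metrizable_space_closedin)
  moreover have "second_countable (hom_topology C A)"
    unfolding hom_topology_def by (intro second_countable_subtopology second_countable_product_discrete C A)
  moreover have "continuous_map (prod_topology (hom_topology C A) (hom_topology C A)) (hom_topology C A)
      (\<lambda>p. fst p \<otimes>\<^bsub>hom_group C A\<^esub> snd p)"
  proof (rule continuous_map_into_hom_topology)
    fix c assume c: "c \<in> carrier C"
    have "continuous_map (prod_topology (hom_topology C A) (hom_topology C A)) (discrete_topology (carrier A))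
       (\<lambda>p. fst p c \<otimes>\<^bsub>A\<^esub> snd p c)"
      using continuous_map_compose[OF continuous_map_fst continuous_map_hom_topology_eval[OF c]]
        continuous_map_compose[OF continuous_map_snd continuous_map_hom_topology_eval[OF c]]
      by (intro continuous_map_abelian_polish_mult[OF dA]) (auto simp: o_def)
    then show "continuous_map (prod_topology (hom_topology C A) (hom_topology C A)) (discrete_topology (carrier A))
       (\<lambda>p. (fst p \<otimes>\<^bsub>hom_group C A\<^esub> snd p) c)"
      using c by (simp add: hom_group_simps)
  qed (auto simp: topspace_hom_topology)
  moreover have "continuous_map (hom_topology C A) (hom_topology C A) (\<lambda>f. inv\<^bsub>hom_group C A\<^esub> f)"
  proof (rule continuous_map_into_hom_topology)
    have inv: "inv\<^bsub>hom_group C A\<^esub> f = (\<lambda>x\<in>carrier C. inv\<^bsub>A\<^esub> (f x))" if f: "f \<in> carrier (hom_group C A)" for f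
    proof (rule H.inv_equality[OF _ f])
      note fD = hom_groupD[OF f]
      have "(\<lambda>x. inv\<^bsub>A\<^esub> f x) \<in> hom C A"
        using fD(1,3) by (auto intro!: homI simp: hom_mult[OF fD(1)] A.inv_mult)
      then show "(\<lambda>x\<in>carrier C. inv\<^bsub>A\<^esub> (f x)) \<in> carrier (hom_group C A)" using C(1) by (rule hom_group_memI)
      show "(\<lambda>x\<in>carrier C. inv\<^bsub>A\<^esub> (f x)) \<otimes>\<^bsub>hom_group C A\<^esub> f = \<one>\<^bsub>hom_group C A\<^esub>"
        using fD by (auto simp: hom_group_simps intro!: restrict_ext)
    qed
    fix c assume c: "c \<in> carrier C"
    have "continuous_map (hom_topology C A) (discrete_topology (carrier A)) (\<lambda>f. inv\<^bsub>A\<^esub> (f c))"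
      using continuous_map_hom_topology_eval[OF c] by (rule continuous_map_abelian_polish_inv[OF dA])
    then show "continuous_map (hom_topology C A) (discrete_topology (carrier A)) (\<lambda>f. (inv\<^bsub>hom_group C A\<^esub> f) c)"
      by (rule continuous_map_eq) (simp add: topspace_hom_topology inv c)
  qed (auto simp: topspace_hom_topology)
  ultimately show ?thesis
    unfolding abelian_polish_group_def
    using H.comm_group_axioms by (simp add: topspace_hom_topology case_prod_unfold)
qed

lemma abelian_polish_group_cong:
  assumes G: "abelian_polish_group G T" and H: "carrier H = carrier G" "monoid.mult H = monoid.mult G" "one H = one G"
  shows "abelian_polish_group H T"
proof -
  have "inv\<^bsub>H\<^esub> x = inv\<^bsub>G\<^esub> x" for x by (simp add: m_inv_def H)
  then show ?thesis
    using G comm_group_cong[of G H] H by (simp add: abelian_polish_group_def)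
qed

text \<open>The coboundary, the restriction from \<open>F\<close> to \<open>R\<close> and both
  comparison maps between the covers are precompositions, so all of them are continuous
  homomorphisms for this one reason.\<close>

lemma continuous_map_precompose:
  assumes D: "group D" and u: "u \<in> hom D C"
  shows "continuous_map (hom_topology C A) (hom_topology D A) (\<lambda>f. \<lambda>x\<in>carrier D. f (u x))"
    and "(\<lambda>f. \<lambda>x\<in>carrier D. f (u x)) \<in> hom (hom_group C A) (hom_group D A)"
proof -
  have uC: "u x \<in> carrier C" if "x \<in> carrier D" for x using u that by (auto simp: hom_def)
  have mem: "(\<lambda>x\<in>carrier D. f (u x)) \<in> carrier (hom_group D A)" if "f \<in> carrier (hom_group C A)" for f
    using hom_group_memI[OF hom_compose[OF u hom_groupD(1)[OF that]] D] by (simp add: o_def)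
  show "continuous_map (hom_topology C A) (hom_topology D A) (\<lambda>f. \<lambda>x\<in>carrier D. f (u x))"
    by (rule continuous_map_into_hom_topology)
      (use mem continuous_map_hom_topology_eval[OF uC] in \<open>auto simp: topspace_hom_topology\<close>)
  show "(\<lambda>f. \<lambda>x\<in>carrier D. f (u x)) \<in> hom (hom_group C A) (hom_group D A)"
    using uC mem by (auto intro!: homI restrict_ext simp: hom_group_simps)
qed

section \<open>Ordered simplicial chains\<close>

lemma ordered_boundary_of:
  "ordered_boundary n (frag_of s) = (\<Sum>j\<le>Suc n. frag_cmul ((-1) ^ j) (frag_of (take j s @ drop (Suc j) s)))"
  by (simp add: ordered_boundary_def del: sum.atMost_Suc)

lemma ordered_boundary_0 [simp]: "ordered_boundary n 0 = 0"
  and ordered_boundary_diff: "ordered_boundary n (a - b) = ordered_boundary n a - ordered_boundary n b"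
  and ordered_boundary_add: "ordered_boundary n (a + b) = ordered_boundary n a + ordered_boundary n b"
  and ordered_boundary_minus: "ordered_boundary n (- a) = - ordered_boundary n a"
  by (simp_all add: ordered_boundary_def frag_extend_diff frag_extend_add frag_extend_minus)

text \<open>Repetitions are allowed in ordered simplices, so a vertex of \<open>s\<close> may itself
  serve as apex and the cone stays over the same simplex. This makes the ordered chains on a simplex
  acyclic.\<close>

definition ordered_cone :: "'v \<Rightarrow> ('v list \<Rightarrow>\<^sub>0 int) \<Rightarrow> ('v list \<Rightarrow>\<^sub>0 int)" where
  "ordered_cone v = frag_extend (\<lambda>s. frag_of (v # s))"

lemma ordered_cone_of [simp]: "ordered_cone v (frag_of s) = frag_of (v # s)"
  and ordered_cone_0 [simp]: "ordered_cone v 0 = 0"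
  and ordered_cone_diff: "ordered_cone v (a - b) = ordered_cone v a - ordered_cone v b"
  by (simp_all add: ordered_cone_def frag_extend_diff)

lemma keys_ordered_cone: "Poly_Mapping.keys (ordered_cone v c) \<subseteq> (#) v ` Poly_Mapping.keys c"
  unfolding ordered_cone_def using keys_frag_extend[of "\<lambda>s. frag_of (v # s)" c] by auto

lemma ordered_boundary_Cons:
  "ordered_boundary (Suc n) (frag_of (v # s)) = frag_of s - ordered_cone v (ordered_boundary n (frag_of s))"
proof -
  have "ordered_boundary (Suc n) (frag_of (v # s))
      = frag_of s + (\<Sum>j\<le>Suc n. frag_cmul ((-1) ^ Suc j) (frag_of (v # take j s @ drop (Suc j) s)))"
    unfolding ordered_boundary_of by (subst sum.atMost_Suc_shift) simp
  also have "(\<Sum>j\<le>Suc n. frag_cmul ((-1) ^ Suc j) (frag_of (v # take j s @ drop (Suc j) s)))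
      = - ordered_cone v (ordered_boundary n (frag_of s))"
    unfolding ordered_boundary_of ordered_cone_def
    by (simp add: frag_extend_sum frag_extend_cmul o_def flip: sum_negf del: sum.atMost_Suc)
  finally show ?thesis by simp
qed

lemma ordered_boundary_pair: "ordered_boundary 0 (frag_of [v, w]) = frag_of [w] - frag_of [v]"
  by (simp add: ordered_boundary_of)

lemma ordered_boundary_cone:
  "ordered_boundary (Suc n) (ordered_cone v c) = c - ordered_cone v (ordered_boundary n c)"
  using subset_UNIV
  by (induction c rule: frag_induction)
    (simp_all add: ordered_boundary_Cons ordered_boundary_diff ordered_cone_diff)

lemma keys_ordered_boundary:
  assumes "length s = Suc (Suc n)"
  shows "Poly_Mapping.keys (ordered_boundary n (frag_of s)) \<subseteq> {t. length t = Suc n \<and> set t \<subseteq> set s}"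
proof -
  have set: "set (take j s @ drop (Suc j) s) \<subseteq> set s" for j
    using set_take_subset[of j s] set_drop_subset[of "Suc j" s] by auto
  have len: "length (take j s @ drop (Suc j) s) = Suc n" if "j \<le> Suc n" for j
    using that assms by simp
  have "Poly_Mapping.keys (frag_cmul ((-1) ^ j) (frag_of (take j s @ drop (Suc j) s)))
      \<subseteq> {t. length t = Suc n \<and> set t \<subseteq> set s}" if "j \<le> Suc n" for j
  proof -
    have "take j s @ drop (Suc j) s \<in> {t. length t = Suc n \<and> set t \<subseteq> set s}"
      using set[of j] len[OF that] by blast
    then show ?thesis
      using keys_cmul[of "(-1) ^ j" "frag_of (take j s @ drop (Suc j) s)"] unfolding keys_frag_of by blast
  qed
  then show ?thesis
    unfolding ordered_boundary_of
    using keys_sum[of "\<lambda>j. frag_cmul ((-1) ^ j) (frag_of (take j s @ drop (Suc j) s))" "{..Suc n}"] by blast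
qed

lemma ordered_simplices_subset:
  assumes "abstract_simplicial_complex K" "s \<in> ordered_simplices K n" "set t \<subseteq> set s" "length t = Suc m"
  shows "t \<in> ordered_simplices K m"
proof -
  have "set t \<noteq> {}" using assms(4) by auto
  then have "set t \<in> K"
    using assms(1-3) unfolding abstract_simplicial_complex_def ordered_simplices_def by blast
  then show ?thesis using assms(4) by (simp add: ordered_simplices_def)
qed

lemma keys_ordered_boundary_chain:
  assumes K: "abstract_simplicial_complex K" and c: "Poly_Mapping.keys c \<subseteq> ordered_simplices K (Suc n)"
  shows "Poly_Mapping.keys (ordered_boundary n c) \<subseteq> ordered_simplices K n"
proof -
  have "Poly_Mapping.keys (ordered_boundary n (frag_of s)) \<subseteq> ordered_simplices K n"
    if s: "s \<in> ordered_simplices K (Suc n)" for s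
  proof
    fix t assume "t \<in> Poly_Mapping.keys (ordered_boundary n (frag_of s))"
    then have "length t = Suc n" "set t \<subseteq> set s"
      using keys_ordered_boundary[of s n] s by (auto simp: ordered_simplices_def)
    then show "t \<in> ordered_simplices K n" by (intro ordered_simplices_subset[OF K s])
  qed
  with c show ?thesis
  proof (induction c rule: frag_induction)
    case (diff a b)
    then show ?case
      using keys_diff[of "ordered_boundary n a" "ordered_boundary n b"] by (auto simp: ordered_boundary_diff)
  qed auto
qed

text \<open>The cone formula replaces the cancellation in the double sum: for \<open>v # t\<close>
  the two terms involving the boundary of \<open>t\<close> cancel, and what remains is a cone over
  its double boundary, zero by induction.\<close>

lemma ordered_boundary_boundary:
  assumes "Poly_Mapping.keys c \<subseteq> {s. length s = Suc (Suc (Suc n))}"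
  shows "ordered_boundary n (ordered_boundary (Suc n) c) = 0"
  using assms
proof (induction n arbitrary: c)
  case 0
  then show ?case
  proof (induction c rule: frag_induction)
    case (one s)
    then obtain u v w where "s = [u, v, w]" by (auto simp: length_Suc_conv)
    then show ?case
      by (simp add: ordered_boundary_Cons ordered_boundary_pair ordered_cone_diff ordered_boundary_diff)
  qed (simp_all add: ordered_boundary_diff)
next
  case (Suc n)
  note IH = Suc.IH
  from Suc.prems show ?case
  proof (induction c rule: frag_induction)
    case (one s)
    then obtain v t where s: "s = v # t" "length t = Suc (Suc (Suc n))" by (auto simp: length_Suc_conv)
    then show ?case
      using IH[of "frag_of t"] by (simp add: ordered_boundary_Cons ordered_boundary_cone ordered_boundary_diff)
  qed (simp_all add: ordered_boundary_diff)
qed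

definition ordered_cycles :: "'v set set \<Rightarrow> nat \<Rightarrow> ('v list \<Rightarrow>\<^sub>0 int) set" where
  "ordered_cycles K n =
     {z. Poly_Mapping.keys z \<subseteq> ordered_simplices K n \<and> (case n of 0 \<Rightarrow> True | Suc m \<Rightarrow> ordered_boundary m z = 0)}"

definition ordered_boundaries :: "'v set set \<Rightarrow> nat \<Rightarrow> ('v list \<Rightarrow>\<^sub>0 int) set" where
  "ordered_boundaries K n = ordered_boundary n ` {c. Poly_Mapping.keys c \<subseteq> ordered_simplices K (Suc n)}"

lemma ordered_boundaries_subset_cycles:
  assumes "abstract_simplicial_complex K"
  shows "ordered_boundaries K n \<subseteq> ordered_cycles K n"
proof
  fix z assume "z \<in> ordered_boundaries K n"
  then obtain c where c: "Poly_Mapping.keys c \<subseteq> ordered_simplices K (Suc n)" "z = ordered_boundary n c"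
    by (auto simp: ordered_boundaries_def)
  have "ordered_boundary m (ordered_boundary (Suc m) c) = 0" if "n = Suc m" for m
    by (rule ordered_boundary_boundary) (use c that in \<open>auto simp: ordered_simplices_def\<close>)
  then show "z \<in> ordered_cycles K n"
    using keys_ordered_boundary_chain[OF assms c(1)] c(2) by (auto simp: ordered_cycles_def split: nat.split)
qed

text \<open>Both \<open>f\<close> and the identity are carried by full simplices and agree on
  vertices, so a chain homotopy between them can be built degree by degree by coning. On a cycle,
  the boundary of the homotopy is the difference of the two maps.\<close>

lemma acyclic_carrier_homotopy:
  fixes f :: "nat \<Rightarrow> 'v list \<Rightarrow> ('v list \<Rightarrow>\<^sub>0 int)"
  assumes chain: "\<And>n s. length s = Suc (Suc n) \<Longrightarrow>
      frag_extend (f n) (ordered_boundary n (frag_of s)) = ordered_boundary n (f (Suc n) s)"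
    and carried: "\<And>n s. length s = Suc n \<Longrightarrow> Poly_Mapping.keys (f n s) \<subseteq> {t. length t = Suc n \<and> set t \<subseteq> set s}"
    and augment: "\<And>v. f 0 [v] = frag_of [v]"
    and K: "abstract_simplicial_complex K" and z: "z \<in> ordered_cycles K n"
  shows "frag_extend (f n) z - z \<in> ordered_boundaries K n"
proof -
  \<comment> \<open>The chain to be filled is a cycle by the homotopy relation one degree lower, so
    coning it off inverts the boundary; the apex \<open>hd s\<close> keeps the result over the
    vertices of \<open>s\<close>. In degree 0 nothing is to be filled, by
    \<open>augment\<close>.\<close>
  define D :: "nat \<Rightarrow> 'v list \<Rightarrow> ('v list \<Rightarrow>\<^sub>0 int)" where
    "D = rec_nat (\<lambda>s. 0) (\<lambda>n D s. ordered_cone (hd s)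
           (f (Suc n) s - frag_of s - frag_extend D (ordered_boundary n (frag_of s))))"
  have D_0: "D 0 s = 0" for s by (simp add: D_def)
  have D_Suc: "D (Suc n) s = ordered_cone (hd s) (f (Suc n) s - frag_of s - frag_extend (D n) (ordered_boundary n (frag_of s)))" for n s
    by (simp add: D_def)
  have keys_D: "Poly_Mapping.keys (D n s) \<subseteq> {t. length t = Suc (Suc n) \<and> set t \<subseteq> set s}" if "length s = Suc n" for n s
    using that
  proof (induction n arbitrary: s)
    case (Suc n)
    have "Poly_Mapping.keys (D n t) \<subseteq> {t. length t = Suc (Suc n) \<and> set t \<subseteq> set s}"
      if "t \<in> Poly_Mapping.keys (ordered_boundary n (frag_of s))" for t
      using Suc.IH[of t] keys_ordered_boundary[OF Suc.prems] that by auto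
    then have "Poly_Mapping.keys (frag_extend (D n) (ordered_boundary n (frag_of s))) \<subseteq> {t. length t = Suc (Suc n) \<and> set t \<subseteq> set s}"
      using keys_frag_extend[of "D n" "ordered_boundary n (frag_of s)"] by blast
    then have "Poly_Mapping.keys (f (Suc n) s - frag_of s - frag_extend (D n) (ordered_boundary n (frag_of s)))
        \<subseteq> {t. length t = Suc (Suc n) \<and> set t \<subseteq> set s}"
      using carried[OF Suc.prems] keys_diff[of "f (Suc n) s - frag_of s" "frag_extend (D n) (ordered_boundary n (frag_of s))"]
        keys_diff[of "f (Suc n) s" "frag_of s"] Suc.prems by auto
    then have "(#) (hd s) ` Poly_Mapping.keys (f (Suc n) s - frag_of s - frag_extend (D n) (ordered_boundary n (frag_of s)))
        \<subseteq> (#) (hd s) ` {t. length t = Suc (Suc n) \<and> set t \<subseteq> set s}"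
      by (rule image_mono)
    also have "\<dots> \<subseteq> {t. length t = Suc (Suc (Suc n)) \<and> set t \<subseteq> set s}"
    proof -
      have "hd s \<in> set s" using Suc.prems by (intro hd_in_set) auto
      then show ?thesis by auto
    qed
    finally show ?case
      unfolding D_Suc by (rule order_trans[OF keys_ordered_cone])
  qed (simp add: D_0)
  \<comment> \<open>\<open>L\<close> is the operator dD + Dd on chains, without the second term in
    degree 0.\<close>
  define L where "L = (\<lambda>n c. ordered_boundary n (frag_extend (D n) c) +
      (case n of 0 \<Rightarrow> 0 | Suc m \<Rightarrow> frag_extend (D m) (ordered_boundary m c)))"
  have L_diff: "L n (a - b) = L n a - L n b" and L_0: "L n 0 = 0" for n a b
    by (simp_all add: L_def frag_extend_diff ordered_boundary_diff split: nat.split)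
  have D: "ordered_boundary n (D n s) + (case n of 0 \<Rightarrow> 0 | Suc m \<Rightarrow> frag_extend (D m) (ordered_boundary m (frag_of s)))
      = f n s - frag_of s" if "length s = Suc n" for n s
    using that
  proof (induction n arbitrary: s)
    case 0
    then obtain v where "s = [v]" by (auto simp: length_Suc_conv)
    then show ?case by (simp add: D_0 augment)
  next
    case (Suc n)
    define b where "b = ordered_boundary n (frag_of s)"
    have b: "Poly_Mapping.keys b \<subseteq> {t. length t = Suc n}"
      using keys_ordered_boundary[OF Suc.prems] by (auto simp: b_def)
    then have "L n b = frag_extend (f n) b - b"
    proof (induction b rule: frag_induction)
      case (one t)
      then show ?case using Suc.IH[of t] by (simp add: L_def)
    qed (simp_all add: L_0 L_diff frag_extend_diff)
    moreover have "(case n of 0 \<Rightarrow> 0 | Suc m \<Rightarrow> frag_extend (D m) (ordered_boundary m b)) = 0"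
      using Suc.prems ordered_boundary_boundary[of "frag_of s"] by (simp add: b_def split: nat.split)
    ultimately have "ordered_boundary n (f (Suc n) s - frag_of s - frag_extend (D n) b) = 0"
      using chain[OF Suc.prems, folded b_def] by (simp add: L_def ordered_boundary_diff flip: b_def)
    then show ?case
      by (simp add: D_Suc ordered_boundary_cone flip: b_def)
  qed
  have "L n z = frag_extend (f n) z - z" if "Poly_Mapping.keys z \<subseteq> {t. length t = Suc n}" for z
    using that
  proof (induction z rule: frag_induction)
    case (one t)
    then show ?case using D[of t n] by (simp add: L_def)
  qed (simp_all add: L_0 L_diff frag_extend_diff)
  from this[of z] have "ordered_boundary n (frag_extend (D n) z) = frag_extend (f n) z - z"
    using z by (auto simp: L_def ordered_cycles_def ordered_simplices_def split: nat.splits)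
  moreover have "Poly_Mapping.keys (frag_extend (D n) z) \<subseteq> ordered_simplices K (Suc n)"
  proof -
    have "Poly_Mapping.keys (D n s) \<subseteq> ordered_simplices K (Suc n)" if "s \<in> Poly_Mapping.keys z" for s
    proof
      fix t assume t: "t \<in> Poly_Mapping.keys (D n s)"
      have s: "s \<in> ordered_simplices K n" using that z by (auto simp: ordered_cycles_def)
      then have "length s = Suc n" by (simp add: ordered_simplices_def)
      with t have "length t = Suc (Suc n)" "set t \<subseteq> set s" using keys_D[of s n] by auto
      then show "t \<in> ordered_simplices K (Suc n)" by (intro ordered_simplices_subset[OF K s])
    qed
    then show ?thesis using keys_frag_extend[of "D n" z] by blast
  qed
  ultimately show ?thesis unfolding ordered_boundaries_def by (metis (mono_tags, lifting) image_eqI mem_Collect_eq)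
qed

section \<open>Simplexwise homotopies of singular chains\<close>

lemma contractible_space_standard_simplex:
  "contractible_space (subtopology (powertop_real UNIV) (standard_simplex n))"
proof -
  let ?X = "subtopology (powertop_real UNIV) (standard_simplex n)"
  define a :: "nat \<Rightarrow> real" where "a = (\<lambda>i. if i = 0 then 1 else 0)"
  have a: "a \<in> standard_simplex n" by (simp add: a_def)
  define h where "h = (\<lambda>(t, x) i. (1 - t) * x i + t * a i)"
  have "continuous_map (prod_topology (top_of_set {0..1::real}) ?X) (powertop_real UNIV) h"
    unfolding continuous_map_componentwise_UNIV
  proof
    fix i
    have c1: "continuous_map (prod_topology (top_of_set {0..1::real}) ?X) euclideanreal (\<lambda>p. fst p)"
      using continuous_map_into_fulltopology[OF continuous_map_fst] .
    have "continuous_map ?X euclideanreal (\<lambda>x. x i)"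
      by (intro continuous_map_from_subtopology continuous_map_product_projection) simp
    from continuous_map_compose[OF continuous_map_snd this]
    have c2: "continuous_map (prod_topology (top_of_set {0..1::real}) ?X) euclideanreal (\<lambda>p. snd p i)"
      by (simp add: o_def)
    have "continuous_map (prod_topology (top_of_set {0..1::real}) ?X) euclideanreal
        (\<lambda>p. (1 - fst p) * snd p i + fst p * a i)"
      by (intro continuous_map_add continuous_map_real_mult continuous_map_diff c1 c2) simp_all
    then show "continuous_map (prod_topology (top_of_set {0..1::real}) ?X) euclideanreal (\<lambda>p. h p i)"
      by (simp add: h_def case_prod_unfold)
  qed
  then have "continuous_map (prod_topology (top_of_set {0..1::real}) ?X) ?X h"
    using convex_standard_simplex[OF _ a] by (auto simp: continuous_map_in_subtopology h_def)
  moreover have "h (0, x) = x" "h (1, x) = a" for x by (simp_all add: h_def)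
  ultimately have "homotopic_with (\<lambda>x. True) ?X ?X id (\<lambda>x. a)"
    unfolding homotopic_with_def by (intro exI[of _ h]) auto
  then show ?thesis unfolding contractible_space_def by blast
qed

text \<open>A contraction makes the cycle homologous to its image at a single point, where every
  cycle of positive degree bounds.\<close>

lemma contractible_space_cycle_boundary:
  assumes X: "contractible_space X" and c: "singular_relcycle p X {} c" and p: "1 \<le> p"
  shows "singular_relboundary p X {} c"
proof (cases "topspace X = {}")
  case True
  then show ?thesis using c by (simp add: singular_cycle singular_chain_empty)
next
  case False
  obtain a where a: "homotopic_with (\<lambda>x. True) X X id (\<lambda>x. a)"
    using X unfolding contractible_space_def by blast
  then have cont: "continuous_map X X (\<lambda>x. a)" using homotopic_with_imp_continuous_maps by blast
  then have aX: "a \<in> topspace X" using False by (auto simp: continuous_map_def)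
  have "homotopic_with (\<lambda>h. h \<in> {} \<rightarrow> {}) X X id (\<lambda>x. a)"
    using a by (rule homotopic_with_mono) auto
  from homotopic_imp_homologous_rel_chain_maps[OF this c]
  have hom: "homologous_rel p X {} c (chain_map p (\<lambda>x. a) c)"
    using c chain_map_ident[of p X c] by (simp add: singular_cycle)
  have cont': "continuous_map X (subtopology X {a}) (\<lambda>x. a)" using cont by (simp add: continuous_map_in_subtopology)
  have "singular_relcycle p (subtopology X {a}) {} (chain_map p (\<lambda>x. a) c)"
    using singular_relcycle_chain_map[OF c cont', of "{}"] by simp
  then have "singular_relboundary p (subtopology X {a}) {} (chain_map p (\<lambda>x. a) c)"
    using singular_boundary_eq_cycle_singleton[of "subtopology X {a}" a p] p aX by simp
  then have "singular_relboundary p X {} (chain_map p (\<lambda>x. a) c)"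
    using singular_boundary_mono[of "{a}" "topspace X" p X] aX by simp
  from singular_relboundary_add[OF _ this, of "c - chain_map p (\<lambda>x. a) c"] show ?thesis
    using hom by (simp add: homologous_rel_def)
qed

section \<open>Universal prisms over the standard simplices\<close>

definition simplex_cylinder :: "nat \<Rightarrow> ((nat \<Rightarrow> real) \<times> real) topology" where
  "simplex_cylinder n =
     prod_topology (subtopology (powertop_real UNIV) (standard_simplex n)) (top_of_set {0..1})"

definition cylinder_face :: "nat \<Rightarrow> (nat \<Rightarrow> real) \<times> real \<Rightarrow> (nat \<Rightarrow> real) \<times> real" where
  "cylinder_face k = (\<lambda>(x, t). (simplical_face k x, t))"

lemma topspace_simplex_cylinder: "topspace (simplex_cylinder n) = standard_simplex n \<times> {0..1}"
  by (simp add: simplex_cylinder_def)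

lemma continuous_map_simplical_face:
  assumes "k \<le> Suc n"
  shows "continuous_map (subtopology (powertop_real UNIV) (standard_simplex n))
    (subtopology (powertop_real UNIV) (standard_simplex (Suc n))) (simplical_face k)"
proof -
  have "continuous_map (powertop_real UNIV) euclideanreal (\<lambda>x. simplical_face k x i)" for i
    unfolding simplical_face_def by (auto intro: continuous_map_product_projection)
  then show ?thesis
    using simplical_face_in_standard_simplex[of "Suc n" k] assms
    by (auto simp: continuous_map_in_subtopology continuous_map_componentwise_UNIV continuous_map_from_subtopology)
qed

lemma continuous_map_cylinder_face:
  assumes "k \<le> Suc n"
  shows "continuous_map (simplex_cylinder n) (simplex_cylinder (Suc n)) (cylinder_face k)"
  unfolding simplex_cylinder_def cylinder_face_def continuous_map_pairwise
  using continuous_map_compose[OF continuous_map_fst continuous_map_simplical_face[OF assms]] continuous_map_snd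
  by (auto simp: o_def case_prod_unfold)

lemma chain_boundary_of_restrict:
  "chain_boundary (Suc n) (frag_of (restrict f (standard_simplex (Suc n))))
     = (\<Sum>k\<le>Suc n. frag_cmul ((-1) ^ k) (frag_of (\<lambda>x\<in>standard_simplex n. f (simplical_face k x))))"
  unfolding chain_boundary_of
  by (auto simp: singular_face_def simplical_face_in_standard_simplex simp del: sum.atMost_Suc intro!: sum.cong restrict_ext
       arg_cong2[where f = frag_cmul] arg_cong[where f = frag_of])

lemma frag_cmul_diff_distrib2: "frag_cmul c (a - b) = frag_cmul c a - frag_cmul c b"
  by (rule poly_mapping_eqI) (simp add: lookup_minus algebra_simps)

text \<open>The boundary that a chain \<open>p\<close> triangulating the cylinder over the \<open>n\<close>-simplex should have, if \<open>q\<close>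
  triangulates the cylinder over the \<open>(n - 1)\<close>-simplex.\<close>

definition prism_boundary :: "nat \<Rightarrow> ((nat \<Rightarrow> real) \<times> real) chain \<Rightarrow> ((nat \<Rightarrow> real) \<times> real) chain" where
  "prism_boundary n q =
     frag_of (\<lambda>x\<in>standard_simplex n. (x, 1)) - frag_of (\<lambda>x\<in>standard_simplex n. (x, 0)) -
     (if n = 0 then 0 else \<Sum>k\<le>n. frag_cmul ((-1) ^ k) (chain_map n (cylinder_face k) q))"

lemma chain_map_prism_boundary:
  "chain_map n g (prism_boundary n q) =
     frag_of (\<lambda>x\<in>standard_simplex n. g (x, 1)) - frag_of (\<lambda>x\<in>standard_simplex n. g (x, 0)) -
     (if n = 0 then 0 else \<Sum>k\<le>n. frag_cmul ((-1) ^ k) (chain_map n (g \<circ> cylinder_face k) q))"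
proof -
  have "simplex_map n g (\<lambda>x\<in>standard_simplex n. (x, t)) = (\<lambda>x\<in>standard_simplex n. g (x, t))" for t
    unfolding simplex_map_def by (rule restrict_ext) simp
  moreover have "chain_map n (g \<circ> f) q = chain_map n g (chain_map n f q)" for f :: "_ \<Rightarrow> (nat \<Rightarrow> real) \<times> real"
    by (simp add: chain_map_compose)
  ultimately show ?thesis
    by (simp add: prism_boundary_def chain_map_diff chain_map_sum comp_def[of "chain_map n g"])
qed

lemma singular_chain_prism_boundary:
  assumes "n > 0 \<Longrightarrow> singular_chain n (simplex_cylinder (n - 1)) q"
  shows "singular_chain n (simplex_cylinder n) (prism_boundary n q)"
proof -
  have "singular_simplex n (simplex_cylinder n) (\<lambda>x\<in>standard_simplex n. (x, t))" if "t \<in> {0..1}" for t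
    unfolding singular_simplex_def
  proof
    have "continuous_map (subtopology (powertop_real UNIV) (standard_simplex n)) (simplex_cylinder n) (\<lambda>x. (x, t))"
      unfolding simplex_cylinder_def continuous_map_pairwise using that by (simp add: o_def)
    then show "continuous_map (subtopology (powertop_real UNIV) (standard_simplex n)) (simplex_cylinder n) (\<lambda>x\<in>standard_simplex n. (x, t))"
      by (rule continuous_map_eq) simp
  qed simp
  moreover have "singular_chain n (simplex_cylinder n) (chain_map n (cylinder_face k) q)" if "n > 0" "k \<le> n" for k
    using singular_chain_chain_map[OF assms continuous_map_cylinder_face[of k "n - 1"]] that by simp
  ultimately show ?thesis
    unfolding prism_boundary_def
    by (auto intro!: singular_chain_diff singular_chain_sum singular_chain_cmul simp: singular_chain_of)
qed

text \<open>The tops and bottoms of the face prisms cancel against the boundaries of the top and the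
  bottom simplex. What survives is a double sum over faces of faces, which vanishes because the
  double boundary of the identity simplex does.\<close>

lemma prism_boundary_cycle:
  assumes p: "singular_chain (Suc n) (simplex_cylinder n) p" "chain_boundary (Suc n) p = prism_boundary n q"
    and q: "n > 0 \<Longrightarrow> singular_chain n (simplex_cylinder (n - 1)) q"
  shows "chain_boundary (Suc n) (prism_boundary (Suc n) p) = 0"
proof -
  define \<iota> where "\<iota> = frag_of (restrict id (standard_simplex (Suc n)))"
  have sing: "singular_chain (Suc n) (subtopology (powertop_real UNIV) (standard_simplex (Suc n))) \<iota>"
    by (simp add: \<iota>_def singular_chain_of singular_simplex_def continuous_map_in_subtopology)
  \<comment> \<open>\<open>T\<close> sends a singular simplex of the standard simplex to
    \<open>q\<close> transported along that simplex times the identity, so the double sum is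
    \<open>T\<close> of a double boundary.\<close>
  define T :: "(nat \<Rightarrow> real) chain \<Rightarrow> ((nat \<Rightarrow> real) \<times> real) chain" where
    "T = frag_extend (\<lambda>\<tau>. chain_map n (\<lambda>(x, t). (\<tau> x, t)) q)"
  have T: "(\<Sum>k\<le>Suc n. frag_cmul ((-1) ^ k) (if n = 0 then 0 else
       \<Sum>l\<le>n. frag_cmul ((-1) ^ l) (chain_map n (cylinder_face k \<circ> cylinder_face l) q))) = 0"
  proof (cases n)
    case (Suc m)
    have "chain_map n (\<lambda>(x, t). (singular_face n l (singular_face (Suc n) k (restrict id (standard_simplex (Suc n)))) x, t)) q
        = chain_map n (cylinder_face k \<circ> cylinder_face l) q" if "k \<le> Suc n" "l \<le> n" for k l
    proof (rule chain_map_eq[OF q])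
      fix p assume "p \<in> topspace (simplex_cylinder (n - 1))"
      then show "(\<lambda>(x, t). (singular_face n l (singular_face (Suc n) k (restrict id (standard_simplex (Suc n)))) x, t)) p
          = (cylinder_face k \<circ> cylinder_face l) p"
        using that Suc by (auto simp: topspace_simplex_cylinder singular_face_def cylinder_face_def
            simplical_face_in_standard_simplex)
    qed (simp add: Suc)
    then have "(\<Sum>k\<le>Suc n. \<Sum>l\<le>n. frag_cmul ((-1) ^ k) (frag_cmul ((-1) ^ l) (chain_map n (cylinder_face k \<circ> cylinder_face l) q)))
      = T (chain_boundary n (chain_boundary (Suc n) \<iota>))"
      using Suc by (simp add: T_def \<iota>_def chain_boundary_of chain_boundary_sum chain_boundary_cmul frag_extend_sum
          frag_extend_cmul frag_cmul_sum o_def del: sum.atMost_Suc frag_cmul_cmul id_apply)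
    also have "\<dots> = 0" using chain_boundary_boundary_alt[OF sing] by (simp add: T_def)
    finally show ?thesis using Suc by (simp add: frag_cmul_sum del: sum.atMost_Suc frag_cmul_cmul)
  qed simp
  have "chain_boundary (Suc n) (chain_map (Suc n) (cylinder_face k) p) =
      frag_of (\<lambda>x\<in>standard_simplex n. (simplical_face k x, 1)) - frag_of (\<lambda>x\<in>standard_simplex n. (simplical_face k x, 0)) -
      (if n = 0 then 0 else \<Sum>l\<le>n. frag_cmul ((-1) ^ l) (chain_map n (cylinder_face k \<circ> cylinder_face l) q))" for k
    using chain_boundary_chain_map[OF p(1), of "cylinder_face k"] p(2) chain_map_prism_boundary[of n "cylinder_face k" q]
    by (simp add: cylinder_face_def)
  then have "chain_boundary (Suc n) (prism_boundary (Suc n) p) =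
      (\<Sum>k\<le>Suc n. frag_cmul ((-1) ^ k) (if n = 0 then 0 else
       \<Sum>l\<le>n. frag_cmul ((-1) ^ l) (chain_map n (cylinder_face k \<circ> cylinder_face l) q)))"
    by (simp add: prism_boundary_def chain_boundary_diff chain_boundary_of_restrict chain_boundary_sum chain_boundary_cmul
        frag_cmul_diff_distrib2 sum_subtractf o_def del: sum.atMost_Suc)
  then show ?thesis using T by simp
qed

text \<open>Acyclic models: the prescribed boundary is a cycle in a contractible cylinder, so it
  bounds. At \<open>n = 0\<close> the truncated \<open>n - 1\<close> is harmless because
  \<open>prism_boundary 0\<close> ignores its chain.\<close>

lemma prism_exists:
  "\<exists>P. \<forall>n. singular_chain (Suc n) (simplex_cylinder n) (P n) \<and>
         chain_boundary (Suc n) (P n) = prism_boundary n (P (n - 1))"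
proof -
  \<comment> \<open>Each stage remembers the preceding prism \<open>q\<close> as well, because the
    next boundary is seen to be a cycle through the boundary relation between \<open>p\<close> and
    \<open>q\<close>.\<close>
  define A where "A = (\<lambda>n (q, p). singular_chain (Suc n) (simplex_cylinder n) p \<and>
      (n > 0 \<longrightarrow> singular_chain n (simplex_cylinder (n - 1)) q) \<and> chain_boundary (Suc n) p = prism_boundary n q)"
  have bound: "\<exists>p. singular_chain (Suc (Suc n)) (simplex_cylinder (Suc n)) p \<and>
      chain_boundary (Suc (Suc n)) p = prism_boundary (Suc n) q"
    if q: "singular_chain (Suc n) (simplex_cylinder n) q"
      "chain_boundary (Suc n) (prism_boundary (Suc n) q) = 0" for n q
  proof -
    have "contractible_space (simplex_cylinder (Suc n))"
      unfolding simplex_cylinder_def contractible_space_prod_topology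
      by (simp add: contractible_space_standard_simplex convex_imp_contractible)
    moreover have "singular_relcycle (Suc n) (simplex_cylinder (Suc n)) {} (prism_boundary (Suc n) q)"
      using singular_chain_prism_boundary[of "Suc n" q] q by (simp add: singular_cycle)
    ultimately have "singular_relboundary (Suc n) (simplex_cylinder (Suc n)) {} (prism_boundary (Suc n) q)"
      by (rule contractible_space_cycle_boundary) simp
    then show ?thesis by (auto simp: singular_boundary)
  qed
  have "\<exists>f. \<forall>n. A n (f n) \<and> fst (f (Suc n)) = snd (f n)"
  proof (rule dependent_nat_choice)
    \<comment> \<open>The prism over a point is the unit interval: the barycentric coordinate
      \<open>x 1\<close> of the 1-simplex is the time, so face 0 gives the top and face 1 the
      bottom, with the signs of \<open>prism_boundary\<close>.\<close>
    define p where "p = frag_of (\<lambda>x\<in>standard_simplex 1. ((\<lambda>i. if i = 0 then 1 else 0), x 1) :: (nat \<Rightarrow> real) \<times> real)"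
    have "singular_chain 1 (simplex_cylinder 0) p"
      unfolding p_def singular_chain_of singular_simplex_def
    proof
      have "continuous_map (subtopology (powertop_real UNIV) (standard_simplex 1)) (top_of_set {0..1}) (\<lambda>x. x 1)"
        unfolding continuous_map_in_subtopology
        by (auto intro: continuous_map_from_subtopology continuous_map_product_projection simp: standard_simplex_def)
      then have "continuous_map (subtopology (powertop_real UNIV) (standard_simplex 1)) (simplex_cylinder 0)
          (\<lambda>x. ((\<lambda>i. if i = 0 then 1 else 0), x 1))"
        unfolding simplex_cylinder_def continuous_map_pairwise by (simp add: o_def)
      then show "continuous_map (subtopology (powertop_real UNIV) (standard_simplex 1)) (simplex_cylinder 0)
          (\<lambda>x\<in>standard_simplex 1. ((\<lambda>i. if i = 0 then 1 else 0), x 1))"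
        by (rule continuous_map_eq) simp
    qed simp
    moreover have "chain_boundary 1 p = prism_boundary 0 0"
      using chain_boundary_of_restrict[of 0 "\<lambda>x. ((\<lambda>i. if i = 0 then 1 else 0), x 1) :: (nat \<Rightarrow> real) \<times> real"]
      by (simp add: p_def prism_boundary_def standard_simplex_0 simplical_face_def restrict_def cong: if_cong)
    ultimately have "A 0 (0, p)" by (simp add: A_def)
    then show "\<exists>x. A 0 x" by blast
  next
    fix x n assume "A n x"
    then obtain q p where x: "x = (q, p)" and p: "singular_chain (Suc n) (simplex_cylinder n) p"
      "n > 0 \<Longrightarrow> singular_chain n (simplex_cylinder (n - 1)) q" "chain_boundary (Suc n) p = prism_boundary n q"
      by (cases x) (auto simp: A_def)
    obtain p' where "singular_chain (Suc (Suc n)) (simplex_cylinder (Suc n)) p'"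
        "chain_boundary (Suc (Suc n)) p' = prism_boundary (Suc n) p"
      using bound[OF p(1) prism_boundary_cycle[OF p(1,3,2)]] by blast
    then have "A (Suc n) (p, p')" using p(1) by (simp add: A_def)
    then show "\<exists>y. A (Suc n) y \<and> fst y = snd x" using x by (metis fst_conv snd_conv)
  qed
  then obtain f where f: "\<And>n. A n (f n)" "\<And>n. fst (f (Suc n)) = snd (f n)" by blast
  define P where "P = (\<lambda>n. snd (f n))"
  show ?thesis
  proof (intro exI[of _ P] allI conjI)
    show "singular_chain (Suc n) (simplex_cylinder n) (P n)" for n
      using f(1)[of n] by (simp add: A_def P_def case_prod_unfold)
    show "chain_boundary (Suc n) (P n) = prism_boundary n (P (n - 1))" for n
      using f(1)[of n] f(2)[of "n - 1"] by (cases n) (simp_all add: A_def P_def case_prod_unfold prism_boundary_def)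
  qed
qed

text \<open>The maps \<open>G n \<sigma>\<close> need not come from a homotopy defined on
  \<open>X\<close>; agreement along faces is enough, since the images of the universal prisms under
  them then fit together to the chain homotopy \<open>E\<close>.\<close>

theorem simplexwise_homotopy_homologous:
  fixes X :: "'a topology" and G :: "nat \<Rightarrow> ((nat \<Rightarrow> real) \<Rightarrow> 'a) \<Rightarrow> (nat \<Rightarrow> real) \<times> real \<Rightarrow> 'a"
  assumes cont: "\<And>n \<sigma>. Q n \<sigma> \<Longrightarrow> continuous_map (simplex_cylinder n) X (G n \<sigma>)"
    and face: "\<And>n k \<sigma>. Q (Suc n) \<sigma> \<Longrightarrow> k \<le> Suc n \<Longrightarrow> Q n (singular_face (Suc n) k \<sigma>)"
    and compat: "\<And>n k \<sigma> x t. Q (Suc n) \<sigma> \<Longrightarrow> k \<le> Suc n \<Longrightarrow> x \<in> standard_simplex n \<Longrightarrow> t \<in> {0..1} \<Longrightarrow>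
        G n (singular_face (Suc n) k \<sigma>) (x, t) = G (Suc n) \<sigma> (simplical_face k x, t)"
    and c: "Poly_Mapping.keys c \<subseteq> Collect (Q n)" and cycle: "chain_boundary n c = 0"
  shows "homologous_rel n X {} (frag_extend (\<lambda>\<sigma>. frag_of (\<lambda>x\<in>standard_simplex n. G n \<sigma> (x, 1))) c)
           (frag_extend (\<lambda>\<sigma>. frag_of (\<lambda>x\<in>standard_simplex n. G n \<sigma> (x, 0))) c)"
proof -
  obtain P where "\<forall>n. singular_chain (Suc n) (simplex_cylinder n) (P n) \<and>
      chain_boundary (Suc n) (P n) = prism_boundary n (P (n - 1))"
    using prism_exists by (rule exE)
  then have P: "singular_chain (Suc n) (simplex_cylinder n) (P n)"
    "chain_boundary (Suc n) (P n) = prism_boundary n (P (n - 1))" for n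
    by simp_all
  define E where "E = (\<lambda>n. frag_extend (\<lambda>\<sigma>. chain_map (Suc n) (G n \<sigma>) (P n)))"
  have E: "chain_boundary (Suc n) (E n c) = frag_extend (\<lambda>\<sigma>. frag_of (\<lambda>x\<in>standard_simplex n. G n \<sigma> (x, 1))) c -
      frag_extend (\<lambda>\<sigma>. frag_of (\<lambda>x\<in>standard_simplex n. G n \<sigma> (x, 0))) c - E (n - 1) (chain_boundary n c)"
    using c
  proof (induction c rule: frag_induction)
    case (one \<sigma>)
    have "(if n = 0 then 0 else \<Sum>k\<le>n. frag_cmul ((-1) ^ k) (chain_map n (G n \<sigma> \<circ> cylinder_face k) (P (n - 1))))
        = E (n - 1) (chain_boundary n (frag_of \<sigma>))"
    proof (cases n)
      case (Suc m)
      have "chain_map n (G n \<sigma> \<circ> cylinder_face k) (P m) = chain_map n (G m (singular_face n k \<sigma>)) (P m)" if "k \<le> n" for k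
        unfolding Suc by (rule chain_map_eq[OF P(1)])
          (use one compat[of m \<sigma> k] that Suc in \<open>auto simp: topspace_simplex_cylinder cylinder_face_def\<close>)
      then show ?thesis
        using Suc by (simp add: E_def chain_boundary_of frag_extend_sum frag_extend_cmul o_def del: sum.atMost_Suc)
    qed (simp add: chain_boundary_def E_def)
    moreover have "chain_boundary (Suc n) (E n (frag_of \<sigma>)) = chain_map n (G n \<sigma>) (prism_boundary n (P (n - 1)))"
      using chain_boundary_chain_map[OF P(1), of n "G n \<sigma>"] P(2)[of n] by (simp add: E_def)
    ultimately show ?case by (simp only: frag_extend_of chain_map_prism_boundary)
  next
    case (diff a b)
    then show ?case by (simp add: E_def frag_extend_diff chain_boundary_diff)
  qed (simp add: E_def)
  have "singular_chain (Suc n) X (E n c)"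
    unfolding E_def by (rule singular_chain_extend) (use c cont singular_chain_chain_map[OF P(1)] in blast)
  moreover have "E (n - 1) (chain_boundary n c) = 0" using cycle by (simp add: E_def)
  ultimately show ?thesis
    using E unfolding homologous_rel_def singular_boundary by (intro exI[of _ "E n c"]) simp
qed

section \<open>Simplicial and singular homology\<close>

text \<open>A vertex repeated in \<open>s\<close> collects the coordinates of all its positions, so
  degenerate ordered simplices have a realization as well. The restriction gives the extensional
  form required of singular simplices.\<close>

definition affine_simplex :: "nat \<Rightarrow> 'v list \<Rightarrow> (nat \<Rightarrow> real) \<Rightarrow> 'v \<Rightarrow> real" where
  "affine_simplex n s = (\<lambda>x\<in>standard_simplex n. \<lambda>u. \<Sum>j\<le>n. if s ! j = u then x j else 0)"

text \<open>Ties are broken by a choice that depends on the point alone, so simplices sharing a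
  corner assign it the same vertex and \<open>vertex_list\<close> is compatible with faces.\<close>

definition dominant_vertex :: "('v \<Rightarrow> real) \<Rightarrow> 'v" where
  "dominant_vertex y = (SOME u. \<forall>w. y w \<le> y u)"

definition vertex_list :: "nat \<Rightarrow> ((nat \<Rightarrow> real) \<Rightarrow> 'v \<Rightarrow> real) \<Rightarrow> 'v list" where
  "vertex_list n \<sigma> = map (\<lambda>j. dominant_vertex (\<sigma> (\<lambda>i. if i = j then 1 else 0))) [0..<Suc n]"

lemma length_vertex_list [simp]: "length (vertex_list n \<sigma>) = Suc n"
  by (simp add: vertex_list_def)

lemma simplical_face_vertex:
  "simplical_face k (\<lambda>i. if i = j then 1 else 0) = (\<lambda>i. if i = (if j < k then j else Suc j) then 1 else (0::real))"
  by (auto simp: simplical_face_def fun_eq_iff)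

lemma nth_delete:
  "k < length s \<Longrightarrow> j < length s - 1 \<Longrightarrow> (take k s @ drop (Suc k) s) ! j = s ! (if j < k then j else Suc j)"
  by (auto simp: nth_append)

lemma vertex_list_face:
  assumes "k \<le> Suc n"
  shows "vertex_list n (singular_face (Suc n) k \<sigma>) = take k (vertex_list (Suc n) \<sigma>) @ drop (Suc k) (vertex_list (Suc n) \<sigma>)"
proof (rule nth_equalityI)
  show "length (vertex_list n (singular_face (Suc n) k \<sigma>))
      = length (take k (vertex_list (Suc n) \<sigma>) @ drop (Suc k) (vertex_list (Suc n) \<sigma>))"
    using assms by simp
  fix j assume "j < length (vertex_list n (singular_face (Suc n) k \<sigma>))"
  then have j: "j \<le> n" by simp
  have nth: "vertex_list m \<tau> ! i = dominant_vertex (\<tau> (\<lambda>l. if l = i then 1 else 0))" if "i \<le> m" for m i and \<tau> :: "(nat \<Rightarrow> real) \<Rightarrow> 'a \<Rightarrow> real"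
    unfolding vertex_list_def using that by (subst nth_map) (auto simp del: upt_Suc)
  have "singular_face (Suc n) k \<sigma> (\<lambda>l. if l = j then 1 else 0) = \<sigma> (simplical_face k (\<lambda>l. if l = j then 1 else 0))"
    using j by (simp add: singular_face_def)
  then show "vertex_list n (singular_face (Suc n) k \<sigma>) ! j
      = (take k (vertex_list (Suc n) \<sigma>) @ drop (Suc k) (vertex_list (Suc n) \<sigma>)) ! j"
    using assms j by (subst nth_delete) (auto simp: nth simplical_face_vertex)
qed

lemma sum_simplical_face:
  fixes x :: "nat \<Rightarrow> real"
  assumes "k \<le> Suc n"
  shows "(\<Sum>j\<le>Suc n. if s ! j = u then simplical_face k x j else 0)
       = (\<Sum>j\<le>n. if s ! (if j < k then j else Suc j) = u then x j else 0)"
proof -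
  let ?f = "\<lambda>j. if j < k then j else Suc j"
  have "bij_betw ?f {..n} ({..Suc n} - {k})"
    by (rule bij_betwI[where g = "\<lambda>j. if j < k then j else j - 1"]) (use assms in \<open>auto split: if_splits\<close>)
  then have "(\<Sum>j\<le>n. if s ! ?f j = u then simplical_face k x (?f j) else 0)
      = (\<Sum>j\<in>{..Suc n} - {k}. if s ! j = u then simplical_face k x j else 0)"
    by (rule sum.reindex_bij_betw)
  moreover have "simplical_face k x (?f j) = x j" for j
    by (simp add: simplical_face_def)
  moreover have "(\<Sum>j\<in>{..Suc n} - {k}. if s ! j = u then simplical_face k x j else 0)
      = (\<Sum>j\<le>Suc n. if s ! j = u then simplical_face k x j else 0)"
    by (rule sum.mono_neutral_left) (auto simp: simplical_face_def)
  ultimately show ?thesis by (simp only:)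
qed

lemma singular_face_affine_simplex:
  assumes "length s = Suc (Suc n)" "k \<le> Suc n"
  shows "singular_face (Suc n) k (affine_simplex (Suc n) s) = affine_simplex n (take k s @ drop (Suc k) s)"
proof
  fix x
  show "singular_face (Suc n) k (affine_simplex (Suc n) s) x = affine_simplex n (take k s @ drop (Suc k) s) x"
  proof (cases "x \<in> standard_simplex n")
    case True
    have "(\<Sum>j\<le>n. if (take k s @ drop (Suc k) s) ! j = u then x j else 0)
        = (\<Sum>j\<le>n. if s ! (if j < k then j else Suc j) = u then x j else 0)" for u
      by (rule sum.cong) (use assms in \<open>auto simp: nth_delete\<close>)
    then show ?thesis
      using True assms simplical_face_in_standard_simplex[of "Suc n" k x]
      by (simp add: singular_face_def affine_simplex_def sum_simplical_face del: sum.atMost_Suc)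
  qed (simp add: singular_face_def affine_simplex_def)
qed

definition affine_chain :: "nat \<Rightarrow> ('v list \<Rightarrow>\<^sub>0 int) \<Rightarrow> ('v \<Rightarrow> real) chain" where
  "affine_chain n = frag_extend (\<lambda>s. frag_of (affine_simplex n s))"

definition vertex_chain :: "nat \<Rightarrow> ('v \<Rightarrow> real) chain \<Rightarrow> ('v list \<Rightarrow>\<^sub>0 int)" where
  "vertex_chain n = frag_extend (\<lambda>\<sigma>. frag_of (vertex_list n \<sigma>))"

lemma affine_chain_simps [simp]:
  "affine_chain n 0 = 0" "affine_chain n (a - b) = affine_chain n a - affine_chain n b"
  "affine_chain n (a + b) = affine_chain n a + affine_chain n b"
  "affine_chain n (frag_of s) = frag_of (affine_simplex n s)"
  by (simp_all add: affine_chain_def frag_extend_diff frag_extend_add)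

lemma vertex_chain_simps [simp]:
  "vertex_chain n 0 = 0" "vertex_chain n (a - b) = vertex_chain n a - vertex_chain n b"
  "vertex_chain n (frag_of \<sigma>) = frag_of (vertex_list n \<sigma>)"
  by (simp_all add: vertex_chain_def frag_extend_diff)

lemma keys_vertex_chain: "Poly_Mapping.keys (vertex_chain n c) \<subseteq> vertex_list n ` Poly_Mapping.keys c"
  unfolding vertex_chain_def using keys_frag_extend[of "\<lambda>\<sigma>. frag_of (vertex_list n \<sigma>)" c] by auto

lemma chain_boundary_affine_chain:
  assumes "Poly_Mapping.keys c \<subseteq> {s. length s = Suc (Suc n)}"
  shows "chain_boundary (Suc n) (affine_chain (Suc n) c) = affine_chain n (ordered_boundary n c)"
  using assms
proof (induction c rule: frag_induction)
  case (one s)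
  then have "singular_face (Suc n) k (affine_simplex (Suc n) s) = affine_simplex n (take k s @ drop (Suc k) s)"
    if "k \<le> Suc n" for k
    using that singular_face_affine_simplex by blast
  then show ?case
    by (simp add: chain_boundary_of ordered_boundary_of affine_chain_def frag_extend_sum frag_extend_cmul o_def
        del: sum.atMost_Suc)
qed (simp_all add: chain_boundary_diff ordered_boundary_diff)

lemma ordered_boundary_vertex_chain:
  "ordered_boundary n (vertex_chain (Suc n) c) = vertex_chain n (chain_boundary (Suc n) c)"
  using subset_UNIV
proof (induction c rule: frag_induction)
  case (one \<sigma>)
  show ?case
    by (simp add: chain_boundary_of ordered_boundary_of vertex_chain_def frag_extend_sum frag_extend_cmul o_def
        vertex_list_face del: sum.atMost_Suc)
qed (simp_all add: chain_boundary_diff ordered_boundary_diff)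

lemma affine_simplex_in_realization:
  assumes "x \<in> standard_simplex n" "length s = Suc n"
  shows "affine_simplex n s x \<in> realization_simplex (set s)"
proof -
  have s: "set s = (\<lambda>j. s ! j) ` {..n}" using assms(2) by (auto simp: set_conv_nth less_Suc_eq_le image_def)
  have "(\<Sum>u\<in>set s. \<Sum>j\<le>n. if s ! j = u then x j else 0) = (\<Sum>j\<le>n. \<Sum>u\<in>set s. if s ! j = u then x j else 0)"
    by (rule sum.swap)
  also have "\<dots> = (\<Sum>j\<le>n. x j)"
    by (rule sum.cong) (use s in auto)
  also have "\<dots> = 1" using assms(1) by (simp add: standard_simplex_def)
  finally show ?thesis
    using assms s by (auto simp: affine_simplex_def realization_simplex_def standard_simplex_def intro!: sum_nonneg sum.neutral)
qed

lemma continuous_map_affine_simplex: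
  "continuous_map (subtopology (powertop_real UNIV) (standard_simplex n)) (powertop_real UNIV) (affine_simplex n s)"
proof (rule continuous_map_eq)
  show "continuous_map (subtopology (powertop_real UNIV) (standard_simplex n)) (powertop_real UNIV)
      (\<lambda>x u. \<Sum>j\<le>n. if s ! j = u then x j else 0)"
    unfolding continuous_map_componentwise_UNIV
  proof
    fix u
    show "continuous_map (subtopology (powertop_real UNIV) (standard_simplex n)) euclideanreal
        (\<lambda>x. \<Sum>j\<le>n. if s ! j = u then x j else 0)"
    proof (rule continuous_map_sum)
      fix j
      show "continuous_map (subtopology (powertop_real UNIV) (standard_simplex n)) euclideanreal
          (\<lambda>x. if s ! j = u then x j else 0)"
        by (cases "s ! j = u") (auto intro: continuous_map_from_subtopology continuous_map_product_projection)
    qed simp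
  qed
qed (simp add: affine_simplex_def)

lemma singular_simplex_affine_simplex:
  assumes "length s = Suc n"
  shows "singular_simplex n (subtopology (powertop_real UNIV) (realization_simplex (set s))) (affine_simplex n s)"
  unfolding singular_simplex_def
  using continuous_map_affine_simplex[of n s] affine_simplex_in_realization[of _ n s] assms
  by (auto simp: continuous_map_in_subtopology) (simp add: affine_simplex_def)

lemma continuous_map_realization_simplex:
  assumes "\<sigma> \<in> K"
  shows "continuous_map (subtopology (powertop_real UNIV) (realization_simplex \<sigma>)) (geometric_realization K) (\<lambda>x. x)"
  unfolding continuous_map_def
proof (intro conjI allI impI)
  show "(\<lambda>x. x) \<in> topspace (subtopology (powertop_real UNIV) (realization_simplex \<sigma>)) \<rightarrow> topspace (geometric_realization K)"
    using assms by (auto simp: topspace_geometric_realization)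
  fix U assume "openin (geometric_realization K) U"
  then have "openin (subtopology (powertop_real UNIV) (realization_simplex \<sigma>)) (U \<inter> realization_simplex \<sigma>)"
    using assms by (simp add: openin_geometric_realization realization_open_def)
  moreover have "U \<inter> realization_simplex \<sigma> = {x \<in> topspace (subtopology (powertop_real UNIV) (realization_simplex \<sigma>)). x \<in> U}"
    by auto
  ultimately show "openin (subtopology (powertop_real UNIV) (realization_simplex \<sigma>))
      {x \<in> topspace (subtopology (powertop_real UNIV) (realization_simplex \<sigma>)). x \<in> U}" by simp
qed

lemma singular_chain_affine_chain:
  assumes "Poly_Mapping.keys c \<subseteq> ordered_simplices K n"
  shows "singular_chain n (geometric_realization K) (affine_chain n c)"
  unfolding affine_chain_def
proof (rule singular_chain_extend)
  fix s assume "s \<in> Poly_Mapping.keys c"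
  then have s: "length s = Suc n" "set s \<in> K" using assms by (auto simp: ordered_simplices_def)
  have "singular_simplex n (geometric_realization K) (simplex_map n (\<lambda>x. x) (affine_simplex n s))"
    using singular_simplex_simplex_map[OF singular_simplex_affine_simplex[OF s(1)] continuous_map_realization_simplex[OF s(2)]] .
  moreover have "simplex_map n (\<lambda>x. x) (affine_simplex n s) = affine_simplex n s"
    by (auto simp: simplex_map_def affine_simplex_def restrict_def)
  ultimately show "singular_chain n (geometric_realization K) (frag_of (affine_simplex n s))"
    by (simp add: singular_chain_of)
qed

section \<open>Barycentric stars and small singular simplices\<close>

lemma dominant_vertex:
  assumes y: "y \<in> realization_simplex \<sigma>" and fin: "finite \<sigma>"
  shows "y w \<le> y (dominant_vertex y)" "dominant_vertex y \<in> \<sigma>" "0 < y (dominant_vertex y)"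
proof -
  have y0: "\<And>v. 0 \<le> y v" "\<And>v. v \<notin> \<sigma> \<Longrightarrow> y v = 0" "(\<Sum>v\<in>\<sigma>. y v) = 1"
    using y by (auto simp: realization_simplex_def)
  have ne: "y ` \<sigma> \<noteq> {}" using y0(3) by auto
  obtain u where u: "u \<in> \<sigma>" "y u = Max (y ` \<sigma>)"
    using Max_in[OF finite_imageI[OF fin] ne] by auto
  have "y w \<le> y u" for w
    using y0(1)[of u] y0(2)[of w] Max_ge[OF finite_imageI[OF fin], of "y w" y] u(2) by (cases "w \<in> \<sigma>") auto
  then have "\<exists>u. \<forall>w. y w \<le> y u" by blast
  from someI_ex[OF this] have max: "y w \<le> y (dominant_vertex y)" for w
    unfolding dominant_vertex_def by blast
  then show "y w \<le> y (dominant_vertex y)" .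
  show pos: "0 < y (dominant_vertex y)"
  proof (rule ccontr)
    assume "\<not> 0 < y (dominant_vertex y)"
    then have "y w = 0" for w using max[of w] y0(1)[of w] by linarith
    then show False using y0(3) by simp
  qed
  show "dominant_vertex y \<in> \<sigma>"
  proof (rule ccontr)
    assume "dominant_vertex y \<notin> \<sigma>"
    from y0(2)[OF this] pos show False by simp
  qed
qed

text \<open>The open star, in the barycentric subdivision, of the barycentre of \<open>\<rho>\<close>.\<close>

definition barycentric_star :: "'v set set \<Rightarrow> 'v set \<Rightarrow> ('v \<Rightarrow> real) set" where
  "barycentric_star K \<rho> =
     {y \<in> topspace (geometric_realization K). (\<forall>u\<in>\<rho>. 0 < y u) \<and> (\<forall>u\<in>\<rho>. \<forall>w. w \<notin> \<rho> \<longrightarrow> y w < y u)}"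

lemma dominant_vertex_in_star:
  assumes K: "abstract_simplicial_complex K" and \<rho>: "\<rho> \<noteq> {}" and y: "y \<in> barycentric_star K \<rho>"
  shows "dominant_vertex y \<in> \<rho>"
proof (rule ccontr)
  assume "dominant_vertex y \<notin> \<rho>"
  moreover obtain u where "u \<in> \<rho>" using \<rho> by blast
  ultimately have "y (dominant_vertex y) < y u" using y by (simp add: barycentric_star_def)
  moreover obtain \<sigma> where "\<sigma> \<in> K" "y \<in> realization_simplex \<sigma>"
    using y by (auto simp: barycentric_star_def topspace_geometric_realization)
  then have "y u \<le> y (dominant_vertex y)"
    using dominant_vertex(1)[of y \<sigma> u] K by (auto simp: abstract_simplicial_complex_def)
  ultimately show False by simp
qed

text \<open>In the weak topology one simplex is inspected at a time; on it the coordinates outside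
  vanish, so the condition on all \<open>w\<close> outside \<open>\<rho>\<close> reduces to finitely
  many strict inequalities.\<close>

lemma openin_barycentric_star:
  assumes K: "abstract_simplicial_complex K" and \<rho>: "finite \<rho>"
  shows "openin (geometric_realization K) (barycentric_star K \<rho>)"
  unfolding openin_geometric_realization realization_open_def
proof (intro conjI ballI)
  show "barycentric_star K \<rho> \<subseteq> (\<Union>\<sigma>\<in>K. realization_simplex \<sigma>)"
    by (auto simp: barycentric_star_def topspace_geometric_realization)
  fix \<sigma> assume \<sigma>: "\<sigma> \<in> K"
  then have fin: "finite \<sigma>" using K by (auto simp: abstract_simplicial_complex_def)
  let ?X = "subtopology (powertop_real UNIV) (realization_simplex \<sigma>)"
  have proj: "continuous_map ?X euclideanreal (\<lambda>y. y u)" for u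
    by (auto intro: continuous_map_from_subtopology continuous_map_product_projection)
  have A: "openin ?X {y \<in> topspace ?X. y u \<in> {0<..}}" for u
    by (rule openin_continuous_map_preimage[OF proj]) simp
  have B: "openin ?X {y \<in> topspace ?X. y u - y w \<in> {0<..}}" for u w
    by (rule openin_continuous_map_preimage[OF continuous_map_diff[OF proj proj]]) simp
  have "openin ?X (((\<Inter>u\<in>\<rho>. {y \<in> topspace ?X. y u \<in> {0<..}}) \<inter> topspace ?X) \<inter>
      ((\<Inter>(u, w)\<in>\<rho> \<times> (\<sigma> - \<rho>). {y \<in> topspace ?X. y u - y w \<in> {0<..}}) \<inter> topspace ?X))"
    by (intro openin_Int openin_INT) (use \<rho> fin A B in auto)
  moreover have "barycentric_star K \<rho> \<inter> realization_simplex \<sigma>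
      = ((\<Inter>u\<in>\<rho>. {y \<in> topspace ?X. y u \<in> {0<..}}) \<inter> topspace ?X) \<inter>
        ((\<Inter>(u, w)\<in>\<rho> \<times> (\<sigma> - \<rho>). {y \<in> topspace ?X. y u - y w \<in> {0<..}}) \<inter> topspace ?X)" (is "?L = ?R")
  proof
    show "?L \<subseteq> ?R" by (auto simp: barycentric_star_def)
    show "?R \<subseteq> ?L"
    proof
      fix y assume y: "y \<in> ?R"
      then have y\<sigma>: "y \<in> realization_simplex \<sigma>" and pos: "\<And>u. u \<in> \<rho> \<Longrightarrow> 0 < y u"
        and less: "\<And>u w. u \<in> \<rho> \<Longrightarrow> w \<in> \<sigma> \<Longrightarrow> w \<notin> \<rho> \<Longrightarrow> y w < y u" by auto
      have "y w < y u" if "u \<in> \<rho>" "w \<notin> \<rho>" for u w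
        using that pos[of u] less[of u w] y\<sigma> by (cases "w \<in> \<sigma>") (auto simp: realization_simplex_def)
      then show "y \<in> ?L" using y\<sigma> pos \<sigma> by (auto simp: barycentric_star_def topspace_geometric_realization)
    qed
  qed
  ultimately show "openin ?X (barycentric_star K \<rho> \<inter> realization_simplex \<sigma>)" by simp
qed

lemma barycentric_star_cover:
  assumes K: "abstract_simplicial_complex K"
  shows "topspace (geometric_realization K) \<subseteq> \<Union>(barycentric_star K ` K)"
proof
  fix y assume y: "y \<in> topspace (geometric_realization K)"
  then obtain \<sigma> where \<sigma>: "\<sigma> \<in> K" "y \<in> realization_simplex \<sigma>" by (auto simp: topspace_geometric_realization)
  then have fin: "finite \<sigma>" using K by (auto simp: abstract_simplicial_complex_def)
  note dom = dominant_vertex[OF \<sigma>(2) fin]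
  \<comment> \<open>A point belongs to the star of the simplex spanned by all vertices at which its
    coordinates are maximal.\<close>
  define \<rho> where "\<rho> = {u. y u = y (dominant_vertex y)}"
  have "\<rho> \<subseteq> \<sigma>" using \<sigma>(2) dom(3) by (force simp: \<rho>_def realization_simplex_def)
  moreover have "\<rho> \<noteq> {}" by (auto simp: \<rho>_def)
  ultimately have "\<rho> \<in> K" using K \<sigma>(1) unfolding abstract_simplicial_complex_def by blast
  moreover have "y \<in> barycentric_star K \<rho>"
    using y dom(1,3) by (auto simp: barycentric_star_def \<rho>_def le_less)
  ultimately show "y \<in> \<Union>(barycentric_star K ` K)" by blast
qed

lemma singular_chain_iterated_subdivision:
  "singular_chain n X c \<Longrightarrow> singular_chain n X ((singular_subdivision n ^^ m) c)"
  by (induction m) (auto intro: singular_chain_singular_subdivision)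

lemma chain_boundary_iterated_subdivision:
  assumes "singular_chain (Suc n) X c"
  shows "chain_boundary (Suc n) ((singular_subdivision (Suc n) ^^ m) c) = (singular_subdivision n ^^ m) (chain_boundary (Suc n) c)"
proof (induction m)
  case (Suc m)
  then show ?case
    using chain_boundary_singular_subdivision[OF singular_chain_iterated_subdivision[OF assms], of m] by simp
qed simp

text \<open>The corners of a simplex inside one star all have their dominant vertices in
  \<open>\<rho>\<close>, so these span a face of \<open>\<rho>\<close>. This is the reason for
  subdividing until simplices are small.\<close>

lemma vertex_list_small:
  assumes K: "abstract_simplicial_complex K" and \<rho>: "\<rho> \<in> K" and \<sigma>: "\<sigma> \<in> standard_simplex n \<rightarrow> barycentric_star K \<rho>"
  shows "vertex_list n \<sigma> \<in> ordered_simplices K n" "set (vertex_list n \<sigma>) \<subseteq> \<rho>"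
proof -
  have "\<rho> \<noteq> {}" using K \<rho> by (auto simp: abstract_simplicial_complex_def)
  then have "dominant_vertex (\<sigma> (\<lambda>i. if i = j then 1 else 0)) \<in> \<rho>" if "j \<le> n" for j
    using that \<sigma> by (intro dominant_vertex_in_star[OF K]) auto
  then show sub: "set (vertex_list n \<sigma>) \<subseteq> \<rho>" by (auto simp: vertex_list_def)
  have "set (vertex_list n \<sigma>) \<noteq> {}" by (auto simp: vertex_list_def)
  then have "set (vertex_list n \<sigma>) \<in> K"
    using K \<rho> sub unfolding abstract_simplicial_complex_def by blast
  then show "vertex_list n \<sigma> \<in> ordered_simplices K n" by (simp add: ordered_simplices_def)
qed

text \<open>The dominant vertices of the subdivided affine simplex on \<open>s\<close> all belong to \<open>s\<close>, so that
  subdivision followed by \<open>vertex_chain\<close> is carried by the full simplices.\<close>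

lemma vertex_chain_subdivision_affine_chain:
  assumes K: "abstract_simplicial_complex K" and z: "z \<in> ordered_cycles K n"
  shows "vertex_chain n ((singular_subdivision n ^^ m) (affine_chain n z)) - z \<in> ordered_boundaries K n"
proof -
  define f :: "nat \<Rightarrow> 'a list \<Rightarrow> ('a list \<Rightarrow>\<^sub>0 int)" where
    "f = (\<lambda>n s. vertex_chain n ((singular_subdivision n ^^ m) (frag_of (affine_simplex n s))))"
  have extend: "frag_extend (f n) c = vertex_chain n ((singular_subdivision n ^^ m) (affine_chain n c))" for n c
    using subset_UNIV
    by (induction c rule: frag_induction) (simp_all add: f_def frag_extend_diff singular_subdivision_power_diff)
  let ?X = "\<lambda>s. subtopology (powertop_real UNIV) (realization_simplex (set s))"
  have sing: "singular_chain n (?X s) (frag_of (affine_simplex n s))" if "length s = Suc n" for n and s :: "'a list"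
    using singular_simplex_affine_simplex[OF that] by (simp add: singular_chain_of)
  have "frag_extend (f n) z - z \<in> ordered_boundaries K n"
  proof (rule acyclic_carrier_homotopy[OF _ _ _ K z])
    fix n and s :: "'a list" assume s: "length s = Suc (Suc n)"
    have "ordered_boundary n (f (Suc n) s)
        = vertex_chain n ((singular_subdivision n ^^ m) (chain_boundary (Suc n) (frag_of (affine_simplex (Suc n) s))))"
      using chain_boundary_iterated_subdivision[OF sing[OF s], of m] by (simp add: f_def ordered_boundary_vertex_chain)
    also have "chain_boundary (Suc n) (frag_of (affine_simplex (Suc n) s)) = affine_chain n (ordered_boundary n (frag_of s))"
      using chain_boundary_affine_chain[of "frag_of s" n] s by simp
    finally show "frag_extend (f n) (ordered_boundary n (frag_of s)) = ordered_boundary n (f (Suc n) s)"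
      by (simp add: extend)
  next
    fix n and s :: "'a list" assume s: "length s = Suc n"
    have "set (vertex_list n \<sigma>) \<subseteq> set s"
      if \<sigma>: "\<sigma> \<in> Poly_Mapping.keys ((singular_subdivision n ^^ m) (frag_of (affine_simplex n s)))" for \<sigma>
    proof -
      have "singular_simplex n (?X s) \<sigma>"
        using singular_chain_iterated_subdivision[OF sing[OF s], of m] \<sigma> by (auto simp: singular_chain_def)
      then have "\<sigma> x \<in> realization_simplex (set s)" if "x \<in> standard_simplex n" for x
        using that by (auto simp: singular_simplex_subtopology)
      then have "dominant_vertex (\<sigma> (\<lambda>i. if i = j then 1 else 0)) \<in> set s" if "j \<le> n" for j
        using that by (intro dominant_vertex(2)) auto
      then show ?thesis by (auto simp: vertex_list_def)
    qed
    then show "Poly_Mapping.keys (f n s) \<subseteq> {t. length t = Suc n \<and> set t \<subseteq> set s}"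
      using keys_vertex_chain[of n "(singular_subdivision n ^^ m) (frag_of (affine_simplex n s))"]
      unfolding f_def by (force simp del: keys_frag_of)
  next
    fix v :: 'a
    have "(singular_subdivision 0 ^^ m) (frag_of (affine_simplex 0 [v])) = frag_of (affine_simplex 0 [v])"
      by (induction m) (simp_all add: singular_subdivision_zero[OF sing[of "[v]" 0, simplified]])
    moreover have "dominant_vertex (affine_simplex 0 [v] (\<lambda>i. if i = 0 then 1 else 0)) \<in> {v}"
      using affine_simplex_in_realization[of "\<lambda>i. if i = 0 then 1 else 0" 0 "[v]"] by (intro dominant_vertex(2)) auto
    ultimately show "f 0 [v] = frag_of [v]"
      by (simp add: f_def vertex_list_def)
  qed
  then show ?thesis by (simp add: extend)
qed

text \<open>Injectivity on homology: a singular chain filling the affine chain is subdivided until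
  \<open>vertex_chain\<close> takes it to ordered chains of \<open>K\<close>. There it fills the
  vertex chain of the subdivided affine chain, which differs from \<open>z\<close> by a
  boundary.\<close>

lemma affine_chain_boundary_imp:
  assumes K: "abstract_simplicial_complex K" and z: "z \<in> ordered_cycles K n"
    and bd: "singular_relboundary n (geometric_realization K) {} (affine_chain n z)"
  shows "z \<in> ordered_boundaries K n"
proof -
  obtain e where e: "singular_chain (Suc n) (geometric_realization K) e" "chain_boundary (Suc n) e = affine_chain n z"
    using bd by (auto simp: singular_boundary)
  have "\<And>U. U \<in> barycentric_star K ` K \<Longrightarrow> openin (geometric_realization K) U"
    using openin_barycentric_star[OF K] K by (auto simp: abstract_simplicial_complex_def)
  from sufficient_iterated_singular_subdivision_exists[OF this barycentric_star_cover[OF K] e(1)]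
  obtain m where m: "\<And>f. f \<in> Poly_Mapping.keys ((singular_subdivision (Suc n) ^^ m) e) \<Longrightarrow>
      \<exists>V\<in>barycentric_star K ` K. f \<in> standard_simplex (Suc n) \<rightarrow> V"
    by (metis order_refl)
  let ?e = "vertex_chain (Suc n) ((singular_subdivision (Suc n) ^^ m) e)"
  have "Poly_Mapping.keys ?e \<subseteq> ordered_simplices K (Suc n)"
    using keys_vertex_chain[of "Suc n" "(singular_subdivision (Suc n) ^^ m) e"] m vertex_list_small(1)[OF K] by blast
  moreover have "ordered_boundary n ?e = vertex_chain n ((singular_subdivision n ^^ m) (affine_chain n z))"
    using chain_boundary_iterated_subdivision[OF e(1), of m] e(2) by (simp add: ordered_boundary_vertex_chain)
  moreover obtain c where c: "Poly_Mapping.keys c \<subseteq> ordered_simplices K (Suc n)"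
      "ordered_boundary n c = vertex_chain n ((singular_subdivision n ^^ m) (affine_chain n z)) - z"
    using vertex_chain_subdivision_affine_chain[OF K z, of m] by (auto simp: ordered_boundaries_def)
  ultimately have "z = ordered_boundary n (?e - c)" "Poly_Mapping.keys (?e - c) \<subseteq> ordered_simplices K (Suc n)"
    using keys_diff[of ?e c] by (auto simp: ordered_boundary_diff)
  then show ?thesis by (auto simp: ordered_boundaries_def)
qed

text \<open>A point has a positive coordinate at some vertex \<open>v\<close>, and where this
  coordinate is positive only the finitely many simplices through \<open>v\<close> matter. Removing
  from this product-open set the parts of those simplices outside \<open>U\<close>, which are
  closed, leaves a product-open neighbourhood whose trace on |K| lies in \<open>U\<close>.\<close>

lemma geometric_realization_locally_finite:
  assumes K: "abstract_simplicial_complex K" and lf: "locally_finite_complex K"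
  shows "geometric_realization K = subtopology (powertop_real UNIV) (topspace (geometric_realization K))"
proof (rule topology_eq[THEN iffD2], rule allI)
  let ?K = "\<Union>\<sigma>\<in>K. realization_simplex \<sigma>"
  let ?T = "powertop_real UNIV :: ('a \<Rightarrow> real) topology"
  have proj: "continuous_map ?T euclideanreal (\<lambda>y. y u)" for u
    by (auto intro: continuous_map_product_projection)
  have closed: "closedin ?T (realization_simplex \<sigma>)" for \<sigma> :: "'a set"
  proof -
    have "closedin ?T ((\<Inter>v. {y \<in> topspace ?T. y v \<in> {0..}}) \<inter> (\<Inter>v. {y \<in> topspace ?T. y v \<in> (if v \<in> \<sigma> then UNIV else {0})}) \<inter>
        {y \<in> topspace ?T. (\<Sum>v\<in>\<sigma>. y v) \<in> {1}})"
    proof (intro closedin_Int closedin_INT closedin_continuous_map_preimage[OF proj])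
      show "closedin ?T {y \<in> topspace ?T. (\<Sum>v\<in>\<sigma>. y v) \<in> {1}}"
      proof (cases "finite \<sigma>")
        case True
        show ?thesis
          by (rule closedin_continuous_map_preimage[where Y = euclideanreal]) (auto intro: continuous_map_sum True proj)
      qed simp
    qed auto
    also have "((\<Inter>v. {y \<in> topspace ?T. y v \<in> {0..}}) \<inter> (\<Inter>v. {y \<in> topspace ?T. y v \<in> (if v \<in> \<sigma> then UNIV else {0})}) \<inter>
        {y \<in> topspace ?T. (\<Sum>v\<in>\<sigma>. y v) \<in> {1}}) = realization_simplex \<sigma>"
      by (auto simp: realization_simplex_def split: if_splits)
    finally show ?thesis .
  qed
  fix U
  show "openin (geometric_realization K) U \<longleftrightarrow> openin (subtopology ?T (topspace (geometric_realization K))) U"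
  proof
    assume U: "openin (geometric_realization K) U"
    then have UK: "U \<subseteq> ?K" using openin_subset topspace_geometric_realization by blast
    have "\<exists>V. openin (subtopology ?T ?K) V \<and> y \<in> V \<and> V \<subseteq> U" if y: "y \<in> U" for y
    proof -
      obtain \<sigma> where \<sigma>: "\<sigma> \<in> K" "y \<in> realization_simplex \<sigma>" using UK y by blast
      have fin: "finite \<sigma>" using K \<sigma>(1) unfolding abstract_simplicial_complex_def by blast
      define v where "v = dominant_vertex y"
      have v: "0 < y v" using dominant_vertex(3)[OF \<sigma>(2) fin] by (simp add: v_def)
      define L where "L = {\<tau> \<in> K. v \<in> \<tau>}"
      have finL: "finite L" using lf by (simp add: L_def locally_finite_complex_def)
      define C where "C = (\<Union>\<tau>\<in>L. realization_simplex \<tau> - U)"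
      have "closedin ?T (realization_simplex \<tau> - U)" if "\<tau> \<in> L" for \<tau>
      proof -
        have "openin (subtopology ?T (realization_simplex \<tau>)) (U \<inter> realization_simplex \<tau>)"
          using U that by (simp add: L_def openin_geometric_realization realization_open_def)
        then have "closedin (subtopology ?T (realization_simplex \<tau>)) (topspace (subtopology ?T (realization_simplex \<tau>)) - U \<inter> realization_simplex \<tau>)"
          by (rule openin_closedin_eq[THEN iffD1, THEN conjunct2])
        moreover have "topspace (subtopology ?T (realization_simplex \<tau>)) - U \<inter> realization_simplex \<tau> = realization_simplex \<tau> - U"
          by auto
        ultimately show ?thesis using closedin_trans_full[OF _ closed] by metis
      qed
      then have "closedin ?T C" unfolding C_def by (intro closedin_Union) (use finL in auto)
      moreover have "openin ?T {x \<in> topspace ?T. x v \<in> {0<..}}"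
        by (rule openin_continuous_map_preimage[OF proj]) simp
      ultimately have "openin ?T ({x \<in> topspace ?T. x v \<in> {0<..}} - C)" by (rule openin_diff[rotated])
      then have "openin (subtopology ?T ?K) (({x \<in> topspace ?T. x v \<in> {0<..}} - C) \<inter> ?K)"
        by (rule openin_subtopology_Int)
      moreover have "y \<in> ({x \<in> topspace ?T. x v \<in> {0<..}} - C) \<inter> ?K"
        using v y UK by (auto simp: C_def)
      moreover have "({x \<in> topspace ?T. x v \<in> {0<..}} - C) \<inter> ?K \<subseteq> U"
      proof
        fix x assume "x \<in> ({x \<in> topspace ?T. x v \<in> {0<..}} - C) \<inter> ?K"
        then obtain \<tau> where x: "x v \<in> {0<..}" "x \<notin> C" "\<tau> \<in> K" "x \<in> realization_simplex \<tau>" by blast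
        then have "v \<in> \<tau>" by (force simp: realization_simplex_def)
        then show "x \<in> U" using x by (auto simp: C_def L_def)
      qed
      ultimately show ?thesis by (intro exI conjI)
    qed
    then show "openin (subtopology ?T (topspace (geometric_realization K))) U"
      unfolding topspace_geometric_realization by (subst openin_subopen) simp
  next
    assume "openin (subtopology ?T (topspace (geometric_realization K))) U"
    then obtain V where V: "openin ?T V" "U = V \<inter> ?K"
      unfolding openin_subtopology topspace_geometric_realization by blast
    have "openin (subtopology ?T (realization_simplex \<sigma>)) (U \<inter> realization_simplex \<sigma>)" if "\<sigma> \<in> K" for \<sigma>
    proof -
      have "U \<inter> realization_simplex \<sigma> = V \<inter> realization_simplex \<sigma>" using V(2) that by blast
      then show ?thesis using V(1) by (simp add: openin_subtopology_Int)
    qed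
    then show "openin (geometric_realization K) U"
      using V(2) by (auto simp: openin_geometric_realization realization_open_def)
  qed
qed

lemma realization_simplex_mono:
  assumes "\<sigma> \<subseteq> \<tau>" "finite \<tau>"
  shows "realization_simplex \<sigma> \<subseteq> realization_simplex \<tau>"
proof
  fix t assume t: "t \<in> realization_simplex \<sigma>"
  then have "(\<Sum>v\<in>\<tau>. t v) = (\<Sum>v\<in>\<sigma>. t v)"
    using assms by (intro sum.mono_neutral_right) (auto simp: realization_simplex_def)
  then show "t \<in> realization_simplex \<tau>" using t assms by (auto simp: realization_simplex_def)
qed

lemma realization_simplex_convex:
  assumes "x \<in> realization_simplex \<sigma>" "y \<in> realization_simplex \<sigma>" "0 \<le> t" "t \<le> 1"
  shows "(\<lambda>u. (1 - t) * x u + t * y u) \<in> realization_simplex \<sigma>"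
  using assms by (auto simp: realization_simplex_def sum.distrib simp flip: sum_distrib_left)

text \<open>Every simplex containing a point of the star has \<open>\<rho>\<close> as a face,
  because the coordinates at \<open>\<rho>\<close> are positive; so it contains both ends of the
  segment and is convex.\<close>

lemma barycentric_star_segment:
  assumes K: "abstract_simplicial_complex K" and \<rho>: "\<rho> \<in> K"
    and x: "x \<in> barycentric_star K \<rho>" and y: "y \<in> realization_simplex \<rho>" and t: "0 \<le> t" "t \<le> 1"
  shows "(\<lambda>u. (1 - t) * x u + t * y u) \<in> topspace (geometric_realization K)"
proof -
  obtain \<sigma> where \<sigma>: "\<sigma> \<in> K" "x \<in> realization_simplex \<sigma>"
    using x by (auto simp: barycentric_star_def topspace_geometric_realization)
  have "\<rho> \<subseteq> \<sigma>" using x \<sigma>(2) by (force simp: barycentric_star_def realization_simplex_def)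
  moreover have "finite \<sigma>" using K \<sigma>(1) unfolding abstract_simplicial_complex_def by blast
  ultimately have "y \<in> realization_simplex \<sigma>" using y realization_simplex_mono by blast
  then show ?thesis
    using realization_simplex_convex[OF \<sigma>(2) _ t] \<sigma>(1) by (auto simp: topspace_geometric_realization)
qed

lemma affine_chain_vertex_chain_homologous:
  assumes K: "abstract_simplicial_complex K" and lf: "locally_finite_complex K"
    and c: "singular_relcycle n (geometric_realization K) {} c"
    and small: "\<And>\<sigma>. \<sigma> \<in> Poly_Mapping.keys c \<Longrightarrow> \<exists>\<rho>\<in>K. \<sigma> \<in> standard_simplex n \<rightarrow> barycentric_star K \<rho>"
  shows "homologous_rel n (geometric_realization K) {} (affine_chain n (vertex_chain n c)) c"
proof -
  let ?X = "geometric_realization K"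
  define Q where "Q = (\<lambda>n \<sigma>. singular_simplex n ?X \<sigma> \<and> (\<exists>\<rho>\<in>K. \<sigma> \<in> standard_simplex n \<rightarrow> barycentric_star K \<rho>))"
  define A where "A = (\<lambda>n (\<sigma> :: (nat \<Rightarrow> real) \<Rightarrow> 'a \<Rightarrow> real). affine_simplex n (vertex_list n \<sigma>))"
  \<comment> \<open>The straight line from \<open>\<sigma>\<close> to the affine simplex on its
    dominant vertices. Both ends are compatible with passing to faces, hence so is the
    homotopy.\<close>
  define G where "G = (\<lambda>n \<sigma> (x, t) u. (1 - t) * \<sigma> x u + t * A n \<sigma> x u)"
  have main: "homologous_rel n ?X {}
      (frag_extend (\<lambda>\<sigma>. frag_of (\<lambda>x\<in>standard_simplex n. G n \<sigma> (x, 1))) c)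
      (frag_extend (\<lambda>\<sigma>. frag_of (\<lambda>x\<in>standard_simplex n. G n \<sigma> (x, 0))) c)"
  proof (rule simplexwise_homotopy_homologous[where Q = Q])
    show "Poly_Mapping.keys c \<subseteq> Collect (Q n)"
      using c small by (auto simp: Q_def singular_cycle singular_chain_def)
    show "chain_boundary n c = 0" using c by (simp add: singular_cycle)
    show "Q n (singular_face (Suc n) k \<sigma>)" if "Q (Suc n) \<sigma>" "k \<le> Suc n" for n k \<sigma>
      using that singular_simplex_singular_face[of "Suc n" ?X \<sigma> k] simplical_face_in_standard_simplex[of "Suc n" k]
      by (force simp: Q_def singular_face_def)
    show "G n (singular_face (Suc n) k \<sigma>) (x, t) = G (Suc n) \<sigma> (simplical_face k x, t)"
      if "Q (Suc n) \<sigma>" "k \<le> Suc n" "x \<in> standard_simplex n" "t \<in> {0..1}" for n k \<sigma> x t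
    proof -
      have "A n (singular_face (Suc n) k \<sigma>) x = A (Suc n) \<sigma> (simplical_face k x)"
        unfolding A_def vertex_list_face[OF that(2)]
        using that by (subst singular_face_affine_simplex[symmetric]) (auto simp: singular_face_def)
      then show ?thesis using that by (simp add: G_def singular_face_def)
    qed
    show "continuous_map (simplex_cylinder n) ?X (G n \<sigma>)" if \<sigma>: "Q n \<sigma>" for n \<sigma>
    proof -
      obtain \<rho> where \<rho>: "\<rho> \<in> K" "\<sigma> \<in> standard_simplex n \<rightarrow> barycentric_star K \<rho>" using \<sigma> by (auto simp: Q_def)
      have fin: "finite \<rho>" using K \<rho>(1) unfolding abstract_simplicial_complex_def by blast
      let ?S = "subtopology (powertop_real UNIV) (standard_simplex n)"
      have "continuous_map ?S ?X \<sigma>" using \<sigma> by (simp add: Q_def singular_simplex_def)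
      \<comment> \<open>Local finiteness is used here and again for the target: since |K| has the
        subspace topology of the product, continuity of the segment can be checked coordinate by
        coordinate.\<close>
      then have c\<sigma>: "continuous_map ?S (powertop_real UNIV) \<sigma>"
        by (subst (asm) geometric_realization_locally_finite[OF K lf]) (rule continuous_map_into_fulltopology)
      have cA: "continuous_map ?S (powertop_real UNIV) (A n \<sigma>)"
        unfolding A_def by (rule continuous_map_affine_simplex)
      have comp: "continuous_map (simplex_cylinder n) euclideanreal (\<lambda>p. h (fst p) u)"
        if "continuous_map ?S (powertop_real UNIV) h" for h and u :: 'a
        using continuous_map_compose[OF continuous_map_compose[OF continuous_map_fst that]
            continuous_map_product_projection[of u UNIV "\<lambda>_. euclideanreal"]]
        unfolding simplex_cylinder_def by (simp add: o_def)
      have cs: "continuous_map (simplex_cylinder n) euclideanreal snd"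
        unfolding simplex_cylinder_def by (rule continuous_map_into_fulltopology[OF continuous_map_snd])
      have "continuous_map (simplex_cylinder n) euclideanreal (\<lambda>p. (1 - snd p) * \<sigma> (fst p) u + snd p * A n \<sigma> (fst p) u)" for u
        by (intro continuous_map_add continuous_map_real_mult continuous_map_diff comp c\<sigma> cA cs) simp
      then have "continuous_map (simplex_cylinder n) (powertop_real UNIV) (G n \<sigma>)"
        unfolding continuous_map_componentwise_UNIV by (simp add: G_def case_prod_unfold)
      moreover have "G n \<sigma> p \<in> topspace ?X" if p0: "p \<in> topspace (simplex_cylinder n)" for p
      proof -
        obtain x t where p: "p = (x, t)" "x \<in> standard_simplex n" "0 \<le> t" "t \<le> 1"
          using p0 by (auto simp: topspace_simplex_cylinder)
        have "A n \<sigma> x \<in> realization_simplex (set (vertex_list n \<sigma>))"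
          unfolding A_def using p(2) by (intro affine_simplex_in_realization) auto
        then have "A n \<sigma> x \<in> realization_simplex \<rho>"
          using realization_simplex_mono[OF vertex_list_small(2)[OF K \<rho>] fin] by blast
        moreover have "\<sigma> x \<in> barycentric_star K \<rho>" using \<rho>(2) p(2) by auto
        ultimately show ?thesis
          using barycentric_star_segment[OF K \<rho>(1) _ _ p(3,4), of "\<sigma> x" "A n \<sigma> x"] by (simp add: G_def p(1))
      qed
      ultimately show ?thesis
        by (subst geometric_realization_locally_finite[OF K lf]) (auto simp: continuous_map_in_subtopology)
    qed
  qed
  have "frag_extend (\<lambda>\<sigma>. frag_of (\<lambda>x\<in>standard_simplex n. G n \<sigma> (x, 1))) c = affine_chain n (vertex_chain n c)"
  proof -
    have "(\<lambda>x\<in>standard_simplex n. G n \<sigma> (x, 1)) = affine_simplex n (vertex_list n \<sigma>)" for \<sigma>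
      by (auto simp: G_def A_def affine_simplex_def)
    then show ?thesis
      using frag_extend_compose[of "\<lambda>s. frag_of (affine_simplex n s)" "vertex_list n" c]
      by (simp add: affine_chain_def vertex_chain_def o_def)
  qed
  moreover have "frag_extend (\<lambda>\<sigma>. frag_of (\<lambda>x\<in>standard_simplex n. G n \<sigma> (x, 0))) c = c"
  proof -
    have "frag_extend (\<lambda>\<sigma>. frag_of (\<lambda>x\<in>standard_simplex n. G n \<sigma> (x, 0))) c = frag_extend frag_of c"
    proof (rule frag_extend_eq)
      fix \<sigma> assume "\<sigma> \<in> Poly_Mapping.keys c"
      then have "\<sigma> \<in> extensional (standard_simplex n)"
        using c by (auto simp: singular_cycle singular_chain_def singular_simplex_def)
      then have "(\<lambda>x\<in>standard_simplex n. G n \<sigma> (x, 0)) = \<sigma>"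
        by (auto simp: G_def extensional_def)
      then show "frag_of (\<lambda>x\<in>standard_simplex n. G n \<sigma> (x, 0)) = frag_of \<sigma>" by simp
    qed
    then show ?thesis by (simp flip: frag_expansion)
  qed
  ultimately show ?thesis using main by simp
qed

lemma affine_chain_relcycle:
  assumes z: "z \<in> ordered_cycles K n"
  shows "singular_relcycle n (geometric_realization K) {} (affine_chain n z)"
proof -
  have "chain_boundary n (affine_chain n z) = 0"
  proof (cases n)
    case (Suc m)
    have "Poly_Mapping.keys z \<subseteq> {s. length s = Suc (Suc m)}"
      using z Suc by (auto simp: ordered_cycles_def ordered_simplices_def)
    then show ?thesis
      using chain_boundary_affine_chain[of z m] z Suc by (simp add: ordered_cycles_def)
  qed (simp add: chain_boundary_def)
  then show ?thesis
    using singular_chain_affine_chain[of z K n] z by (simp add: singular_cycle ordered_cycles_def)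
qed

text \<open>Surjectivity on homology: a cycle is first replaced by a homologous small one, whose
  vertex chain is then an ordered cycle with affine realization homologous to it.\<close>

lemma affine_chain_surjective:
  assumes K: "abstract_simplicial_complex K" and lf: "locally_finite_complex K"
    and c: "singular_relcycle n (geometric_realization K) {} c"
  obtains z where "z \<in> ordered_cycles K n" "homologous_rel n (geometric_realization K) {} (affine_chain n z) c"
proof -
  let ?X = "geometric_realization K"
  have "openin ?X U" if "U \<in> barycentric_star K ` K" for U
    using that openin_barycentric_star[OF K] K unfolding abstract_simplicial_complex_def by blast
  then obtain c' where c': "singular_relcycle n ?X {} c'" "homologous_rel n ?X {} c c'"
    and small: "\<And>f. f \<in> Poly_Mapping.keys c' \<Longrightarrow> \<exists>V\<in>barycentric_star K ` K. f \<in> standard_simplex n \<rightarrow> V"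
    by (rule small_homologous_rel_relcycle_exists[OF _ barycentric_star_cover[OF K] c]) blast+
  have small': "\<exists>\<rho>\<in>K. \<sigma> \<in> standard_simplex n \<rightarrow> barycentric_star K \<rho>" if "\<sigma> \<in> Poly_Mapping.keys c'" for \<sigma>
    using small[OF that] by blast
  have "vertex_chain n c' \<in> ordered_cycles K n"
  proof -
    have "Poly_Mapping.keys (vertex_chain n c') \<subseteq> ordered_simplices K n"
      using keys_vertex_chain[of n c'] vertex_list_small(1)[OF K] small' by blast
    moreover have "ordered_boundary m (vertex_chain n c') = 0" if "n = Suc m" for m
      using c'(1) that by (simp add: ordered_boundary_vertex_chain singular_cycle)
    ultimately show ?thesis by (auto simp: ordered_cycles_def split: nat.split)
  qed
  moreover have "homologous_rel n ?X {} (affine_chain n (vertex_chain n c')) c"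
    using affine_chain_vertex_chain_homologous[OF K lf c'(1) small'] c'(2)
    by (metis homologous_rel_sym homologous_rel_trans)
  ultimately show thesis by (rule that)
qed

lemma subgroup_ordered_cycles: "subgroup (ordered_cycles K n) (ordered_chains K n)"
proof -
  have keys: "Poly_Mapping.keys (x + y) \<subseteq> S" if "Poly_Mapping.keys x \<subseteq> S" "Poly_Mapping.keys y \<subseteq> S"
    for x y :: "'a list \<Rightarrow>\<^sub>0 int" and S
    using that keys_add[of x y] by blast
  have iff: "z \<in> ordered_cycles K n \<longleftrightarrow>
      Poly_Mapping.keys z \<subseteq> ordered_simplices K n \<and> (\<forall>m. n = Suc m \<longrightarrow> ordered_boundary m z = 0)" for z
    by (cases n) (simp_all add: ordered_cycles_def)
  have "0 \<in> ordered_cycles K n" by (simp add: iff)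
  then have "ordered_cycles K n \<noteq> {}" by blast
  then show ?thesis
    unfolding ordered_chains_def
    by (intro group.subgroupI[OF group_free_Abelian_group] subsetI)
      (simp_all add: iff keys ordered_boundary_add ordered_boundary_minus)
qed

text \<open>Homology is presented by cycles and boundaries because the sequel compares two free
  resolutions and takes the inclusion of the boundaries in the cycles for one of them.\<close>

theorem ordered_homology_epi:
  assumes K: "abstract_simplicial_complex K" and lf: "locally_finite_complex K"
  obtains q where "q \<in> epi (ordered_chains K n\<lparr>carrier := ordered_cycles K n\<rparr>) (homology_group (int n) (geometric_realization K))"
    "kernel (ordered_chains K n\<lparr>carrier := ordered_cycles K n\<rparr>) (homology_group (int n) (geometric_realization K)) q
       = ordered_boundaries K n"
proof -
  let ?X = "geometric_realization K" and ?Z = "ordered_chains K n\<lparr>carrier := ordered_cycles K n\<rparr>"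
  let ?H = "homology_group (int n) ?X"
  define q where "q = homologous_rel_set n ?X {} \<circ> affine_chain n"
  have "affine_chain n \<in> hom ?Z (relcycle_group n ?X {})"
    by (rule homI) (auto simp: affine_chain_relcycle ordered_chains_def)
  moreover have "homologous_rel_set n ?X {} \<in> hom (relcycle_group n ?X {}) ?H"
    using normal.r_coset_hom_Mod[OF normal_subgroup_singular_relboundary_relcycle[of n ?X "{}"]]
    by (simp add: nontrivial_relative_homology_group right_coset_singular_relboundary)
  ultimately have q: "q \<in> hom ?Z ?H" unfolding q_def by (rule hom_compose)
  moreover have "carrier ?H \<subseteq> q ` ordered_cycles K n"
  proof
    fix x assume "x \<in> carrier ?H"
    then obtain c where c: "singular_relcycle n ?X {} c" "x = homologous_rel_set n ?X {} c"
      by (auto simp: carrier_relative_homology_group)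
    obtain z where z: "z \<in> ordered_cycles K n" "homologous_rel n ?X {} (affine_chain n z) c"
      by (rule affine_chain_surjective[OF K lf c(1)])
    then have "x = q z" using c(2) by (simp add: q_def homologous_rel_set_eq[symmetric])
    then show "x \<in> q ` ordered_cycles K n" using z(1) by blast
  qed
  ultimately have "q \<in> epi ?Z ?H" by (auto simp: epi_def hom_def)
  moreover have "kernel ?Z ?H q = ordered_boundaries K n"
  proof
    show "kernel ?Z ?H q \<subseteq> ordered_boundaries K n"
      using affine_chain_boundary_imp[OF K] by (auto simp: kernel_def q_def homologous_rel_set_eq_relboundary)
    show "ordered_boundaries K n \<subseteq> kernel ?Z ?H q"
    proof
      fix z assume z: "z \<in> ordered_boundaries K n"
      then obtain c where c: "Poly_Mapping.keys c \<subseteq> ordered_simplices K (Suc n)" "z = ordered_boundary n c"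
        by (auto simp: ordered_boundaries_def)
      have "chain_boundary (Suc n) (affine_chain (Suc n) c) = affine_chain n z"
        unfolding c(2) by (rule chain_boundary_affine_chain) (use c(1) in \<open>auto simp: ordered_simplices_def\<close>)
      then have "singular_relboundary n ?X {} (affine_chain n z)"
        using singular_chain_affine_chain[OF c(1)] by (auto simp: singular_boundary)
      then show "z \<in> kernel ?Z ?H q"
        using ordered_boundaries_subset_cycles[OF K] z
        by (auto simp: kernel_def q_def homologous_rel_set_eq_relboundary)
    qed
  qed
  ultimately show thesis by (rule that)
qed

section \<open>The universal coefficient theorem for phantom subgroups\<close>

lemma countable_free_Abelian_group:
  assumes "countable S"
  shows "countable (carrier (free_Abelian_group S))"
proof -
  define f where "f = (\<lambda>P :: ('a \<times> int) set. \<Sum>(s, k)\<in>P. frag_cmul k (frag_of s))"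
  have "carrier (free_Abelian_group S) \<subseteq> f ` {P. finite P \<and> P \<subseteq> S \<times> UNIV}"
  proof
    fix c assume c: "c \<in> carrier (free_Abelian_group S)"
    let ?P = "(\<lambda>s. (s, Poly_Mapping.lookup c s)) ` Poly_Mapping.keys c"
    have "inj_on (\<lambda>s. (s, Poly_Mapping.lookup c s)) (Poly_Mapping.keys c)" by (auto intro: inj_onI)
    then have "f ?P = frag_extend frag_of c"
      by (simp add: f_def frag_extend_def sum.reindex)
    then have "c = f ?P" by (simp flip: frag_expansion)
    moreover have "?P \<in> {P. finite P \<and> P \<subseteq> S \<times> UNIV}" using c by auto
    ultimately show "c \<in> f ` {P. finite P \<and> P \<subseteq> S \<times> UNIV}" by (rule image_eqI)
  qed
  moreover have "countable {P. finite P \<and> P \<subseteq> S \<times> (UNIV :: int set)}"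
    using assms by (intro countable_Collect_finite_subset) auto
  ultimately show ?thesis by (meson countable_image countable_subset)
qed

lemma countable_ordered_simplices:
  assumes "abstract_simplicial_complex K" "countable K"
  shows "countable (ordered_simplices K n)"
proof -
  have "ordered_simplices K n \<subseteq> (\<Union>\<sigma>\<in>K. {s. set s \<subseteq> \<sigma> \<and> length s = Suc n})"
    by (auto simp: ordered_simplices_def)
  moreover have "finite {s. set s \<subseteq> \<sigma> \<and> length s = Suc n}" if "\<sigma> \<in> K" for \<sigma>
    using that assms(1) by (intro finite_lists_length_eq) (auto simp: abstract_simplicial_complex_def)
  ultimately show ?thesis
    using assms(2) by (meson countable_UN countable_finite countable_subset)
qed

lemma mon_lift:
  assumes i: "i \<in> mon R F" and u: "u \<in> hom P F" "u ` carrier P \<subseteq> i ` carrier R" and R: "group R"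
  obtains v where "v \<in> hom P R" "\<And>x. x \<in> carrier P \<Longrightarrow> i (v x) = u x"
proof -
  have ih: "i \<in> hom R F" and inj: "inj_on i (carrier R)" using i by (auto simp: mon_def)
  interpret R: group R by fact
  define v where "v = (\<lambda>x. inv_into (carrier R) i (u x))"
  have v: "v x \<in> carrier R" "i (v x) = u x" if "x \<in> carrier P" for x
    using u(2) that inv_into_into[of "u x" i "carrier R"] f_inv_into_f[of "u x" i "carrier R"]
    by (auto simp: v_def)
  have "v (x \<otimes>\<^bsub>P\<^esub> y) = v x \<otimes>\<^bsub>R\<^esub> v y" if xy: "x \<in> carrier P" "y \<in> carrier P" for x y
  proof -
    have "i (v x \<otimes>\<^bsub>R\<^esub> v y) = u (x \<otimes>\<^bsub>P\<^esub> y)"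
      using hom_mult[OF ih v(1)[OF xy(1)] v(1)[OF xy(2)]] hom_mult[OF u(1) xy] v(2) xy by simp
    then show ?thesis
      using inv_into_f_f[OF inj R.m_closed[OF v(1)[OF xy(1)] v(1)[OF xy(2)]]] by (simp add: v_def)
  qed
  then have "v \<in> hom P R" using v(1) by (intro homI)
  then show thesis using v(2) by (rule that)
qed

lemma hom_cong:
  assumes "u \<in> hom P F" "\<And>x. x \<in> carrier P \<Longrightarrow> u x = w x" "group P"
  shows "w \<in> hom P F"
proof (rule homI)
  interpret group P by fact
  fix x y assume xy: "x \<in> carrier P" "y \<in> carrier P"
  show "w x \<in> carrier F" using hom_in_carrier[OF assms(1) xy(1)] assms(2)[OF xy(1)] by simp
  show "w (x \<otimes>\<^bsub>P\<^esub> y) = w x \<otimes>\<^bsub>F\<^esub> w y"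
    using hom_mult[OF assms(1) xy] assms(2)[OF xy(1)] assms(2)[OF xy(2)] assms(2)[OF m_closed[OF xy]] by simp
qed

lemma hom_mult_inv:
  assumes "comm_group F" "u \<in> hom P F" "w \<in> hom P F"
  shows "(\<lambda>x. u x \<otimes>\<^bsub>F\<^esub> inv\<^bsub>F\<^esub> (w x)) \<in> hom P F"
proof -
  interpret F: comm_group F by fact
  have c: "u x \<in> carrier F" "w x \<in> carrier F" if "x \<in> carrier P" for x
    using assms that by (auto simp: hom_def)
  show ?thesis
    by (rule homI) (simp_all add: c hom_mult[OF assms(2)] hom_mult[OF assms(3)] F.inv_mult F.m_ac)
qed

text \<open>The annihilator of the boundaries consists of the cocycles, that of the cycles is the
  subgroup \<open>W\<close>; one closedness argument serves both.\<close>

definition hom_annihilator :: "('c, 'm) monoid_scheme \<Rightarrow> ('a, 'n) monoid_scheme \<Rightarrow> 'c set \<Rightarrow> ('c \<Rightarrow> 'a) set" where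
  "hom_annihilator C A S = {f \<in> carrier (hom_group C A). \<forall>c\<in>S. f c = \<one>\<^bsub>A\<^esub>}"

lemma hom_annihilator_closed_subgroup:
  assumes C: "group C" "countable (carrier C)" and A: "comm_group A" "countable (carrier A)" and S: "S \<subseteq> carrier C"
  shows "subgroup (hom_annihilator C A S) (hom_group C A)"
    and "closedin (hom_topology C A) (hom_annihilator C A S)"
proof -
  interpret A: comm_group A by (rule A)
  interpret H: comm_group "hom_group C A" by (rule comm_group_hom_group[OF C(1) A(1)])
  have inv: "(inv\<^bsub>hom_group C A\<^esub> f) c = inv\<^bsub>A\<^esub> (f c)" if f: "f \<in> carrier (hom_group C A)" and c: "c \<in> carrier C" for f c
  proof -
    have "f \<otimes>\<^bsub>hom_group C A\<^esub> inv\<^bsub>hom_group C A\<^esub> f = \<one>\<^bsub>hom_group C A\<^esub>" using f by simp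
    then have "f c \<otimes>\<^bsub>A\<^esub> (inv\<^bsub>hom_group C A\<^esub> f) c = \<one>\<^bsub>A\<^esub>"
      using c by (simp add: hom_group_simps fun_eq_iff restrict_def split: if_splits)
    then show ?thesis
      using hom_groupD(3)[OF f c] hom_groupD(3)[OF H.inv_closed[OF f] c] A.inv_equality A.m_comm by metis
  qed
  have SC: "c \<in> carrier C" if "c \<in> S" for c using S that by blast
  show "subgroup (hom_annihilator C A S) (hom_group C A)"
  proof (rule H.subgroupI)
    show "hom_annihilator C A S \<noteq> {}"
      using H.one_closed SC by (auto simp: hom_annihilator_def hom_group_simps intro!: exI[of _ "\<one>\<^bsub>hom_group C A\<^esub>"])
    fix f assume f: "f \<in> hom_annihilator C A S"
    then show "inv\<^bsub>hom_group C A\<^esub> f \<in> hom_annihilator C A S"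
      using SC by (simp add: hom_annihilator_def inv)
    fix g assume g: "g \<in> hom_annihilator C A S"
    have "(f \<otimes>\<^bsub>hom_group C A\<^esub> g) c = \<one>\<^bsub>A\<^esub>" if "c \<in> S" for c
      using f g SC[OF that] that by (simp add: hom_annihilator_def hom_group_simps)
    then show "f \<otimes>\<^bsub>hom_group C A\<^esub> g \<in> hom_annihilator C A S"
      using f g by (simp add: hom_annihilator_def)
  qed (auto simp: hom_annihilator_def)
  have "closedin (hom_topology C A) {f \<in> topspace (hom_topology C A). f c \<in> {\<one>\<^bsub>A\<^esub>}}" if "c \<in> S" for c
    by (rule closedin_continuous_map_preimage[OF continuous_map_hom_topology_eval[OF SC[OF that]]]) simp
  then have "closedin (hom_topology C A) (topspace (hom_topology C A) \<inter> (\<Inter>c\<in>S. {f \<in> topspace (hom_topology C A). f c \<in> {\<one>\<^bsub>A\<^esub>}}))"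
    by (cases "S = {}") (auto intro!: closedin_Int closedin_INT)
  moreover have "topspace (hom_topology C A) \<inter> (\<Inter>c\<in>S. {f \<in> topspace (hom_topology C A). f c \<in> {\<one>\<^bsub>A\<^esub>}}) = hom_annihilator C A S"
    by (auto simp: hom_annihilator_def topspace_hom_topology)
  ultimately show "closedin (hom_topology C A) (hom_annihilator C A S)" by simp
qed

lemma group_ordered_chains: "group (ordered_chains K n)" "comm_group (ordered_chains K n)"
  by (simp_all add: ordered_chains_def abelian_free_Abelian_group)

lemma carrier_ordered_chains: "carrier (ordered_chains K n) = {c. Poly_Mapping.keys c \<subseteq> ordered_simplices K n}"
  by (auto simp: ordered_chains_def)

lemma ordered_boundary_hom:
  assumes "abstract_simplicial_complex K"
  shows "ordered_boundary n \<in> hom (ordered_chains K (Suc n)) (ordered_chains K n)"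
  using keys_ordered_boundary_chain[OF assms]
  by (intro homI) (auto simp: ordered_chains_def ordered_boundary_add)

lemma cocycles_eq_annihilator:
  "cocycles K A n = hom_annihilator (ordered_chains K n) A (ordered_boundaries K n)"
  by (auto simp: cocycles_def hom_annihilator_def coboundary_def hom_group_simps ordered_boundaries_def
      carrier_ordered_chains fun_eq_iff restrict_def split: if_splits)

lemma cohomology_cover_polish:
  assumes K: "abstract_simplicial_complex K" "countable K" and A: "comm_group A" "countable (carrier A)"
  shows "abelian_polish_group (cohomology_cover K A n) (cover_topology (cohomology_cover K A n))"
    and "S \<subseteq> carrier (ordered_chains K n) \<Longrightarrow> ordered_boundaries K n \<subseteq> S \<Longrightarrow>
      subgroup (hom_annihilator (ordered_chains K n) A S) (cohomology_cover K A n) \<and>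
      closedin (cover_topology (cohomology_cover K A n)) (hom_annihilator (ordered_chains K n) A S)"
proof -
  let ?C = "ordered_chains K n" and ?G = "cohomology_cover K A n"
  have cC: "countable (carrier ?C)"
    unfolding ordered_chains_def by (intro countable_free_Abelian_group countable_ordered_simplices K)
  note pol = abelian_polish_group_hom[OF group_ordered_chains(1) cC A]
  have B: "ordered_boundaries K n \<subseteq> carrier ?C"
    using ordered_boundaries_subset_cycles[OF K(1)] by (auto simp: ordered_cycles_def carrier_ordered_chains)
  note ann = hom_annihilator_closed_subgroup[OF group_ordered_chains(1) cC A]
  have G: "carrier ?G = hom_annihilator ?C A (ordered_boundaries K n)" "monoid.mult ?G = monoid.mult (hom_group ?C A)"
    "one ?G = one (hom_group ?C A)"
    "cover_topology ?G = subtopology (hom_topology ?C A) (hom_annihilator ?C A (ordered_boundaries K n))"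
    by (simp_all add: cohomology_cover_def cocycles_eq_annihilator)
  have "abelian_polish_group (hom_group ?C A\<lparr>carrier := hom_annihilator ?C A (ordered_boundaries K n)\<rparr>) (cover_topology ?G)"
    using polish_subgroup_topology_closed[OF pol ann[OF B]] by (simp add: polish_subgroup_topology_def G)
  then show pG: "abelian_polish_group ?G (cover_topology ?G)"
    by (rule abelian_polish_group_cong) (simp_all add: G)
  assume S: "S \<subseteq> carrier ?C" "ordered_boundaries K n \<subseteq> S"
  have sub: "hom_annihilator ?C A S \<subseteq> carrier ?G" using S(2) by (auto simp: G hom_annihilator_def)
  have "subgroup (hom_annihilator ?C A S) ?G"
    by (rule subgroup_cong[OF ann(1)[OF S(1)] _ _ sub])
      (use abelian_polish_groupD(1)[OF pol] abelian_polish_groupD(1)[OF pG] in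
        \<open>auto simp: G hom_annihilator_def comm_group_def\<close>)
  moreover have "closedin (cover_topology ?G) (hom_annihilator ?C A S)"
    using closedin_subset_topspace[OF ann(2)[OF S(1)]] sub unfolding G by blast
  ultimately show "subgroup (hom_annihilator ?C A S) ?G \<and> closedin (cover_topology ?G) (hom_annihilator ?C A S)" by simp
qed

section \<open>Splittings of the chain complex\<close>

lemma subgroup_ordered_boundaries:
  assumes "abstract_simplicial_complex K"
  shows "subgroup (ordered_boundaries K n) (ordered_chains K n)"
proof -
  interpret group_hom "ordered_chains K (Suc n)" "ordered_chains K n" "ordered_boundary n"
    by (intro group_hom.intro group_hom_axioms.intro group_ordered_chains ordered_boundary_hom assms)
  show ?thesis using img_is_subgroup by (simp add: ordered_boundaries_def carrier_ordered_chains)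
qed

text \<open>The boundaries are a subgroup of a free group, so their identity map lifts through the
  boundary map.\<close>

lemma ordered_boundary_section:
  assumes K: "abstract_simplicial_complex K" "countable K"
  shows "\<exists>s \<in> hom (ordered_chains K n\<lparr>carrier := ordered_boundaries K n\<rparr>) (ordered_chains K (Suc n)).
    \<forall>b \<in> ordered_boundaries K n. ordered_boundary n (s b) = b"
proof -
  let ?B = "ordered_chains K n\<lparr>carrier := ordered_boundaries K n\<rparr>"
  note sub = subgroup_ordered_boundaries[OF K(1), of n]
  have "ordered_boundary n \<in> epi (ordered_chains K (Suc n)) ?B"
    using hom_mult[OF ordered_boundary_hom[OF K(1)]]
    by (auto simp: epi_def hom_def ordered_boundaries_def carrier_ordered_chains)
  from subgroup_free_Abelian_group_lift[OF countable_ordered_simplices[OF K] sub[unfolded ordered_chains_def]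
      group_ordered_chains(2) this[unfolded ordered_chains_def[of K n]] id_iso[unfolded iso_def, THEN CollectD, THEN conjunct1]]
  show ?thesis
    using subgroup.subgroup_is_group[OF sub group_ordered_chains(1)] by (simp add: ordered_chains_def)
qed

text \<open>With \<open>s\<close> a section of the boundary, subtracting \<open>s\<close> of its
  boundary from a chain projects onto the cycles. The retraction serves to extend homomorphisms from
  cycles to cochains on all chains.\<close>

lemma ordered_cycles_retraction:
  assumes K: "abstract_simplicial_complex K" "countable K"
  shows "\<exists>\<rho> \<in> hom (ordered_chains K n) (ordered_chains K n\<lparr>carrier := ordered_cycles K n\<rparr>).
    \<forall>z \<in> ordered_cycles K n. \<rho> z = z"
proof (cases n)
  case 0
  have "(\<lambda>z. z) \<in> hom (ordered_chains K n) (ordered_chains K n\<lparr>carrier := ordered_cycles K n\<rparr>)"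
    by (rule homI) (auto simp: 0 ordered_cycles_def carrier_ordered_chains)
  then show ?thesis by (rule rev_bexI) simp
next
  case (Suc k)
  obtain s where s1: "s \<in> hom (ordered_chains K k\<lparr>carrier := ordered_boundaries K k\<rparr>) (ordered_chains K (Suc k))"
    and s2: "\<forall>b \<in> ordered_boundaries K k. ordered_boundary k (s b) = b"
    using ordered_boundary_section[OF K, of k] by (rule bexE)
  note s = s1 s2[rule_format]
  have bd: "ordered_boundary k c \<in> ordered_boundaries K k" if "c \<in> carrier (ordered_chains K (Suc k))" for c
    using that by (auto simp: ordered_boundaries_def carrier_ordered_chains)
  define \<rho> where "\<rho> = (\<lambda>c. c - s (ordered_boundary k c))"
  have sk: "Poly_Mapping.keys (s b) \<subseteq> ordered_simplices K (Suc k)" if "b \<in> ordered_boundaries K k" for b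
    using s(1) that by (auto simp: hom_def carrier_ordered_chains)
  have sadd: "s (a + b) = s a + s b" if "a \<in> ordered_boundaries K k" "b \<in> ordered_boundaries K k" for a b
    using hom_mult[OF s(1), of a b] that by (simp add: ordered_chains_def)
  have "s 0 = 0"
    using sadd[of 0 0] subgroup.one_closed[OF subgroup_ordered_boundaries[OF K(1), of k]] by (simp add: ordered_chains_def)
  have "\<rho> \<in> hom (ordered_chains K n) (ordered_chains K n\<lparr>carrier := ordered_cycles K n\<rparr>)"
  proof (rule homI)
    fix c assume c: "c \<in> carrier (ordered_chains K n)"
    then have keys: "Poly_Mapping.keys (\<rho> c) \<subseteq> ordered_simplices K (Suc k)"
      using keys_diff[of c "s (ordered_boundary k c)"] sk[OF bd, of c] by (auto simp: \<rho>_def Suc carrier_ordered_chains)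
    have "ordered_boundary k (\<rho> c) = 0" using s(2)[OF bd, of c] c by (simp add: \<rho>_def Suc ordered_boundary_diff)
    then show "\<rho> c \<in> carrier (ordered_chains K n\<lparr>carrier := ordered_cycles K n\<rparr>)"
      using keys by (simp add: Suc ordered_cycles_def)
    fix c' assume c': "c' \<in> carrier (ordered_chains K n)"
    then show "\<rho> (c \<otimes>\<^bsub>ordered_chains K n\<^esub> c') = \<rho> c \<otimes>\<^bsub>ordered_chains K n\<lparr>carrier := ordered_cycles K n\<rparr>\<^esub> \<rho> c'"
      using sadd[OF bd bd, of c c'] c by (simp add: \<rho>_def Suc ordered_chains_def ordered_boundary_add)
  qed
  moreover have "\<rho> z = z" if "z \<in> ordered_cycles K n" for z
    using that \<open>s 0 = 0\<close> by (simp add: \<rho>_def Suc ordered_cycles_def)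
  ultimately show ?thesis by (intro bexI[of _ \<rho>] ballI)
qed

text \<open>Here \<open>C\<close>, \<open>Z\<close> and \<open>B\<close> are the chains, cycles and boundaries of degree \<open>m\<close>, while \<open>r\<close> and \<open>t\<close> are
  induced by lifts \<open>r0\<close> and \<open>t0\<close> between the two resolutions \<open>B \<rightarrow> Z\<close> and \<open>R \<rightarrow> F\<close> of the homology group.
  A cocycle \<open>c\<close> is mapped to \<open>c \<circ> s \<circ> r\<close>, and \<open>h \<in> Hom(R,A)\<close> is mapped to \<open>h \<circ> t\<close> composed with the
  boundary. The cocycles that vanish on all cycles form the closed subgroup \<open>W\<close>, which represents
  \<open>Ext\<close>.\<close>

theorem Ph_cohomology_isomorphic_Ph_Ext:
  fixes K :: "'v set set" and A :: "'a monoid" and R :: "'r monoid" and F :: "'f monoid" and H :: "'h monoid"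
  assumes K: "abstract_simplicial_complex K" "countable K" and A: "comm_group A" "countable (carrier A)"
    and H: "group H" and q: "q \<in> epi (ordered_chains K m\<lparr>carrier := ordered_cycles K m\<rparr>) H"
    and ker_q: "kernel (ordered_chains K m\<lparr>carrier := ordered_cycles K m\<rparr>) H q = ordered_boundaries K m"
    and res: "free_resolution R i F p H"
  shows "Ph \<alpha> (cohomology_cover K A (Suc m)) \<cong>\<^sub>P Ph \<alpha> (Ext_cover R i F A)"
proof -
  let ?C = "ordered_chains K m" and ?D = "ordered_chains K (Suc m)"
  let ?Z = "?C\<lparr>carrier := ordered_cycles K m\<rparr>" and ?B = "?C\<lparr>carrier := ordered_boundaries K m\<rparr>"
  let ?G = "cohomology_cover K A (Suc m)" and ?E = "Ext_cover R i F A"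
  interpret A: comm_group A by (rule A)
  interpret H: group H by (rule H)
  have R: "comm_group R" "countable (carrier R)" and F: "comm_group F" "countable (carrier F)"
    and i: "i \<in> mon R F" and p: "p \<in> epi F H" and ip: "i ` carrier R = kernel F H p"
    using res by (auto simp: free_resolution_def free_abelian_def)
  interpret R: comm_group R by (rule R)
  interpret F: comm_group F by (rule F)
  interpret C: comm_group ?C by (rule group_ordered_chains)
  interpret D: comm_group ?D by (rule group_ordered_chains)
  obtain SF :: "'f set" where SF: "F \<cong> free_Abelian_group SF"
    using res by (auto simp: free_resolution_def free_abelian_def)
  have ih: "i \<in> hom R F" and inj: "inj_on i (carrier R)" using i by (auto simp: mon_def)
  have ph: "p \<in> hom F H" using p by (simp add: epi_def)
  have qh: "q \<in> hom ?Z H" using q by (simp add: epi_def)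
  note subZ = subgroup_ordered_cycles[of K m] and subB = subgroup_ordered_boundaries[OF K(1), of m]
  have BZ: "ordered_boundaries K m \<subseteq> ordered_cycles K m" by (rule ordered_boundaries_subset_cycles[OF K(1)])
  have ZC: "ordered_cycles K m \<subseteq> carrier ?C" by (rule subgroup.subset[OF subZ])
  have cgZ: "comm_group ?Z"
    by (rule comm_group_subgroup[OF C.comm_group_axioms subZ])
  interpret Z: comm_group ?Z by (rule cgZ)
  interpret B: group ?B by (rule subgroup.subgroup_is_group[OF subB C.is_group])
  have inv: "inv\<^bsub>?Z\<^esub> z = - z" if "z \<in> ordered_cycles K m" for z
    using that ZC by (subst C.m_inv_consistent[OF subZ]) (auto simp: ordered_chains_def)
  obtain t0 where t0': "t0 \<in> hom ?Z F" "\<forall>z \<in> ordered_cycles K m. p (t0 z) = q z"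
    using subgroup_free_Abelian_group_lift[OF countable_ordered_simplices[OF K] subZ[unfolded ordered_chains_def]
      F(1) p qh[unfolded ordered_chains_def] H] unfolding ordered_chains_def by (rule bexE)
  note t0 = t0'(1) t0'(2)[rule_format]
  obtain r0 where r0': "r0 \<in> hom F ?Z" "\<forall>x \<in> carrier F. q (r0 x) = p x"
    using free_Abelian_group_lift[OF SF F.is_group cgZ q ph H] by (rule bexE)
  note r0 = r0'(1) r0'(2)[rule_format]
  obtain s where s': "s \<in> hom ?B ?D" "\<forall>b \<in> ordered_boundaries K m. ordered_boundary m (s b) = b"
    using ordered_boundary_section[OF K, of m] by (rule bexE)
  note s = s'(1) s'(2)[rule_format]
  obtain \<rho> where \<rho>': "\<rho> \<in> hom ?C ?Z" "\<forall>z \<in> ordered_cycles K m. \<rho> z = z"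
    using ordered_cycles_retraction[OF K, of m] by (rule bexE)
  note \<rho> = \<rho>'(1) \<rho>'(2)[rule_format]
  have inclB: "(\<lambda>b. b) \<in> hom ?B ?Z" using BZ by (auto simp: hom_def)
  have bd: "ordered_boundary m \<in> hom ?D ?B"
    using hom_mult[OF ordered_boundary_hom[OF K(1)]]
    by (auto simp: hom_def ordered_boundaries_def carrier_ordered_chains)
  have "t0 \<in> hom ?B F" using hom_compose[OF inclB t0(1)] by (simp add: o_def)
  moreover have "t0 ` carrier ?B \<subseteq> i ` carrier R"
  proof -
    have "q b = \<one>\<^bsub>H\<^esub>" if "b \<in> ordered_boundaries K m" for b using that ker_q by (auto simp: kernel_def)
    then show ?thesis
      using t0 BZ unfolding ip by (auto simp: kernel_def hom_def)
  qed
  ultimately obtain t where t: "t \<in> hom ?B R" "\<And>b. b \<in> ordered_boundaries K m \<Longrightarrow> i (t b) = t0 b"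
    using mon_lift[OF i _ _ R.is_group, of t0 ?B] by auto
  have r0i: "r0 (i x) \<in> ordered_boundaries K m" if x: "x \<in> carrier R" for x
  proof -
    have "i x \<in> kernel F H p" using x ip by blast
    then have "q (r0 (i x)) = \<one>\<^bsub>H\<^esub>" "r0 (i x) \<in> ordered_cycles K m"
      using r0 by (auto simp: kernel_def hom_def)
    then show ?thesis unfolding ker_q[symmetric] by (auto simp: kernel_def)
  qed
  define r where "r = (\<lambda>x. r0 (i x))"
  have rZ: "r \<in> hom R ?Z" unfolding r_def using hom_compose[OF ih r0(1)] by (simp add: o_def)
  have r: "r \<in> hom R ?B" using r0i hom_mult[OF rZ] by (intro homI) (auto simp: r_def)
  \<comment> \<open>The homotopy on the side of \<open>Z\<close>: \<open>r0\<close> after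
    \<open>t0\<close> and the identity agree after \<open>q\<close>, so their difference takes
    values in the kernel \<open>B\<close>. The map \<open>v\<close> below plays the same part for
    \<open>F\<close>.\<close>
  define w where "w = (\<lambda>z. r0 (t0 z) - z)"
  have rt: "(\<lambda>z. r0 (t0 z)) \<in> hom ?Z ?Z" using hom_compose[OF t0(1) r0(1)] by (simp add: o_def)
  have t0F: "t0 z \<in> carrier F" if "z \<in> ordered_cycles K m" for z using t0(1) that by (auto simp: hom_def)
  have r0Z: "r0 x \<in> ordered_cycles K m" if "x \<in> carrier F" for x using r0(1) that by (auto simp: hom_def)
  have wZ: "w \<in> hom ?Z ?Z"
  proof -
    have id: "(\<lambda>z. z) \<in> hom ?Z ?Z" by (auto simp: hom_def)
    have "(\<lambda>z. r0 (t0 z) \<otimes>\<^bsub>?Z\<^esub> inv\<^bsub>?Z\<^esub> z) \<in> hom ?Z ?Z" by (rule hom_mult_inv[OF cgZ rt id])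
    moreover have "r0 (t0 z) \<otimes>\<^bsub>?Z\<^esub> inv\<^bsub>?Z\<^esub> z = w z" if "z \<in> carrier ?Z" for z
      using inv[of z] that by (simp add: w_def ordered_chains_def)
    ultimately show ?thesis by (rule hom_cong[OF _ _ Z.is_group])
  qed
  interpret q: group_hom ?Z H q by (intro group_hom.intro group_hom_axioms.intro Z.is_group H qh)
  have w: "w \<in> hom ?Z ?B"
  proof (rule homI)
    fix z assume z: "z \<in> carrier ?Z"
    then have "w z \<otimes>\<^bsub>?Z\<^esub> z = r0 (t0 z)" by (simp add: w_def ordered_chains_def)
    moreover have wz: "w z \<in> carrier ?Z" using wZ z by (auto simp: hom_def)
    ultimately have "q (w z) \<otimes>\<^bsub>H\<^esub> q z = q z"
      using q.hom_mult[OF wz z] r0(2)[OF t0F, of z] t0(2)[of z] z by simp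
    then have "q (w z) = \<one>\<^bsub>H\<^esub>" using H.r_cancel_one[OF q.hom_closed[OF z] q.hom_closed[OF wz]] by simp
    then show "w z \<in> carrier ?B" using wz unfolding ker_q[symmetric] by (simp add: kernel_def)
    fix y assume "y \<in> carrier ?Z"
    then show "w (z \<otimes>\<^bsub>?Z\<^esub> y) = w z \<otimes>\<^bsub>?B\<^esub> w y" using hom_mult[OF wZ z] by simp
  qed
  have tr: "(\<lambda>x. t0 (r0 x)) \<in> hom F F" using hom_compose[OF r0(1) t0(1)] by (simp add: o_def)
  have idF: "(\<lambda>x. x) \<in> hom F F" by (auto simp: hom_def)
  interpret p: group_hom F H p by (intro group_hom.intro group_hom_axioms.intro F.is_group H ph)
  have "(\<lambda>x. t0 (r0 x) \<otimes>\<^bsub>F\<^esub> inv\<^bsub>F\<^esub> x) ` carrier F \<subseteq> i ` carrier R"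
    unfolding ip using t0F[OF r0Z] t0(2)[OF r0Z] r0(2) by (auto simp: kernel_def)
  then obtain v where v: "v \<in> hom F R" "\<And>x. x \<in> carrier F \<Longrightarrow> i (v x) = t0 (r0 x) \<otimes>\<^bsub>F\<^esub> inv\<^bsub>F\<^esub> x"
    using mon_lift[OF i hom_mult_inv[OF F(1) tr idF] _ R.is_group] by auto
  interpret i: group_hom R F i by (intro group_hom.intro group_hom_axioms.intro F.is_group R.is_group ih)
  have tB: "t b \<in> carrier R" if "b \<in> ordered_boundaries K m" for b using t(1) that by (auto simp: hom_def)
  have rB: "r x \<in> ordered_boundaries K m" if "x \<in> carrier R" for x using r that by (auto simp: hom_def)
  \<comment> \<open>Checked after applying the injective \<open>i\<close>, where both sides become
    \<open>t0 (r x)\<close>.\<close>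
  have vi: "v (i x) \<otimes>\<^bsub>R\<^esub> x = t (r x)" if x: "x \<in> carrier R" for x
  proof -
    have vR: "v (i x) \<in> carrier R" using v(1) x by (auto simp: hom_def)
    have "i (v (i x) \<otimes>\<^bsub>R\<^esub> x) = t0 (r x) \<otimes>\<^bsub>F\<^esub> inv\<^bsub>F\<^esub> (i x) \<otimes>\<^bsub>F\<^esub> i x"
      using x vR v(2)[of "i x"] by (simp add: r_def)
    also have "\<dots> = t0 (r x)" using x t0F[OF r0Z, of "i x"] by (simp add: F.m_assoc r_def)
    also have "\<dots> = i (t (r x))" using t(2)[OF rB[OF x]] by simp
    finally show ?thesis using inj_onD[OF inj] x vR tB[OF rB[OF x]] by simp
  qed
  \<comment> \<open>\<open>s\<close> turns a boundary into a chain having it as boundary, on which a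
    cochain can be evaluated; for cochains in \<open>W\<close> the choice of that chain is
    immaterial.\<close>
  define f where "f = (\<lambda>c :: _ \<Rightarrow> 'a. \<lambda>x\<in>carrier R. c (s (r x)))"
  define g where "g = (\<lambda>h :: _ \<Rightarrow> 'a. \<lambda>x\<in>carrier ?D. h (t (ordered_boundary m x)))"
  have sr: "(\<lambda>x. s (r x)) \<in> hom R ?D" using hom_compose[OF r s(1)] by (simp add: o_def)
  have tb: "(\<lambda>x. t (ordered_boundary m x)) \<in> hom ?D R" using hom_compose[OF bd t(1)] by (simp add: o_def)
  note pre_f = continuous_map_precompose[OF R.is_group sr, of A, folded f_def]
  note pre_g = continuous_map_precompose[OF D.is_group tb, of A, folded g_def]
  have G: "carrier ?G = hom_annihilator ?D A (ordered_boundaries K (Suc m))"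
    "monoid.mult ?G = monoid.mult (hom_group ?D A)" "one ?G = one (hom_group ?D A)"
    "cover_topology ?G = subtopology (hom_topology ?D A) (hom_annihilator ?D A (ordered_boundaries K (Suc m)))"
    "cover_kernel ?G = coboundary K m ` carrier (hom_group ?C A)"
    by (simp_all add: cohomology_cover_def cocycles_eq_annihilator coboundaries_def)
  have E: "carrier ?E = carrier (hom_group R A)" "monoid.mult ?E = monoid.mult (hom_group R A)"
    "one ?E = one (hom_group R A)" "cover_topology ?E = hom_topology R A"
    "cover_kernel ?E = (\<lambda>h. \<lambda>x\<in>carrier R. h (i x)) ` carrier (hom_group F A)"
    by (simp_all add: Ext_cover_def)
  have polG: "abelian_polish_group ?G (cover_topology ?G)" by (rule cohomology_cover_polish[OF K A])
  have polE: "abelian_polish_group ?E (cover_topology ?E)"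
    unfolding E(4) by (rule abelian_polish_group_cong[OF abelian_polish_group_hom[OF R.is_group R(2) A]]) (simp_all add: E)
  define W where "W = hom_annihilator ?D A (ordered_cycles K (Suc m))"
  have W: "subgroup W ?G \<and> closedin (cover_topology ?G) W"
    unfolding W_def
    by (rule cohomology_cover_polish(2)[OF K A subgroup.subset[OF subgroup_ordered_cycles] ordered_boundaries_subset_cycles[OF K(1)]])
  have NW: "cover_kernel ?G \<subseteq> W"
  proof
    fix n assume "n \<in> cover_kernel ?G"
    then obtain b where b: "b \<in> carrier (hom_group ?C A)" "n = coboundary K m b" by (auto simp: G)
    have "(\<lambda>x\<in>carrier ?D. b (ordered_boundary m x)) \<in> carrier (hom_group ?D A)"
      using hom_group_memI[OF hom_compose[OF ordered_boundary_hom[OF K(1)] hom_groupD(1)[OF b(1)]] D.is_group]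
      by (simp add: o_def)
    moreover have "n z = \<one>\<^bsub>A\<^esub>" if "z \<in> ordered_cycles K (Suc m)" for z
      using that hom_one[OF hom_groupD(1)[OF b(1)] C.is_group A.is_group]
      by (simp add: b(2) coboundary_def ordered_cycles_def carrier_ordered_chains) (simp add: ordered_chains_def)
    ultimately show "n \<in> W" by (simp add: W_def hom_annihilator_def b(2) coboundary_def)
  qed
  have boundary_cycle: "ordered_boundary m z = 0" if "z \<in> ordered_cycles K (Suc m)" for z
    using that by (simp add: ordered_cycles_def)
  have cycleI: "z \<in> ordered_cycles K (Suc m)" if "z \<in> carrier ?D" "ordered_boundary m z = 0" for z
    using that by (simp add: ordered_cycles_def carrier_ordered_chains)
  have bB: "ordered_boundary m x \<in> ordered_boundaries K m" if "x \<in> carrier ?D" for x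
    using hom_in_carrier[OF bd that] by simp
  have t_0: "t 0 = \<one>\<^bsub>R\<^esub>" using hom_one[OF t(1) B.is_group R.is_group] by (simp add: ordered_chains_def)
  have sD: "s b \<in> carrier ?D" if "b \<in> ordered_boundaries K m" for b
    using hom_in_carrier[OF s(1)] that by simp
  have W_hom: "c \<in> carrier (hom_group ?D A)" "\<And>z. z \<in> ordered_cycles K (Suc m) \<Longrightarrow> c z = \<one>\<^bsub>A\<^esub>" if "c \<in> W" for c
    using that by (simp_all add: W_def hom_annihilator_def)
  have coboundary_hom: "coboundary K m \<in> hom (hom_group ?C A) (hom_group ?D A)"
    using continuous_map_precompose(2)[OF D.is_group ordered_boundary_hom[OF K(1)], of A]
    by (simp add: coboundary_def[abs_def])
  show ?thesis
  proof (rule Ph_isomorphic[OF polG polE])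
    show "subgroup W ?G" "closedin (cover_topology ?G) W" "cover_kernel ?G \<subseteq> W"
      using W NW by simp_all
    have WG: "W \<subseteq> carrier ?G" using W subgroup.subset by blast
    show "subgroup (cover_kernel ?G) ?G"
    proof (rule subgroup_cong)
      interpret cb: group_hom "hom_group ?C A" "hom_group ?D A" "coboundary K m"
        using comm_group_hom_group[OF C.is_group A(1)] comm_group_hom_group[OF D.is_group A(1)]
        by (intro group_hom.intro group_hom_axioms.intro coboundary_hom) (simp_all add: comm_group_def)
      show "subgroup (cover_kernel ?G) (hom_group ?D A)" unfolding G by (rule cb.img_is_subgroup)
      show "group (hom_group ?D A)" by (rule cb.H.is_group)
    qed (use abelian_polish_groupD(1)[OF polG] NW WG in \<open>auto simp: G comm_group_def hom_annihilator_def\<close>)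
    show "subgroup (cover_kernel ?E) ?E"
    proof (rule subgroup_cong)
      interpret rs: group_hom "hom_group F A" "hom_group R A" "\<lambda>h. \<lambda>x\<in>carrier R. h (i x)"
        using comm_group_hom_group[OF F.is_group A(1)] comm_group_hom_group[OF R.is_group A(1)]
        by (intro group_hom.intro group_hom_axioms.intro continuous_map_precompose(2)[OF R.is_group ih])
          (simp_all add: comm_group_def)
      show sub: "subgroup (cover_kernel ?E) (hom_group R A)" unfolding E by (rule rs.img_is_subgroup)
      show "group (hom_group R A)" by (rule rs.H.is_group)
      show "cover_kernel ?E \<subseteq> carrier ?E" using subgroup.subset[OF sub] by (simp add: E)
    qed (use abelian_polish_groupD(1)[OF polE] in \<open>auto simp: E comm_group_def\<close>)
    show "f \<in> hom ?G ?E"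
      using pre_f(2) by (auto simp: hom_def G E hom_annihilator_def)
    show "continuous_map (cover_topology ?G) (cover_topology ?E) f"
      unfolding G E by (rule continuous_map_from_subtopology[OF pre_f(1)])
    have g_mem: "g h \<in> carrier ?G" if h: "h \<in> carrier (hom_group R A)" for h
    proof -
      have "g h z = \<one>\<^bsub>A\<^esub>" if z: "z \<in> ordered_boundaries K (Suc m)" for z
      proof -
        have "z \<in> ordered_cycles K (Suc m)" using z ordered_boundaries_subset_cycles[OF K(1)] by blast
        then show ?thesis
          using boundary_cycle[of z] hom_one[OF hom_groupD(1)[OF h] R.is_group A.is_group]
            subgroup.subset[OF subgroup_ordered_cycles, of K "Suc m"]
          by (simp add: g_def t_0 subset_iff)
      qed
      then show ?thesis using hom_in_carrier[OF pre_g(2) h] by (simp add: G hom_annihilator_def)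
    qed
    then show "g \<in> hom ?E ?G"
      using pre_g(2) by (auto simp: hom_def G E)
    show "continuous_map (cover_topology ?E) (cover_topology ?G) g"
      using pre_g(1) g_mem unfolding G E by (auto simp: continuous_map_in_subtopology topspace_hom_topology)
    show "f ` cover_kernel ?G \<subseteq> cover_kernel ?E"
    proof
      fix y assume "y \<in> f ` cover_kernel ?G"
      then obtain b where b: "b \<in> carrier (hom_group ?C A)" "y = f (coboundary K m b)" by (auto simp: G)
      \<comment> \<open>The coboundary of \<open>b\<close> evaluated on \<open>s (r x)\<close> is
        \<open>b (r x)\<close>, and \<open>b\<close> composed with \<open>r0\<close> extends this
        from \<open>R\<close> to \<open>F\<close>.\<close>
      have "r0 \<in> hom F ?C" using r0(1) ZC by (auto simp: hom_def)
      from hom_group_memI[OF hom_compose[OF this hom_groupD(1)[OF b(1)]] F.is_group]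
      have k: "restrict (b \<circ> r0) (carrier F) \<in> carrier (hom_group F A)" .
      have "y = (\<lambda>x\<in>carrier R. restrict (b \<circ> r0) (carrier F) (i x))"
        unfolding b(2) f_def coboundary_def
        by (rule restrict_ext) (use rB sD s(2) in \<open>simp add: r_def\<close>)
      then show "y \<in> cover_kernel ?E" unfolding E using k by (rule image_eqI)
    qed
    show "g ` cover_kernel ?E \<subseteq> cover_kernel ?G"
    proof
      fix y assume "y \<in> g ` cover_kernel ?E"
      then obtain k where k: "k \<in> carrier (hom_group F A)" "y = g (\<lambda>x\<in>carrier R. k (i x))" by (auto simp: E)
      \<comment> \<open>\<open>k\<close> composed with \<open>t0\<close> lives only on cycles; the
        retraction \<open>\<rho>\<close> extends it to a cochain on \<open>C\<close>, unchanged on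
        the boundaries, where the coboundary evaluates it.\<close>
      have "k \<circ> (t0 \<circ> \<rho>) \<in> hom ?C A"
        using hom_compose[OF hom_compose[OF \<rho>(1) t0(1)] hom_groupD(1)[OF k(1)]] .
      from hom_group_memI[OF this C.is_group]
      have b: "restrict (k \<circ> (t0 \<circ> \<rho>)) (carrier ?C) \<in> carrier (hom_group ?C A)" .
      have "y = coboundary K m (restrict (k \<circ> (t0 \<circ> \<rho>)) (carrier ?C))"
        unfolding k(2) g_def coboundary_def
        by (rule restrict_ext) (use bB tB t(2) \<rho>(2) BZ ZC in \<open>simp add: subset_iff\<close>)
      then show "y \<in> cover_kernel ?G" unfolding G using b by (rule image_eqI)
    qed
    fix c assume c: "c \<in> W"
    note cD = W_hom[OF c]
    have sw: "s \<circ> (w \<circ> \<rho>) \<in> hom ?C ?D"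
      using hom_compose[OF hom_compose[OF \<rho>(1) w] s(1)] .
    have k: "restrict (c \<circ> (s \<circ> (w \<circ> \<rho>))) (carrier ?C) \<in> carrier (hom_group ?C A)"
      using hom_group_memI[OF hom_compose[OF sw hom_groupD(1)[OF cD(1)]] C.is_group] .
    have wB: "w z \<in> ordered_boundaries K m" if "z \<in> ordered_cycles K m" for z
      using hom_in_carrier[OF w] that by simp
    \<comment> \<open>If \<open>b\<close> is the boundary of \<open>x\<close>, then
      \<open>r (t b)\<close> is \<open>w b + b\<close>. The first summand gives the coboundary term,
      the second gives back \<open>c\<close>.\<close>
    have "g (f c) = coboundary K m (restrict (c \<circ> (s \<circ> (w \<circ> \<rho>))) (carrier ?C)) \<otimes>\<^bsub>?G\<^esub> c"
    proof -
      have "c (s (r (t b))) = c (s (w b)) \<otimes>\<^bsub>A\<^esub> c x" if x: "x \<in> carrier ?D" and b: "b = ordered_boundary m x" for x b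
      proof -
        have bb: "b \<in> ordered_boundaries K m" using bB[OF x] b by simp
        have "r (t b) = w b + b" using t(2)[OF bb] by (simp add: r_def w_def)
        then have "s (r (t b)) = s (w b) \<otimes>\<^bsub>?D\<^esub> s b"
          using hom_mult[OF s(1), of "w b" b] wB[of b] bb BZ by (auto simp: ordered_chains_def)
        then have "c (s (r (t b))) = c (s (w b)) \<otimes>\<^bsub>A\<^esub> c (s b)"
          using hom_mult[OF hom_groupD(1)[OF cD(1)] sD sD, of "w b" b] wB[of b] bb BZ by auto
        \<comment> \<open>Here membership in \<open>W\<close> is used: \<open>s b\<close> and
          \<open>x\<close> have the same boundary, so \<open>c\<close> vanishes on their
          difference.\<close>
        moreover have "c (s b) = c x"
        proof -
          have inv_x: "inv\<^bsub>?D\<^esub> x = - x" using x by (simp add: ordered_chains_def)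
          have sx: "s b \<otimes>\<^bsub>?D\<^esub> inv\<^bsub>?D\<^esub> x \<in> carrier ?D" using x sD[OF bb] by simp
          have "ordered_boundary m (s b \<otimes>\<^bsub>?D\<^esub> inv\<^bsub>?D\<^esub> x) = 0"
            unfolding inv_x using s(2)[OF bb] b by (simp add: ordered_chains_def ordered_boundary_diff)
          then have "c (s b \<otimes>\<^bsub>?D\<^esub> inv\<^bsub>?D\<^esub> x) = \<one>\<^bsub>A\<^esub>" using cD(2)[OF cycleI[OF sx]] by simp
          then have "c (s b \<otimes>\<^bsub>?D\<^esub> inv\<^bsub>?D\<^esub> x) \<otimes>\<^bsub>A\<^esub> c x = c x" using hom_groupD(3)[OF cD(1) x] by simp
          moreover have "c (s b \<otimes>\<^bsub>?D\<^esub> inv\<^bsub>?D\<^esub> x) \<otimes>\<^bsub>A\<^esub> c x = c (s b)"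
            using hom_mult[OF hom_groupD(1)[OF cD(1)] sx x] x sD[OF bb] by (simp add: D.m_assoc)
          ultimately show ?thesis by simp
        qed
        ultimately show ?thesis by simp
      qed
      then show ?thesis
        unfolding G hom_group_simps g_def f_def coboundary_def
        by (intro restrict_ext) (use bB tB \<rho>(2) BZ ZC in \<open>simp add: subset_iff\<close>)
    qed
    moreover have "coboundary K m (restrict (c \<circ> (s \<circ> (w \<circ> \<rho>))) (carrier ?C)) \<in> cover_kernel ?G"
      unfolding G using k by (rule imageI)
    ultimately show "\<exists>n\<in>cover_kernel ?G. g (f c) = n \<otimes>\<^bsub>?G\<^esub> c" by blast
  next
    fix h assume "h \<in> carrier ?E"
    then have h: "h \<in> carrier (hom_group R A)" by (simp add: E)
    have k: "restrict (h \<circ> v) (carrier F) \<in> carrier (hom_group F A)"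
      using hom_group_memI[OF hom_compose[OF v(1) hom_groupD(1)[OF h]] F.is_group] .
    \<comment> \<open>By \<open>vi\<close>, the composite of \<open>h\<close> with \<open>t\<close>
      and \<open>r\<close> exceeds \<open>h\<close> by its composite with \<open>v\<close> and
      \<open>i\<close>, which is the restriction to \<open>R\<close> of a homomorphism on
      \<open>F\<close>.\<close>
    have "f (g h) = (\<lambda>x\<in>carrier R. restrict (h \<circ> v) (carrier F) (i x)) \<otimes>\<^bsub>?E\<^esub> h"
    proof -
      have "h (t (r x)) = h (v (i x)) \<otimes>\<^bsub>A\<^esub> h x" if x: "x \<in> carrier R" for x
        using hom_mult[OF hom_groupD(1)[OF h] hom_in_carrier[OF v(1) i.hom_closed[OF x]] x] vi[OF x] by simp
      then show ?thesis
        unfolding E hom_group_simps g_def f_def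
        by (intro restrict_ext) (use rB sD s(2) in simp)
    qed
    moreover have "(\<lambda>x\<in>carrier R. restrict (h \<circ> v) (carrier F) (i x)) \<in> cover_kernel ?E"
      unfolding E using k by (rule imageI)
    ultimately show "\<exists>n\<in>cover_kernel ?E. f (g h) = n \<otimes>\<^bsub>?E\<^esub> h" by blast
  qed
qed

theorem theorem7p6:
  fixes Y :: "'y topology" and K :: "'v set set" and A :: "'a monoid" and \<alpha> :: omega1
    and d :: nat and R :: "'r monoid" and F :: "'f monoid"
    and i :: "'r \<Rightarrow> 'f" and p :: "'f \<Rightarrow> 'y chain set"
  assumes "abstract_simplicial_complex K" and "countable K" and "locally_finite_complex K"
    and "Y homotopy_equivalent_space geometric_realization K"
    and "comm_group A" and "countable (carrier A)"
    and "d \<ge> 1"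
    and "free_resolution R i F p (homology_group (int d - 1) Y)"
  shows "Ph \<alpha> (cohomology_cover K A d) \<cong>\<^sub>P Ph \<alpha> (Ext_cover R i F A)"
proof -
  obtain m where d: "d = Suc m" using assms(7) by (cases d) auto
  let ?Z = "ordered_chains K m\<lparr>carrier := ordered_cycles K m\<rparr>"
  let ?HK = "homology_group (int m) (geometric_realization K)" and ?HY = "homology_group (int m) Y"
  obtain q where q: "q \<in> epi ?Z ?HK" "kernel ?Z ?HK q = ordered_boundaries K m"
    using ordered_homology_epi[OF assms(1,3)] by metis
  have "geometric_realization K homotopy_equivalent_space Y"
    using assms(4) homotopy_equivalent_space_sym by blast
  \<comment> \<open>An isomorphism applied after \<open>q\<close> leaves the kernel unchanged, so
    the cycles and boundaries of |K| also present the homology of \<open>Y\<close>, in degree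
    \<open>m\<close> with \<open>d = Suc m\<close>.\<close>
  then have "?HK \<cong> ?HY" by (rule homotopy_equivalent_space_imp_isomorphic_homology_groups)
  then obtain \<phi> where \<phi>: "\<phi> \<in> iso ?HK ?HY" by (auto simp: is_iso_def)
  then have \<phi>h: "\<phi> \<in> hom ?HK ?HY" and \<phi>b: "bij_betw \<phi> (carrier ?HK) (carrier ?HY)" by (auto simp: iso_def)
  have qh: "q \<in> hom ?Z ?HK" "q ` carrier ?Z = carrier ?HK" using q(1) by (auto simp: epi_def)
  have "(\<phi> \<circ> q) ` carrier ?Z = carrier ?HY"
    unfolding image_comp[symmetric] qh(2) by (rule bij_betw_imp_surj_on[OF \<phi>b])
  then have "\<phi> \<circ> q \<in> epi ?Z ?HY"
    using hom_compose[OF qh(1) \<phi>h] by (simp add: epi_def)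
  moreover have "kernel ?Z ?HY (\<phi> \<circ> q) = ordered_boundaries K m"
  proof -
    have "\<phi> y = \<one>\<^bsub>?HY\<^esub> \<longleftrightarrow> y = \<one>\<^bsub>?HK\<^esub>" if y: "y \<in> carrier ?HK" for y
      using bij_betw_imp_inj_on[OF \<phi>b] y hom_one[OF \<phi>h] group.is_monoid[of ?HK]
      by (metis group_relative_homology_group inj_onD monoid.one_closed)
    then show ?thesis
      unfolding q(2)[symmetric] using hom_in_carrier[OF qh(1)] by (auto simp: kernel_def)
  qed
  moreover have "free_resolution R i F p ?HY" using assms(8) by (simp add: d)
  ultimately show ?thesis
    unfolding d by (intro Ph_cohomology_isomorphic_Ph_Ext[OF assms(1,2,5,6) group_relative_homology_group])
qed

end
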